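(* Let $(M,g)$ be an oriented Riemannian four-manifold and let $f,\lambda\in C^\infty(M)$ satisfy $$\mathrm{Ric}+\nabla^2f+\frac12\,df\otimes df=\lambda g$$ (so that $(M,g,f)$ is conformally Einstein, $e^{-f}g$ being an Einstein metric). Then, for each choice of sign $\pm$ (the same throughout), $$\Delta_f|W^{\pm}|^2=2|\nabla W^{\pm}|^2+\big(4\lambda-|\nabla f|^2\big)|W^{\pm}|^2-36\det W^{\pm}.$$
   Context: Curvature sign convention: $K(e_i,e_j)=R_{ijij}$ for orthonormal $e_i,e_j$, $R_{ik}=g^{jl}R_{ijkl}$. $W$ is the Weyl tensor, viewed as a $(0,4)$-tensor and as the symmetric operator on $\wedge^2TM$ with $\langle W(e_i\wedge e_j),e_k\wedge e_l\rangle=W_{ijkl}$, where $\{e_i\wedge e_j\}_{i<j}$ is orthonormal for an orthonormal frame $\{e_i\}$. The Hodge star gives $\wedge^2TM=\wedge^+M\oplus\wedge^-M$ ($\pm1$ eigenbundles), and $W^{\pm}$ are the self-dual and anti-self-dual parts of $W$, i.e. $W^{\pm}(\alpha,\beta)=W(\alpha^{\pm},\beta^{\pm})$ with $\alpha^\pm$ the projection of $\alpha$ to $\wedge^\pm M$; $\det W^{\pm}$ is the determinant of $W^{\pm}$ as an endomorphism of the rank-3 bundle $\wedge^{\pm}M$. Inner product of $(0,4)$-tensors: $\langle S,T\rangle=\frac14S_{ijkl}T^{ijkl}$, $|T|^2=\langle T,T\rangle$, $|\nabla T|^2=\frac14\nabla_pT_{ijkl}\nabla^pT^{ijkl}$.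 Also $\Delta_f=\Delta-\langle\nabla f,\nabla\,\cdot\,\rangle$, where $\Delta=\nabla^p\nabla_p$. *)

theory Defs
  imports "HOL-Analysis.Analysis"
begin

section \<open>Smooth functions on open subsets of Euclidean 4-space\<close>

definition pd :: "4 \<Rightarrow> (real^4 \<Rightarrow> real) \<Rightarrow> real^4 \<Rightarrow> real" where
  "pd i F x = frechet_derivative F (at x) (axis i 1)"

primrec Ck_on :: "nat \<Rightarrow> (real^4 \<Rightarrow> real) \<Rightarrow> (real^4) set \<Rightarrow> bool" where
  "Ck_on 0 F S \<longleftrightarrow> continuous_on S F"
| "Ck_on (Suc k) F S \<longleftrightarrow> (\<forall>x\<in>S. F differentiable (at x)) \<and> (\<forall>i. Ck_on k (pd i F) S)"

definition smooth_on :: "(real^4 \<Rightarrow> real) \<Rightarrow> (real^4) set \<Rightarrow> bool" where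
  "smooth_on F S \<longleftrightarrow> (\<forall>k. Ck_on k F S)"


section \<open>Oriented Riemannian four-manifolds\<close>

text \<open>A chart is its domain together with its coordinate map.\<close>

type_synonym 'a chart = "'a set \<times> ('a \<Rightarrow> real^4)"

definition chart_range :: "'a chart \<Rightarrow> (real^4) set" where
  "chart_range c = snd c ` fst c"

definition chart_inv :: "'a chart \<Rightarrow> real^4 \<Rightarrow> 'a" where
  "chart_inv c = inv_into (fst c) (snd c)"

definition transition :: "'a chart \<Rightarrow> 'a chart \<Rightarrow> real^4 \<Rightarrow> real^4" where
  "transition c d = snd d \<circ> chart_inv c"

text \<open>The orientation is the one for which all charts of the atlas are positively oriented.
  The atlas need not be maximal.\<close>

definition oriented_4manifold :: "'a topology \<Rightarrow> 'a chart set \<Rightarrow> bool" where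
  "oriented_4manifold M A \<longleftrightarrow>
     Hausdorff_space M \<and> second_countable M \<and>
     (\<Union>c\<in>A. fst c) = topspace M \<and>
     (\<forall>c\<in>A. openin M (fst c) \<and> open (chart_range c) \<and>
        homeomorphic_map (subtopology M (fst c)) (top_of_set (chart_range c)) (snd c)) \<and>
     (\<forall>c\<in>A. \<forall>d\<in>A.
        (\<forall>i. smooth_on (\<lambda>x. transition c d x $ i) (snd c ` (fst c \<inter> fst d))) \<and>
        (\<forall>x\<in>snd c ` (fst c \<inter> fst d). det (jacobian (transition c d) (at x)) > 0))"

text \<open>A tangent vector at \<open>p\<close> is given by its coordinate columns in the charts around \<open>p\<close>, which
  are related by the Jacobians of the transition maps; its entry at every other chart is \<open>0\<close>.\<close>

type_synonym 'a tangent = "'a chart \<Rightarrow> real^4"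

definition tangent_space :: "'a chart set \<Rightarrow> 'a \<Rightarrow> 'a tangent set" where
  "tangent_space A p =
     {v. (\<forall>c\<in>A. \<forall>d\<in>A. p \<in> fst c \<inter> fst d \<longrightarrow>
            v d = jacobian (transition c d) (at (snd c p)) *v v c) \<and>
         (\<forall>c. c \<notin> A \<or> p \<notin> fst c \<longrightarrow> v c = 0)}"

definition coord_vec :: "'a chart set \<Rightarrow> 'a \<Rightarrow> 'a chart \<Rightarrow> 4 \<Rightarrow> 'a tangent" where
  "coord_vec A p c i =
     (\<lambda>d. if d \<in> A \<and> p \<in> fst d
          then jacobian (transition c d) (at (snd c p)) *v axis i 1 else 0)"

type_synonym 'a metric_field = "'a \<Rightarrow> 'a tangent \<Rightarrow> 'a tangent \<Rightarrow> real"

definition inner_product_on_tangent :: "'a tangent set \<Rightarrow> ('a tangent \<Rightarrow> 'a tangent \<Rightarrow> real) \<Rightarrow> bool" where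
  "inner_product_on_tangent T h \<longleftrightarrow>
     (\<forall>u\<in>T. \<forall>v\<in>T. h u v = h v u) \<and>
     (\<forall>u\<in>T. \<forall>v\<in>T. \<forall>w\<in>T. \<forall>a b. h (\<lambda>c. a *\<^sub>R u c + b *\<^sub>R v c) w = a * h u w + b * h v w) \<and>
     (\<forall>v\<in>T. v \<noteq> (\<lambda>c. 0) \<longrightarrow> h v v > 0)"

definition metric_comp :: "'a chart set \<Rightarrow> 'a metric_field \<Rightarrow> 'a chart \<Rightarrow> real^4 \<Rightarrow> real^4^4" where
  "metric_comp A g c x =
     (\<chi> i j. g (chart_inv c x) (coord_vec A (chart_inv c x) c i) (coord_vec A (chart_inv c x) c j))"

definition riemannian_metric :: "'a topology \<Rightarrow> 'a chart set \<Rightarrow> 'a metric_field \<Rightarrow> bool" where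
  "riemannian_metric M A g \<longleftrightarrow>
     (\<forall>p\<in>topspace M. inner_product_on_tangent (tangent_space A p) (g p)) \<and>
     (\<forall>c\<in>A. \<forall>i j. smooth_on (\<lambda>x. metric_comp A g c x $ i $ j) (chart_range c))"

definition smooth_function :: "'a chart set \<Rightarrow> ('a \<Rightarrow> real) \<Rightarrow> bool" where
  "smooth_function A f \<longleftrightarrow> (\<forall>c\<in>A. smooth_on (f \<circ> chart_inv c) (chart_range c))"


section \<open>Tensor calculus in a coordinate chart\<close>

text \<open>In the following, \<open>G\<close> is the matrix field of the metric in some chart, and \<open>h\<close> is its value at
  a point. Tensors are given by their components with respect to the coordinate frame.\<close>

type_synonym tensor4 = "4 \<Rightarrow> 4 \<Rightarrow> 4 \<Rightarrow> 4 \<Rightarrow> real"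

definition ginv :: "real^4^4 \<Rightarrow> 4 \<Rightarrow> 4 \<Rightarrow> real" where
  "ginv h i j = matrix_inv h $ i $ j"

definition christoffel :: "(real^4 \<Rightarrow> real^4^4) \<Rightarrow> real^4 \<Rightarrow> 4 \<Rightarrow> 4 \<Rightarrow> 4 \<Rightarrow> real" where
  \<comment> \<open>the first index is the upper one\<close>
  "christoffel G x m i j =
     1/2 * (\<Sum>l\<in>UNIV. ginv (G x) m l *
       (pd i (\<lambda>y. G y $ j $ l) x + pd j (\<lambda>y. G y $ i $ l) x - pd l (\<lambda>y. G y $ i $ j) x))"

text \<open>Sign: \<open>R\<^sub>i\<^sub>j\<^sub>k\<^sub>l = \<langle>R(\<partial>\<^sub>i,\<partial>\<^sub>j)\<partial>\<^sub>l, \<partial>\<^sub>k\<rangle>\<close> with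
  \<open>R(X,Y) = \<nabla>\<^sub>X\<nabla>\<^sub>Y - \<nabla>\<^sub>Y\<nabla>\<^sub>X - \<nabla>\<^bsub>[X,Y]\<^esub>\<close>,
  so that \<open>R\<^sub>i\<^sub>j\<^sub>i\<^sub>j\<close> is the sectional curvature in an orthonormal frame.\<close>

definition riemann :: "(real^4 \<Rightarrow> real^4^4) \<Rightarrow> real^4 \<Rightarrow> tensor4" where
  "riemann G x i j k l =
     (\<Sum>m\<in>UNIV. G x $ k $ m *
       (pd i (\<lambda>y. christoffel G y m j l) x - pd j (\<lambda>y. christoffel G y m i l) x
        + (\<Sum>n\<in>UNIV. christoffel G x m i n * christoffel G x n j l
                    - christoffel G x m j n * christoffel G x n i l)))"

definition ricci :: "(real^4 \<Rightarrow> real^4^4) \<Rightarrow> real^4 \<Rightarrow> 4 \<Rightarrow> 4 \<Rightarrow> real" where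
  "ricci G x i k = (\<Sum>j\<in>UNIV. \<Sum>l\<in>UNIV. ginv (G x) j l * riemann G x i j k l)"

definition scalar_curv :: "(real^4 \<Rightarrow> real^4^4) \<Rightarrow> real^4 \<Rightarrow> real" where
  "scalar_curv G x = (\<Sum>i\<in>UNIV. \<Sum>k\<in>UNIV. ginv (G x) i k * ricci G x i k)"

text \<open>The coefficients \<open>1/2\<close> and \<open>1/6\<close> are \<open>1/(n-2)\<close> and \<open>1/((n-1)(n-2))\<close> in dimension \<open>n = 4\<close>.\<close>

definition weyl :: "(real^4 \<Rightarrow> real^4^4) \<Rightarrow> real^4 \<Rightarrow> tensor4" where
  "weyl G x i j k l =
     riemann G x i j k l
     - 1/2 * (G x $ i $ k * ricci G x j l + G x $ j $ l * ricci G x i k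
              - G x $ i $ l * ricci G x j k - G x $ j $ k * ricci G x i l)
     + scalar_curv G x / 6 * (G x $ i $ k * G x $ j $ l - G x $ i $ l * G x $ j $ k)"

definition hessian :: "(real^4 \<Rightarrow> real^4^4) \<Rightarrow> (real^4 \<Rightarrow> real) \<Rightarrow> real^4 \<Rightarrow> 4 \<Rightarrow> 4 \<Rightarrow> real" where
  "hessian G F x i j = pd i (pd j F) x - (\<Sum>m\<in>UNIV. christoffel G x m i j * pd m F x)"

definition laplacian :: "(real^4 \<Rightarrow> real^4^4) \<Rightarrow> (real^4 \<Rightarrow> real) \<Rightarrow> real^4 \<Rightarrow> real" where
  "laplacian G F x = (\<Sum>i\<in>UNIV. \<Sum>j\<in>UNIV. ginv (G x) i j * hessian G F x i j)"

definition grad_inner :: "(real^4 \<Rightarrow> real^4^4) \<Rightarrow> (real^4 \<Rightarrow> real) \<Rightarrow> (real^4 \<Rightarrow> real) \<Rightarrow> real^4 \<Rightarrow> real" where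
  "grad_inner G F H x = (\<Sum>i\<in>UNIV. \<Sum>j\<in>UNIV. ginv (G x) i j * pd i F x * pd j H x)"

definition drift_laplacian ::
    "(real^4 \<Rightarrow> real^4^4) \<Rightarrow> (real^4 \<Rightarrow> real) \<Rightarrow> (real^4 \<Rightarrow> real) \<Rightarrow> real^4 \<Rightarrow> real" where
  "drift_laplacian G F H x = laplacian G H x - grad_inner G F H x"

definition tensor_inner :: "real^4^4 \<Rightarrow> tensor4 \<Rightarrow> tensor4 \<Rightarrow> real" where
  "tensor_inner h S T =
     1/4 * (\<Sum>i\<in>UNIV. \<Sum>j\<in>UNIV. \<Sum>k\<in>UNIV. \<Sum>l\<in>UNIV. S i j k l *
       (\<Sum>a\<in>UNIV. \<Sum>b\<in>UNIV. \<Sum>c\<in>UNIV. \<Sum>d\<in>UNIV.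
          ginv h i a * ginv h j b * ginv h k c * ginv h l d * T a b c d))"

definition tensor_norm2 :: "(real^4 \<Rightarrow> real^4^4) \<Rightarrow> (real^4 \<Rightarrow> tensor4) \<Rightarrow> real^4 \<Rightarrow> real" where
  "tensor_norm2 G T x = tensor_inner (G x) (T x) (T x)"

definition cov_deriv :: "(real^4 \<Rightarrow> real^4^4) \<Rightarrow> (real^4 \<Rightarrow> tensor4) \<Rightarrow> real^4 \<Rightarrow> 4 \<Rightarrow> tensor4" where
  "cov_deriv G T x p i j k l =
     pd p (\<lambda>y. T y i j k l) x
     - (\<Sum>m\<in>UNIV. christoffel G x m p i * T x m j k l + christoffel G x m p j * T x i m k l
                  + christoffel G x m p k * T x i j m l + christoffel G x m p l * T x i j k m)"

definition cov_deriv_norm2 :: "(real^4 \<Rightarrow> real^4^4) \<Rightarrow> (real^4 \<Rightarrow> tensor4) \<Rightarrow> real^4 \<Rightarrow> real" where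
  "cov_deriv_norm2 G T x =
     (\<Sum>p\<in>UNIV. \<Sum>q\<in>UNIV. ginv (G x) p q * tensor_inner (G x) (cov_deriv G T x p) (cov_deriv G T x q))"


section \<open>Bivectors, Hodge star, and the self-dual and anti-self-dual parts\<close>

text \<open>A bivector \<open>1/2 \<alpha>\<^sup>i\<^sup>j \<partial>\<^sub>i \<and> \<partial>\<^sub>j\<close> is given by the antisymmetric matrix \<open>\<alpha>\<^sup>i\<^sup>j\<close>.\<close>

definition bivectors :: "(real^4^4) set" where
  "bivectors = {\<alpha>. transpose \<alpha> = - \<alpha>}"

definition wedge :: "real^4 \<Rightarrow> real^4 \<Rightarrow> real^4^4" where
  "wedge u v = (\<chi> i j. u $ i * v $ j - u $ j * v $ i)"

definition tensor_form :: "tensor4 \<Rightarrow> real^4^4 \<Rightarrow> real^4^4 \<Rightarrow> real" where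
  "tensor_form T \<alpha> \<beta> =
     1/4 * (\<Sum>i\<in>UNIV. \<Sum>j\<in>UNIV. \<Sum>k\<in>UNIV. \<Sum>l\<in>UNIV. T i j k l * \<alpha> $ i $ j * \<beta> $ k $ l)"

text \<open>The operator \<open>T\<close> on bivectors with \<open>\<langle>T \<alpha>, \<beta>\<rangle> = T(\<alpha>,\<beta>)\<close>, for the inner product
  \<open>\<langle>\<alpha>,\<beta>\<rangle> = 1/2 \<alpha>\<^sup>i\<^sup>j \<beta>\<^sub>i\<^sub>j\<close>, in which \<open>e\<^sub>i \<and> e\<^sub>j\<close> (\<open>i < j\<close>) are orthonormal if the \<open>e\<^sub>i\<close> are.\<close>

definition tensor_op :: "real^4^4 \<Rightarrow> tensor4 \<Rightarrow> real^4^4 \<Rightarrow> real^4^4" where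
  "tensor_op h T \<alpha> =
     (\<chi> k l. 1/2 * (\<Sum>i\<in>UNIV. \<Sum>j\<in>UNIV. \<Sum>a\<in>UNIV. \<Sum>b\<in>UNIV.
        T i j a b * ginv h a k * ginv h b l * \<alpha> $ i $ j))"

definition volume_form :: "real^4^4 \<Rightarrow> tensor4" where
  "volume_form h i j k l =
     sqrt (det h) * det (vector [axis i 1, axis j 1, axis k 1, axis l 1] :: real^4^4)"

text \<open>This is the operator with \<open>*(e\<^sub>1 \<and> e\<^sub>2) = e\<^sub>3 \<and> e\<^sub>4\<close> for oriented orthonormal frames.\<close>

definition hodge_star :: "real^4^4 \<Rightarrow> real^4^4 \<Rightarrow> real^4^4" where
  "hodge_star h = tensor_op h (volume_form h)"

text \<open>The sign \<open>s = 1\<close> stands for self-dual, \<open>s = -1\<close> for anti-self-dual.\<close>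

definition dual_space :: "real \<Rightarrow> real^4^4 \<Rightarrow> (real^4^4) set" where
  "dual_space s h = {\<alpha>\<in>bivectors. hodge_star h \<alpha> = s *\<^sub>R \<alpha>}"

text \<open>On bivectors, these are the projections of the decomposition into the two eigenspaces,
  since the star operator is an involution.\<close>

definition dual_proj :: "real \<Rightarrow> real^4^4 \<Rightarrow> real^4^4 \<Rightarrow> real^4^4" where
  "dual_proj s h \<alpha> = (1/2) *\<^sub>R (\<alpha> + s *\<^sub>R hodge_star h \<alpha>)"

definition weyl_dual :: "real \<Rightarrow> (real^4 \<Rightarrow> real^4^4) \<Rightarrow> real^4 \<Rightarrow> tensor4" where
  "weyl_dual s G x i j k l =
     tensor_form (weyl G x)
       (dual_proj s (G x) (wedge (axis i 1) (axis j 1)))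
       (dual_proj s (G x) (wedge (axis k 1) (axis l 1)))"

text \<open>Determinant of an endomorphism \<open>T\<close> of a three-dimensional subspace \<open>V\<close>: the determinant of its
  matrix with respect to any basis of \<open>V\<close>.\<close>

definition endo_det3 :: "'v::real_vector set \<Rightarrow> ('v \<Rightarrow> 'v) \<Rightarrow> real" where
  "endo_det3 V T =
     (THE d. \<exists>(b :: 3 \<Rightarrow> 'v) (B :: real^3^3).
        inj b \<and> independent (range b) \<and> span (range b) = V \<and>
        (\<forall>j. T (b j) = (\<Sum>i\<in>UNIV. B $ i $ j *\<^sub>R b i)) \<and> d = det B)"

definition det_weyl_dual :: "real \<Rightarrow> (real^4 \<Rightarrow> real^4^4) \<Rightarrow> real^4 \<Rightarrow> real" where
  "det_weyl_dual s G x = endo_det3 (dual_space s (G x)) (tensor_op (G x) (weyl_dual s G x))"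

end

theory Submission
  imports Defs
begin

text \<open>In an orthonormal frame \<open>W\<^sup>\<plusminus>\<close> becomes a trace-free symmetric \<open>3 \<times> 3\<close> matrix \<open>A\<close>, and the basic
  (anti-)self-dual two-forms become almost complex structures \<open>J\<^sub>\<beta>\<close> satisfying the quaternion relations.
  By the hypothesis, the Levi-Civita connection of \<open>e\<^sup>-\<^sup>f g\<close>, written in the rescaled frame, has curvature
  \<open>W + \<rho> id\<close>. Its second Bianchi identity, projected to \<open>\<and>\<^sup>\<plusminus>\<close>, gives \<open>\<rho>\<close> its conformal weight and
  yields the first order system \<open>\<Sum>\<^sub>\<beta> J\<^sub>\<beta> X\<^sub>\<alpha>\<^sub>\<beta> = 0\<close> for \<open>X = \<nabla>A - A \<nabla>f / 2\<close>; no contracted Bianchi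
  identity and no Ricci identity for \<open>f\<close> are needed. Differentiating this system and multiplying by
  \<open>J\<^sub>\<gamma>\<close> expresses the divergence of \<open>X\<close> through commutators \<open>[\<nabla>\<^sub>i, \<nabla>\<^sub>j] A\<close>, that is, through the
  curvature of \<open>\<and>\<^sup>\<plusminus>\<close>, of which only the block \<open>A + R/12\<close> enters. Pairing with \<open>A\<close> gives the cubic term
  \<open>- 18 det A\<close>, and the trace of the hypothesis eliminates \<open>R\<close> and \<open>\<Delta>f\<close>.\<close>

section \<open>Partial derivatives and smooth functions\<close>

text \<open>For u = - f/2 the Schouten tensor of exp(2u) g is that of g, minus the Hessian of u,
  plus du tensor du, minus |du|^2 g / 2. The hypothesis turns this into half of (\<lambda> - R/6 -
  |du|^2) g, which is why the curvature beside W is a multiple of the identity. The change of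
  connection caused by du acts, after wedging with the basic two-forms, as du on the trace-free A
  and as - 2 du on the multiple of the identity; symmetry and trace then separate the two parts.
  Since so(4) is a sum of two copies of so(3), a frame makes each half of the bivectors a bundle
  with a skew 3 by 3 connection matrix, so that curvature, Bianchi identity and commutators become
  matrix calculus. Both signs are treated at once, the algebra using only s * s = 1. The cubic term
  is a determinant because tr A^3 = 3 det A for trace-free A, and the Laplacian of |A|^2 doubles 18
  to 36. The terms in which A is paired with its derivative along the gradient of f cancel against
  the drift.\<close>

lemma pd_eqI:
  assumes "(F has_derivative D) (at x)"
  shows "pd i F x = D (axis i 1)"
  unfolding pd_def using frechet_derivative_at[OF assms] by simp

lemma pd_cong_open:
  assumes "open S" "x \<in> S" "\<And>y. y \<in> S \<Longrightarrow> F y = H y"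
  shows "pd i F x = pd i H x"
proof -
  have "(F has_derivative D) (at x) \<longleftrightarrow> (H has_derivative D) (at x)" for D
    using has_derivative_transform_within_open[OF _ assms(1,2), where f = F and g = H]
      has_derivative_transform_within_open[OF _ assms(1,2), where f = H and g = F] assms(3) by auto
  then show ?thesis unfolding pd_def frechet_derivative_def by simp
qed

lemma differentiable_cong_open:
  assumes "open S" "x \<in> S" "\<And>y. y \<in> S \<Longrightarrow> F y = H y" "F differentiable (at x)"
  shows "H differentiable (at x)"
proof -
  obtain D where "(F has_derivative D) (at x)" using assms(4) unfolding differentiable_def by blast
  from has_derivative_transform_within_open[OF this assms(1,2,3)] show ?thesis
    by (rule differentiableI)
qed

lemma has_derivative_pd:
  assumes "F differentiable (at x)"
  shows "(F has_derivative frechet_derivative F (at x)) (at x)"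
  using assms frechet_derivative_works by blast

lemma pd_const [simp]: "pd i (\<lambda>y. c) x = 0"
  by (rule pd_eqI[THEN trans]) (auto intro: derivative_intros)

lemma pd_add:
  assumes "F differentiable (at x)" "H differentiable (at x)"
  shows "pd i (\<lambda>y. F y + H y) x = pd i F x + pd i H x"
  by (subst pd_eqI[OF has_derivative_add[OF assms[THEN has_derivative_pd]]]) (simp add: pd_def)

lemma pd_diff:
  assumes "F differentiable (at x)" "H differentiable (at x)"
  shows "pd i (\<lambda>y. F y - H y) x = pd i F x - pd i H x"
  by (subst pd_eqI[OF has_derivative_diff[OF assms[THEN has_derivative_pd]]]) (simp add: pd_def)

lemma pd_uminus:
  assumes "F differentiable (at x)"
  shows "pd i (\<lambda>y. - F y) x = - pd i F x"
  by (subst pd_eqI[OF has_derivative_minus[OF assms[THEN has_derivative_pd]]]) (simp add: pd_def)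

lemma pd_mult:
  assumes "F differentiable (at x)" "H differentiable (at x)"
  shows "pd i (\<lambda>y. F y * H y) x = pd i F x * H x + F x * pd i H x"
  by (subst pd_eqI[OF has_derivative_mult[OF assms[THEN has_derivative_pd]]]) (simp add: pd_def)

lemma pd_cmult:
  assumes "F differentiable (at x)"
  shows "pd i (\<lambda>y. c * F y) x = c * pd i F x"
  by (subst pd_mult) (use assms in auto)

lemma pd_sum:
  assumes "\<And>k. k \<in> K \<Longrightarrow> F k differentiable (at x)"
  shows "pd i (\<lambda>y. \<Sum>k\<in>K. F k y) x = (\<Sum>k\<in>K. pd i (F k) x)"
  by (subst pd_eqI[OF has_derivative_sum[OF assms[THEN has_derivative_pd]]]) (simp_all add: pd_def)

lemma pd_inverse:
  assumes "F differentiable (at x)" "F x \<noteq> (0::real)"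
  shows "pd i (\<lambda>y. inverse (F y)) x = - (inverse (F x) * inverse (F x) * pd i F x)"
  by (subst pd_eqI[OF Deriv.has_derivative_inverse[OF assms(2) has_derivative_pd[OF assms(1)]]])
    (simp add: pd_def)

lemma pd_sqrt:
  assumes "F differentiable (at x)" "F x > 0"
  shows "pd i (\<lambda>y. sqrt (F y)) x = pd i F x * inverse (2 * sqrt (F x))"
  by (subst pd_eqI[OF has_derivative_real_sqrt[OF assms(2) has_derivative_pd[OF assms(1)]]])
    (simp add: pd_def field_simps)

section \<open>Closure properties of C^k and smooth functions on open sets\<close>

lemma Ck_on_cong:
  assumes "open S" "\<And>y. y \<in> S \<Longrightarrow> F y = H y" "Ck_on k F S"
  shows "Ck_on k H S"
  using assms(2,3)
proof (induction k arbitrary: F H)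
  case 0
  then show ?case using continuous_on_cong[of S S F H] by simp
next
  case (Suc k)
  have "pd i F y = pd i H y" if "y \<in> S" for i y
    using pd_cong_open[OF assms(1) that] Suc.prems(1) by blast
  then have "Ck_on k (pd i H) S" for i
    using Suc.IH[of "pd i F" "pd i H"] Suc.prems(2) by auto
  then show ?case
    using Suc.prems differentiable_cong_open[OF assms(1), of _ F H] by auto
qed

lemma Ck_on_Suc: "Ck_on (Suc k) F S \<Longrightarrow> Ck_on k F S"
proof (induction k arbitrary: F)
  case 0
  then show ?case
    using differentiable_imp_continuous_within[of F _ UNIV]
    by (simp add: continuous_at_imp_continuous_on)
next
  case (Suc k)
  then show ?case by auto
qed

lemma Ck_on_const: "Ck_on k (\<lambda>y. c) S"
proof (induction k arbitrary: c)
  case (Suc k)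
  have "pd i (\<lambda>y. c) = (\<lambda>y. 0)" for i by (rule ext) simp
  then show ?case using Suc by simp
qed simp

lemma Ck_on_add:
  assumes "open S" "Ck_on k F S" "Ck_on k H S"
  shows "Ck_on k (\<lambda>y. F y + H y) S"
  using assms(2,3)
proof (induction k arbitrary: F H)
  case 0
  then show ?case using continuous_on_add[of S F H] by simp
next
  case (Suc k)
  have "Ck_on k (pd i (\<lambda>y. F y + H y)) S" for i
    by (rule Ck_on_cong[OF assms(1) _ Suc.IH[of "pd i F" "pd i H"]])
      (use Suc.prems in \<open>auto simp: pd_add\<close>)
  then show ?case using Suc.prems by auto
qed

lemma Ck_on_mult:
  assumes "open S" "Ck_on k F S" "Ck_on k H S"
  shows "Ck_on k (\<lambda>y. F y * H y) S"
  using assms(2,3)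
proof (induction k arbitrary: F H)
  case 0
  then show ?case using continuous_on_mult[of S F H] by simp
next
  case (Suc k)
  have "Ck_on k (\<lambda>y. pd i F y * H y + F y * pd i H y) S" for i
    using Suc.prems Suc.prems[THEN Ck_on_Suc] by (intro Ck_on_add[OF assms(1)] Suc.IH) auto
  then have "Ck_on k (pd i (\<lambda>y. F y * H y)) S" for i
    by (rule Ck_on_cong[OF assms(1), rotated]) (use Suc.prems in \<open>auto simp: pd_mult\<close>)
  then show ?case using Suc.prems by auto
qed

lemma Ck_on_inverse:
  assumes "open S" "Ck_on k F S" "\<And>y. y \<in> S \<Longrightarrow> F y \<noteq> 0"
  shows "Ck_on k (\<lambda>y. inverse (F y)) S"
  using assms(2)
proof (induction k)
  case 0
  then have "continuous_on S (\<lambda>y. inverse (F y))"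
    using assms(3) by (intro continuous_intros) auto
  then show ?case by simp
next
  case (Suc k)
  have IH: "Ck_on k (\<lambda>y. inverse (F y)) S" by (rule Suc.IH[OF Ck_on_Suc[OF Suc.prems]])
  have "Ck_on k (\<lambda>y. - 1 * (inverse (F y) * inverse (F y) * pd i F y)) S" for i
    using Suc.prems IH by (intro Ck_on_mult[OF assms(1)] Ck_on_const) auto
  then have "Ck_on k (pd i (\<lambda>y. inverse (F y))) S" for i
    by (rule Ck_on_cong[OF assms(1), rotated])
      (use Suc.prems in \<open>auto simp: pd_inverse assms(3)\<close>)
  then show ?case using Suc.prems assms(3) by auto
qed

lemma Ck_on_sqrt:
  assumes "open S" "Ck_on k F S" "\<And>y. y \<in> S \<Longrightarrow> F y > 0"
  shows "Ck_on k (\<lambda>y. sqrt (F y)) S"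
  using assms(2)
proof (induction k)
  case 0
  then have "continuous_on S (\<lambda>y. sqrt (F y))"
    by (intro continuous_intros) auto
  then show ?case by simp
next
  case (Suc k)
  have IH: "Ck_on k (\<lambda>y. sqrt (F y)) S" by (rule Suc.IH[OF Ck_on_Suc[OF Suc.prems]])
  have "Ck_on k (\<lambda>y. pd i F y * inverse (2 * sqrt (F y))) S" for i
    using Suc.prems IH less_imp_neq[OF assms(3)]
    by (intro Ck_on_mult[OF assms(1)] Ck_on_const Ck_on_inverse[OF assms(1)]) auto
  then have "Ck_on k (pd i (\<lambda>y. sqrt (F y))) S" for i
    by (rule Ck_on_cong[OF assms(1), rotated]) (use Suc.prems in \<open>auto simp: pd_sqrt assms(3)\<close>)
  moreover have "(\<lambda>y. sqrt (F y)) differentiable at y" if "y \<in> S" for y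
    using has_derivative_real_sqrt[OF assms(3)[OF that] has_derivative_pd[of F y], THEN differentiableI]
      Suc.prems that by auto
  ultimately show ?case by auto
qed

named_theorems smooth_intros

lemma smooth_on_const [smooth_intros]: "smooth_on (\<lambda>y. c) S"
  by (simp add: smooth_on_def Ck_on_const)

lemma smooth_on_add [smooth_intros]:
  "open S \<Longrightarrow> smooth_on F S \<Longrightarrow> smooth_on H S \<Longrightarrow> smooth_on (\<lambda>y. F y + H y) S"
  by (simp add: smooth_on_def Ck_on_add)

lemma smooth_on_mult [smooth_intros]:
  "open S \<Longrightarrow> smooth_on F S \<Longrightarrow> smooth_on H S \<Longrightarrow> smooth_on (\<lambda>y. F y * H y) S"
  by (simp add: smooth_on_def Ck_on_mult)

lemma smooth_on_uminus [smooth_intros]: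
  "open S \<Longrightarrow> smooth_on F S \<Longrightarrow> smooth_on (\<lambda>y. - F y) S"
  using smooth_on_mult[OF _ smooth_on_const[of "-1"], of S F] by simp

lemma smooth_on_diff [smooth_intros]:
  "open S \<Longrightarrow> smooth_on F S \<Longrightarrow> smooth_on H S \<Longrightarrow> smooth_on (\<lambda>y. F y - H y) S"
  using smooth_on_add[OF _ _ smooth_on_uminus, of S F H] by simp

lemma smooth_on_sum [smooth_intros]:
  assumes "open S" "\<And>k. k \<in> K \<Longrightarrow> smooth_on (F k) S"
  shows "smooth_on (\<lambda>y. \<Sum>k\<in>K. F k y) S"
  using assms(2)
  by (induction K rule: infinite_finite_induct) (auto intro!: smooth_intros assms(1))

lemma smooth_on_inverse:
  "open S \<Longrightarrow> smooth_on F S \<Longrightarrow> (\<And>y. y \<in> S \<Longrightarrow> F y \<noteq> 0) \<Longrightarrow> smooth_on (\<lambda>y. inverse (F y)) S"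
  by (simp add: smooth_on_def Ck_on_inverse)

lemma smooth_on_divide:
  assumes "open S" "smooth_on F S" "smooth_on H S" "\<And>y. y \<in> S \<Longrightarrow> H y \<noteq> 0"
  shows "smooth_on (\<lambda>y. F y / H y) S"
  using smooth_on_mult[OF assms(1,2) smooth_on_inverse[OF assms(1,3,4)]]
  by (simp add: divide_inverse)

lemma smooth_on_sqrt:
  "open S \<Longrightarrow> smooth_on F S \<Longrightarrow> (\<And>y. y \<in> S \<Longrightarrow> F y > 0) \<Longrightarrow> smooth_on (\<lambda>y. sqrt (F y)) S"
  by (simp add: smooth_on_def Ck_on_sqrt)

lemma smooth_on_pd [smooth_intros]: "smooth_on F S \<Longrightarrow> smooth_on (pd i F) S"
  unfolding smooth_on_def by (metis Ck_on.simps(2))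

lemma smooth_on_pd' [smooth_intros]: "smooth_on F S \<Longrightarrow> smooth_on (\<lambda>y. pd i F y) S"
  by (rule smooth_on_pd)

lemma smooth_on_cong:
  "open S \<Longrightarrow> (\<And>y. y \<in> S \<Longrightarrow> F y = H y) \<Longrightarrow> smooth_on F S \<Longrightarrow> smooth_on H S"
  unfolding smooth_on_def using Ck_on_cong by blast

lemma smooth_on_differentiable: "smooth_on F S \<Longrightarrow> x \<in> S \<Longrightarrow> F differentiable (at x)"
  unfolding smooth_on_def by (metis Ck_on.simps(2))

lemma smooth_on_continuous: "smooth_on F S \<Longrightarrow> continuous_on S F"
  unfolding smooth_on_def by (metis Ck_on.simps(1))

section \<open>Symmetry of second partial derivatives\<close>

lemma pd_line_derivative:
  assumes "F differentiable (at (p + t *\<^sub>R axis i 1))"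
  shows "((\<lambda>t. F (p + t *\<^sub>R axis i 1)) has_real_derivative pd i F (p + t *\<^sub>R axis i 1)) (at t)"
proof -
  have "((\<lambda>t. p + t *\<^sub>R axis i 1) has_derivative (\<lambda>t. t *\<^sub>R axis i 1)) (at t)"
    by (auto intro!: derivative_eq_intros)
  from has_derivative_compose[OF this has_derivative_pd[OF assms]]
  have "((\<lambda>t. F (p + t *\<^sub>R axis i 1)) has_derivative
      (\<lambda>u. frechet_derivative F (at (p + t *\<^sub>R axis i 1)) (u *\<^sub>R axis i 1))) (at t)" .
  moreover have "frechet_derivative F (at (p + t *\<^sub>R axis i 1)) (u *\<^sub>R axis i 1)
      = pd i F (p + t *\<^sub>R axis i 1) * u" for u
    using linear_scale[OF linear_frechet_derivative[OF assms]] by (simp add: pd_def)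
  ultimately show ?thesis by (simp add: has_field_derivative_def)
qed

lemma dist_add2_le: "dist x (x + a + b) \<le> norm a + norm (b::'b::real_normed_vector)"
proof -
  have "dist (x + a + b) x = norm (a + b)" by (simp add: dist_norm)
  then show ?thesis using norm_triangle_ineq[of a b] by (simp add: dist_commute)
qed

text \<open>Two mean values: first in u for the difference of F across the j-edge, then in v for
  \<open>pd i F\<close>. The left side is symmetric in i and j, and this symmetry is what
  \<open>pd_commute\<close> exploits.\<close>

lemma second_difference:
  assumes "smooth_on F S" "ball x r \<subseteq> S" "0 < h" "2 * h < r"
  shows "\<exists>p. dist x p < 2 * h \<and>
    F (x + h *\<^sub>R axis i 1 + h *\<^sub>R axis j 1) - F (x + h *\<^sub>R axis i 1) - F (x + h *\<^sub>R axis j 1) + F x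
      = h * h * pd j (pd i F) p"
proof -
  have near: "dist x (x + u *\<^sub>R axis i 1 + v *\<^sub>R axis j 1) < 2 * h"
    if "0 \<le> u" "u \<le> h" "0 \<le> v" "v \<le> h" "u < h \<or> v < h" for u v
  proof -
    have "dist x (x + u *\<^sub>R axis i 1 + v *\<^sub>R axis j 1) \<le> norm (u *\<^sub>R axis i (1::real)) + norm (v *\<^sub>R axis j (1::real))"
      using dist_add2_le by blast
    also have "\<dots> = u + v" using that by (simp add: norm_axis_1)
    finally show ?thesis using that by linarith
  qed
  have le: "x + u *\<^sub>R axis i 1 + v *\<^sub>R axis j 1 \<in> S"
    if "0 \<le> u" "u \<le> h" "0 \<le> v" "v \<le> h" for u v
  proof -
    have "dist x (x + u *\<^sub>R axis i 1 + v *\<^sub>R axis j 1) \<le> norm (u *\<^sub>R axis i (1::real)) + norm (v *\<^sub>R axis j (1::real))"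
      using dist_add2_le by blast
    also have "\<dots> = u + v" using that by (simp add: norm_axis_1)
    finally show ?thesis using that assms by (auto simp: mem_ball)
  qed
  define q where "q u v = x + u *\<^sub>R axis i 1 + v *\<^sub>R axis j (1::real)" for u v
  have dF: "F differentiable (at (q u v))" "pd i F differentiable (at (q u v))"
    if "0 \<le> u" "u \<le> h" "0 \<le> v" "v \<le> h" for u v
    using smooth_on_differentiable[OF _ le[OF that]] smooth_on_pd[OF assms(1)] assms(1)
    unfolding q_def by blast+
  have D1: "((\<lambda>u. F (q u v)) has_real_derivative pd i F (q u v)) (at u)"
    if "0 \<le> u" "u \<le> h" "0 \<le> v" "v \<le> h" for u v
  proof -
    have "q u v = (x + v *\<^sub>R axis j 1) + u *\<^sub>R axis i 1" for u by (simp add: q_def)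
    then show ?thesis using pd_line_derivative[of F "x + v *\<^sub>R axis j 1" u i] dF(1)[OF that] by simp
  qed
  have D2: "((\<lambda>v. pd i F (q u v)) has_real_derivative pd j (pd i F) (q u v)) (at v)"
    if "0 \<le> u" "u \<le> h" "0 \<le> v" "v \<le> h" for u v
    using pd_line_derivative[of "pd i F" "x + u *\<^sub>R axis i 1" v j] dF(2)[OF that] by (simp add: q_def)
  have "((\<lambda>u. F (q u h) - F (q u 0)) has_real_derivative (pd i F (q u h) - pd i F (q u 0))) (at u)"
    if "0 \<le> u" "u \<le> h" for u
    using that assms(3) by (intro DERIV_diff D1) auto
  from MVT2[OF assms(3) this] obtain u where u: "0 < u" "u < h"
    "(F (q h h) - F (q h 0)) - (F (q 0 h) - F (q 0 0)) = (h - 0) * (pd i F (q u h) - pd i F (q u 0))"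
    by metis
  have "((\<lambda>v. pd i F (q u v)) has_real_derivative pd j (pd i F) (q u v)) (at v)"
    if "0 \<le> v" "v \<le> h" for v
    using D2[of u v] u that by simp
  from MVT2[OF assms(3) this] obtain v where v: "0 < v" "v < h"
    "pd i F (q u h) - pd i F (q u 0) = (h - 0) * pd j (pd i F) (q u v)"
    by metis
  have "F (q h h) - F (q h 0) - F (q 0 h) + F (q 0 0) = h * h * pd j (pd i F) (q u v)"
    using u(3) v(3) by simp
  moreover have "dist x (q u v) < 2 * h" using near u v by (auto simp: q_def)
  ultimately show ?thesis by (intro exI[of _ "q u v"]) (simp add: q_def)
qed

lemma pd_commute:
  assumes "open S" "smooth_on F S" "x \<in> S"
  shows "pd i (pd j F) x = pd j (pd i F) x"
proof -
  have cont: "isCont (pd i (pd j F)) x" "isCont (pd j (pd i F)) x"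
    using smooth_on_continuous[OF smooth_on_pd[OF smooth_on_pd[OF assms(2)]]] assms(1,3)
    by (simp_all add: continuous_on_eq_continuous_at)
  have "\<bar>pd i (pd j F) x - pd j (pd i F) x\<bar> \<le> e" if "0 < e" for e
  proof -
  have e2: "0 < e / 2" using that by simp
  obtain d1 where d1: "d1 > 0" "\<And>y. dist y x < d1 \<Longrightarrow> dist (pd i (pd j F) y) (pd i (pd j F) x) < e/2"
    using cont(1)[unfolded continuous_at_eps_delta, rule_format, OF e2] by blast
  obtain d2 where d2: "d2 > 0" "\<And>y. dist y x < d2 \<Longrightarrow> dist (pd j (pd i F) y) (pd j (pd i F) x) < e/2"
    using cont(2)[unfolded continuous_at_eps_delta, rule_format, OF e2] by blast
  obtain r where r: "r > 0" "ball x r \<subseteq> S" using assms open_contains_ball by blast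
  define h where "h = min (min d1 d2) r / 3"
  have h: "0 < h" "2 * h < r" "2 * h < d1" "2 * h < d2"
    using r(1) d1(1) d2(1) by (auto simp: h_def)
  obtain p where p: "dist x p < 2 * h"
    "F (x + h *\<^sub>R axis i 1 + h *\<^sub>R axis j 1) - F (x + h *\<^sub>R axis i 1) - F (x + h *\<^sub>R axis j 1) + F x
      = h * h * pd j (pd i F) p"
    using second_difference[OF assms(2) r(2) h(1,2)] by blast
  obtain q where q: "dist x q < 2 * h"
    "F (x + h *\<^sub>R axis j 1 + h *\<^sub>R axis i 1) - F (x + h *\<^sub>R axis j 1) - F (x + h *\<^sub>R axis i 1) + F x
      = h * h * pd i (pd j F) q"
    using second_difference[OF assms(2) r(2) h(1,2)] by blast
  have eq: "x + h *\<^sub>R axis j 1 + h *\<^sub>R axis i 1 = x + h *\<^sub>R axis i 1 + h *\<^sub>R axis j (1::real)"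
    by simp
  then have "h * h * pd j (pd i F) p = h * h * pd i (pd j F) q" using p(2) q(2)[unfolded eq] by linarith
  \<comment> \<open>Both are the same second difference divided by h * h, so the mixed derivatives
    agree at the two nearby points p and q; continuity carries this to x.\<close>
  then have "pd j (pd i F) p = pd i (pd j F) q" using h(1) by simp
  moreover have "dist (pd i (pd j F) q) (pd i (pd j F) x) < e/2"
    "dist (pd j (pd i F) p) (pd j (pd i F) x) < e/2"
    using p(1) q(1) h d1 d2 by (auto simp: dist_commute)
  ultimately show ?thesis
    unfolding dist_real_def by arith
  qed
  then have "pd i (pd j F) x - pd j (pd i F) x = 0"
    by (intro dense_eq0_I) auto
  then show ?thesis by simp
qed

section \<open>Bivectors in dimension four\<close>

text \<open>\<open>sd s\<close> lists \<open>e\<^sub>1\<^sub>2 + s e\<^sub>3\<^sub>4\<close>, \<open>e\<^sub>1\<^sub>3 - s e\<^sub>2\<^sub>4\<close>, \<open>e\<^sub>1\<^sub>4 + s e\<^sub>2\<^sub>3\<close>, a basis of the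
  (anti-)self-dual bivectors of an orthonormal frame, orthogonal and of norm \<open>\<surd>2\<close>.\<close>

definition elem_skew :: "4 \<Rightarrow> 4 \<Rightarrow> 4 \<Rightarrow> 4 \<Rightarrow> real" where
  "elem_skew p q a b = (if a = p \<and> b = q then 1 else if a = q \<and> b = p then -1 else 0)"

definition sd :: "real \<Rightarrow> 3 \<Rightarrow> 4 \<Rightarrow> 4 \<Rightarrow> real" where
  "sd s \<alpha> a b =
     (if \<alpha> = 1 then elem_skew 1 2 a b + s * elem_skew 3 4 a b
      else if \<alpha> = 2 then elem_skew 1 3 a b - s * elem_skew 2 4 a b
      else elem_skew 1 4 a b + s * elem_skew 2 3 a b)"

definition eps3 :: "3 \<Rightarrow> 3 \<Rightarrow> 3 \<Rightarrow> real" where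
  "eps3 i j k = (if (i,j,k) \<in> {(1,2,3),(2,3,1),(3,1,2)} then 1
     else if (i,j,k) \<in> {(1,3,2),(2,1,3),(3,2,1)} then -1 else 0)"

text \<open>The sum runs over all ordered pairs, so by \<open>sd_orthogonal\<close> a combination of
  the \<open>sd s\<close> with coefficients c has \<open>sd_comp\<close> equal to 4 c. The factors
  1/4 and 1/8 below compensate for this.\<close>

definition sd_comp :: "real \<Rightarrow> (4 \<Rightarrow> 4 \<Rightarrow> real) \<Rightarrow> 3 \<Rightarrow> real" where
  "sd_comp s w \<gamma> = (\<Sum>a\<in>UNIV. \<Sum>b\<in>UNIV. sd s \<gamma> a b * w a b)"

text \<open>Matrix of the bracket with a skew w on the span of the \<open>sd s\<close>, as a
  function of n = \<open>sd_comp s w\<close> (see \<open>sd_commutator\<close>). Only n enters,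
  because the part of w in the opposite half commutes with every \<open>sd s \<alpha>\<close>;
  \<open>eps3\<close> carries the structure constants of so(3).\<close>

definition ad3 :: "real \<Rightarrow> (3 \<Rightarrow> real) \<Rightarrow> 3 \<Rightarrow> 3 \<Rightarrow> real" where
  "ad3 s n \<beta> \<alpha> = - (s/2) * (\<Sum>\<epsilon>\<in>UNIV. eps3 \<epsilon> \<alpha> \<beta> * n \<epsilon>)"

definition kd :: "'i \<Rightarrow> 'i \<Rightarrow> real" where
  "kd a b = (if a = b then 1 else 0)"

lemma numeral_4_neq [simp]:
  "(1::4) \<noteq> 2" "(1::4) \<noteq> 3" "(1::4) \<noteq> 4" "(2::4) \<noteq> 1" "(2::4) \<noteq> 3" "(2::4) \<noteq> 4"
  "(3::4) \<noteq> 1" "(3::4) \<noteq> 2" "(3::4) \<noteq> 4" "(4::4) \<noteq> 1" "(4::4) \<noteq> 2" "(4::4) \<noteq> 3"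
  "(1::3) \<noteq> 2" "(1::3) \<noteq> 3" "(2::3) \<noteq> 1" "(2::3) \<noteq> 3" "(3::3) \<noteq> 1" "(3::3) \<noteq> 2"
  by simp_all

lemma sd_table:
  "sd s 1 1 1 = 0" "sd s 1 1 2 = 1" "sd s 1 1 3 = 0" "sd s 1 1 4 = 0"
  "sd s 1 2 1 = -1" "sd s 1 2 2 = 0" "sd s 1 2 3 = 0" "sd s 1 2 4 = 0"
  "sd s 1 3 1 = 0" "sd s 1 3 2 = 0" "sd s 1 3 3 = 0" "sd s 1 3 4 = s"
  "sd s 1 4 1 = 0" "sd s 1 4 2 = 0" "sd s 1 4 3 = -s" "sd s 1 4 4 = 0"
  "sd s 2 1 1 = 0" "sd s 2 1 2 = 0" "sd s 2 1 3 = 1" "sd s 2 1 4 = 0"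
  "sd s 2 2 1 = 0" "sd s 2 2 2 = 0" "sd s 2 2 3 = 0" "sd s 2 2 4 = -s"
  "sd s 2 3 1 = -1" "sd s 2 3 2 = 0" "sd s 2 3 3 = 0" "sd s 2 3 4 = 0"
  "sd s 2 4 1 = 0" "sd s 2 4 2 = s" "sd s 2 4 3 = 0" "sd s 2 4 4 = 0"
  "sd s 3 1 1 = 0" "sd s 3 1 2 = 0" "sd s 3 1 3 = 0" "sd s 3 1 4 = 1"
  "sd s 3 2 1 = 0" "sd s 3 2 2 = 0" "sd s 3 2 3 = s" "sd s 3 2 4 = 0"
  "sd s 3 3 1 = 0" "sd s 3 3 2 = -s" "sd s 3 3 3 = 0" "sd s 3 3 4 = 0"
  "sd s 3 4 1 = -1" "sd s 3 4 2 = 0" "sd s 3 4 3 = 0" "sd s 3 4 4 = 0"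
  by (simp_all add: sd_def elem_skew_def)

lemma eps3_table:
  "eps3 i i k = 0" "eps3 i k i = 0" "eps3 k i i = 0"
  "eps3 1 2 3 = 1" "eps3 2 3 1 = 1" "eps3 3 1 2 = 1"
  "eps3 1 3 2 = -1" "eps3 2 1 3 = -1" "eps3 3 2 1 = -1"
  by (auto simp: eps3_def)

lemma ad3_table:
  "ad3 s n 1 1 = 0" "ad3 s n 1 2 = s/2 * n 3" "ad3 s n 1 3 = - s/2 * n 2"
  "ad3 s n 2 1 = - s/2 * n 3" "ad3 s n 2 2 = 0" "ad3 s n 2 3 = s/2 * n 1"
  "ad3 s n 3 1 = s/2 * n 2" "ad3 s n 3 2 = - s/2 * n 1" "ad3 s n 3 3 = 0"
  by (simp_all add: ad3_def sum_3 eps3_table)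

lemma sd_comp_table:
  assumes "\<And>a b. w a b = - w b a"
  shows "sd_comp s w 1 = 2 * (w 1 2 + s * w 3 4)"
    "sd_comp s w 2 = 2 * (w 1 3 - s * w 2 4)"
    "sd_comp s w 3 = 2 * (w 1 4 + s * w 2 3)"
  using assms[of 2 1] assms[of 3 1] assms[of 4 1] assms[of 3 2] assms[of 4 2] assms[of 4 3]
  by (simp_all add: sd_comp_def sum_4 sd_table)

lemma sd_skew: "sd s \<alpha> b a = - sd s \<alpha> a b"
proof -
  have "\<forall>\<alpha> a b. sd s \<alpha> b a = - sd s \<alpha> a b"
    unfolding forall_3 forall_4 sd_table by simp
  then show ?thesis by blast
qed

lemma skew_diag: "(\<And>a b. w a b = - w b a) \<Longrightarrow> w a a = (0::real)"
  by (metis equal_neg_zero)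

lemma sd_orthogonal:
  assumes "s * s = 1"
  shows "(\<Sum>a\<in>UNIV. \<Sum>b\<in>UNIV. sd s \<alpha> a b * sd s \<beta> a b) = 4 * kd \<alpha> \<beta>"
proof -
  have "\<forall>\<alpha> \<beta>. (\<Sum>a\<in>UNIV. \<Sum>b\<in>UNIV. sd s \<alpha> a b * sd s \<beta> a b) = 4 * kd \<alpha> \<beta>"
    unfolding forall_3 sum_4 sd_table kd_def using assms by simp
  then show ?thesis by blast
qed

lemma sd_commutator:
  assumes s: "s * s = 1" and w: "\<And>a b. w a b = - w b a"
  shows "(\<Sum>c\<in>UNIV. w a c * sd s \<alpha> c b - sd s \<alpha> a c * w c b)
    = (\<Sum>\<beta>\<in>UNIV. ad3 s (sd_comp s w) \<beta> \<alpha> * sd s \<beta> a b)"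
proof -
  have r: "w 2 1 = - w 1 2" "w 3 1 = - w 1 3" "w 4 1 = - w 1 4"
      "w 3 2 = - w 2 3" "w 4 2 = - w 2 4" "w 4 3 = - w 3 4"
    by (rule w)+
  have s2: "s * (s * x) = x" "s * x * s = x" for x using s by (simp_all add: algebra_simps)
  have "\<forall>\<alpha> a b. (\<Sum>c\<in>UNIV. w a c * sd s \<alpha> c b - sd s \<alpha> a c * w c b)
    = (\<Sum>\<beta>\<in>UNIV. ad3 s (sd_comp s w) \<beta> \<alpha> * sd s \<beta> a b)"
    unfolding forall_3 forall_4 sum_3 sum_4 sd_table ad3_table sd_comp_table[OF w] r
      skew_diag[of w, OF w]
    using s by (simp add: algebra_simps s2)
  then show ?thesis by blast
qed

lemma ad3_skew: "ad3 s n \<alpha> \<beta> = - ad3 s n \<beta> \<alpha>"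
proof -
  have "\<forall>\<alpha> \<beta>. ad3 s n \<alpha> \<beta> = - ad3 s n \<beta> \<alpha>"
    unfolding forall_3 ad3_table by simp
  then show ?thesis by blast
qed

lemma ad3_sd_comp_table:
  assumes s: "s * s = 1" and w: "\<And>a b. w a b = - w b a"
  shows "ad3 s (sd_comp s w) 1 2 = s * w 1 4 + w 2 3"
    "ad3 s (sd_comp s w) 1 3 = w 2 4 - s * w 1 3"
    "ad3 s (sd_comp s w) 2 3 = s * w 1 2 + w 3 4"
    "ad3 s (sd_comp s w) 2 1 = - (s * w 1 4 + w 2 3)"
    "ad3 s (sd_comp s w) 3 1 = s * w 1 3 - w 2 4"
    "ad3 s (sd_comp s w) 3 2 = - (s * w 1 2 + w 3 4)"
    "ad3 s (sd_comp s w) \<alpha> \<alpha> = 0"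
proof -
  have s2: "s * (s * x) = x" for x using s by (simp add: mult.assoc[symmetric])
  show "ad3 s (sd_comp s w) 1 2 = s * w 1 4 + w 2 3"
    "ad3 s (sd_comp s w) 1 3 = w 2 4 - s * w 1 3"
    "ad3 s (sd_comp s w) 2 3 = s * w 1 2 + w 3 4"
    "ad3 s (sd_comp s w) 2 1 = - (s * w 1 4 + w 2 3)"
    "ad3 s (sd_comp s w) 3 1 = s * w 1 3 - w 2 4"
    "ad3 s (sd_comp s w) 3 2 = - (s * w 1 2 + w 3 4)"
    "ad3 s (sd_comp s w) \<alpha> \<alpha> = 0"
    unfolding ad3_table sd_comp_table[OF w] by (simp_all add: s2 distrib_left right_diff_distrib ad3_def eps3_table)
qed

text \<open>Sending w to \<open>ad3 s (sd_comp s w)\<close> is the Lie algebra homomorphism from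
  so(4) onto one of its two so(3) factors. Hence the connection induced on the half of the bivectors
  has the projected curvature, as \<open>curv_\<Theta>\<close> states.\<close>

lemma ad3_commutator:
  assumes s: "s * s = 1" and w: "\<And>a b. w a b = - w b a" and u: "\<And>a b. u a b = - u b a"
  shows "ad3 s (sd_comp s (\<lambda>a b. \<Sum>c\<in>UNIV. w a c * u c b - u a c * w c b)) \<alpha> \<beta> =
    (\<Sum>\<gamma>\<in>UNIV. ad3 s (sd_comp s w) \<alpha> \<gamma> * ad3 s (sd_comp s u) \<gamma> \<beta>
       - ad3 s (sd_comp s u) \<alpha> \<gamma> * ad3 s (sd_comp s w) \<gamma> \<beta>)"
proof -
  let ?c = "\<lambda>a b. \<Sum>c\<in>UNIV. w a c * u c b - u a c * w c b"
  have c: "?c a b = - ?c b a" for a b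
    unfolding sum_negf[symmetric]
    by (rule sum.cong) (use w u in \<open>metis (no_types, opaque_lifting) minus_diff_eq minus_mult_minus mult.commute\<close>)+
  have r: "w 2 1 = - w 1 2" "w 3 1 = - w 1 3" "w 4 1 = - w 1 4"
      "w 3 2 = - w 2 3" "w 4 2 = - w 2 4" "w 4 3 = - w 3 4"
      "u 2 1 = - u 1 2" "u 3 1 = - u 1 3" "u 4 1 = - u 1 4"
      "u 3 2 = - u 2 3" "u 4 2 = - u 2 4" "u 4 3 = - u 3 4"
    by (rule w u)+
  have "\<forall>\<alpha> \<beta>. ad3 s (sd_comp s ?c) \<alpha> \<beta> =
    (\<Sum>\<gamma>\<in>UNIV. ad3 s (sd_comp s w) \<alpha> \<gamma> * ad3 s (sd_comp s u) \<gamma> \<beta>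
       - ad3 s (sd_comp s u) \<alpha> \<gamma> * ad3 s (sd_comp s w) \<gamma> \<beta>)"
    unfolding forall_3 sum_3 ad3_sd_comp_table[OF s c] ad3_sd_comp_table[OF s w] ad3_sd_comp_table[OF s u]
    unfolding sum_4 skew_diag[of w, OF w] skew_diag[of u, OF u]
    unfolding r
    by (intro conjI) (simp add: algebra_simps; fail | (simp, use s in algebra))+
  then show ?thesis by blast
qed


subsection \<open>Algebraic curvature tensors\<close>

definition curvature_like :: "tensor4 \<Rightarrow> bool" where
  "curvature_like R \<longleftrightarrow>
     (\<forall>a b c d. R b a c d = - R a b c d) \<and> (\<forall>a b c d. R a b d c = - R a b c d) \<and>
     (\<forall>a b c d. R a b c d + R b c a d + R c a b d = 0)"

text \<open>Octahedron argument: four instances of the cyclic identity are combined, the skew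
  symmetries only aligning their terms.\<close>

lemma curvature_like_pair:
  assumes "curvature_like R"
  shows "R c d a b = R a b c d"
proof -
  have 1: "R b a c d = - R a b c d" for a b c d using assms unfolding curvature_like_def by blast
  have 2: "R a b d c = - R a b c d" for a b c d using assms unfolding curvature_like_def by blast
  have 3: "R a b c d + R b c a d + R c a b d = 0" for a b c d
    using assms unfolding curvature_like_def by blast
  show ?thesis
    using 3[of a b c d] 3[of b c d a] 3[of c d a b] 3[of d a b c]
      1[of a c b d] 2[of a c b d] 1[of b d c a] 2[of b d c a] 2[of b c a d] 2[of c d b a]
      1[of c a b d] 1[of c a d b] 2[of c a b d] 2[of d b c a] 1[of d b a c]
      1[of d a c b] 2[of d a b c] 1[of d a b c] 2[of a b c d] 2[of c d a b] 1[of a d b c] 2[of a d b c]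
      1[of b d a c] 2[of b d a c]
    by linarith
qed

definition ricci_tr :: "tensor4 \<Rightarrow> 4 \<Rightarrow> 4 \<Rightarrow> real" where
  "ricci_tr R a c = (\<Sum>b\<in>UNIV. R a b c b)"

text \<open>Matrix entry in the orthonormal basis \<open>sd s\<close> divided by the square root of
  2: a factor 1/4 comes from pairing a tensor with two bivectors, as in \<open>tensor_form\<close>,
  and 1/2 from normalising both of them.\<close>

definition sd_block :: "real \<Rightarrow> tensor4 \<Rightarrow> 3 \<Rightarrow> 3 \<Rightarrow> real" where
  "sd_block s R \<alpha> \<beta> = 1/8 * (\<Sum>a\<in>UNIV. \<Sum>b\<in>UNIV. sd s \<alpha> a b * sd_comp s (R a b) \<beta>)"

definition weyl_part :: "tensor4 \<Rightarrow> tensor4" where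
  "weyl_part R a b c d = R a b c d
     - 1/2 * (kd a c * ricci_tr R b d + kd b d * ricci_tr R a c
              - kd a d * ricci_tr R b c - kd b c * ricci_tr R a d)
     + (\<Sum>e\<in>UNIV. ricci_tr R e e) / 6 * (kd a c * kd b d - kd a d * kd b c)"

lemma kd_sum [simp]:
  "(\<Sum>b\<in>UNIV. kd a b * f b) = f a" "(\<Sum>b\<in>UNIV. kd b a * f b) = f a"
  "(\<Sum>b\<in>UNIV. f b * kd a b) = f a" "(\<Sum>b\<in>UNIV. f b * kd b a) = f (a::'i::finite)"
  by (simp_all add: kd_def if_distrib[where f = "\<lambda>x. x * _"] if_distrib[where f = "\<lambda>x. _ * x"]
      cong: if_cong)

lemma kd_sym: "kd a b = kd b a"
  by (simp add: kd_def)

lemma kd_refl [simp]: "kd a a = 1"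
  by (simp add: kd_def)

lemma ricci_tr_sym:
  assumes "curvature_like R"
  shows "ricci_tr R a c = ricci_tr R c a"
  unfolding ricci_tr_def by (rule sum.cong) (simp_all add: curvature_like_pair[OF assms, of _ _ a])

lemma weyl_part_curvature_like:
  assumes "curvature_like R"
  shows "curvature_like (weyl_part R)"
proof -
  have R: "R b a c d = - R a b c d" "R a b d c = - R a b c d"
    "R a b c d = - R b c a d - R c a b d" for a b c d
    using assms[unfolded curvature_like_def] by (blast, blast, smt (verit))
  show ?thesis
    unfolding curvature_like_def
  proof (intro conjI allI)
    fix a b c d
    show "weyl_part R b a c d = - weyl_part R a b c d"
      unfolding weyl_part_def by (simp add: R(1)[of b a] algebra_simps)
    show "weyl_part R a b d c = - weyl_part R a b c d"
      unfolding weyl_part_def by (simp add: R(2)[of _ _ d c] algebra_simps)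
    show "weyl_part R a b c d + weyl_part R b c a d + weyl_part R c a b d = 0"
      unfolding weyl_part_def R(3)[of a b c d] kd_sym[of b a] kd_sym[of c a] kd_sym[of c b]
        ricci_tr_sym[OF assms, of c a] ricci_tr_sym[OF assms, of b a] ricci_tr_sym[OF assms, of c b]
      by (simp add: algebra_simps)
  qed
qed

lemma weyl_part_trace:
  assumes "curvature_like R"
  shows "ricci_tr (weyl_part R) a c = 0"
proof -
  define S where "S = (\<Sum>e\<in>UNIV. ricci_tr R e e)"
  have "weyl_part R a b c b = R a b c b
      - 1/2 * (kd a c * ricci_tr R b b + ricci_tr R a c - kd a b * ricci_tr R b c - kd b c * ricci_tr R a b)
      + S / 6 * (kd a c - kd a b * kd b c)" for b
    unfolding weyl_part_def S_def by simp
  then have "ricci_tr (weyl_part R) a c =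
     ricci_tr R a c - 1/2 * (kd a c * S + 4 * ricci_tr R a c - ricci_tr R a c - ricci_tr R a c)
     + S / 6 * (4 * kd a c - kd a c)"
    unfolding ricci_tr_def[of "weyl_part R"]
    by (simp only: sum.distrib sum_subtractf sum_distrib_left[symmetric] S_def[symmetric]
        ricci_tr_def[of R a c, symmetric] kd_sum) simp
  then show ?thesis by (simp add: field_simps)
qed

lemma sd_block_table:
  assumes "curvature_like R"
  shows "sd_block s R 1 1 = 1/2 * (R 1 2 1 2 + s * R 1 2 3 4 + s * (R 3 4 1 2 + s * R 3 4 3 4))"
    "sd_block s R 1 2 = 1/2 * (R 1 2 1 3 - s * R 1 2 2 4 + s * (R 3 4 1 3 - s * R 3 4 2 4))"
    "sd_block s R 1 3 = 1/2 * (R 1 2 1 4 + s * R 1 2 2 3 + s * (R 3 4 1 4 + s * R 3 4 2 3))"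
    "sd_block s R 2 1 = 1/2 * (R 1 3 1 2 + s * R 1 3 3 4 - s * (R 2 4 1 2 + s * R 2 4 3 4))"
    "sd_block s R 2 2 = 1/2 * (R 1 3 1 3 - s * R 1 3 2 4 - s * (R 2 4 1 3 - s * R 2 4 2 4))"
    "sd_block s R 2 3 = 1/2 * (R 1 3 1 4 + s * R 1 3 2 3 - s * (R 2 4 1 4 + s * R 2 4 2 3))"
    "sd_block s R 3 1 = 1/2 * (R 1 4 1 2 + s * R 1 4 3 4 + s * (R 2 3 1 2 + s * R 2 3 3 4))"
    "sd_block s R 3 2 = 1/2 * (R 1 4 1 3 - s * R 1 4 2 4 + s * (R 2 3 1 3 - s * R 2 3 2 4))"
    "sd_block s R 3 3 = 1/2 * (R 1 4 1 4 + s * R 1 4 2 3 + s * (R 2 3 1 4 + s * R 2 3 2 3))"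
proof -
  have R: "R b a c d = - R a b c d" "R a b c d = - R a b d c" for a b c d
    using assms[unfolded curvature_like_def] by (blast, metis minus_equation_iff)
  have eq: "sd_block s R \<alpha> \<beta> = 1/8 * sd_comp s (\<lambda>a b. sd_comp s (R a b) \<beta>) \<alpha>" for \<alpha> \<beta>
    by (simp add: sd_block_def sd_comp_def)
  have c: "sd_comp s (R a b) \<beta> = - sd_comp s (R b a) \<beta>" for a b \<beta>
    unfolding sd_comp_def by (simp add: R(1)[of a b] sum_negf)
  note t = sd_comp_table[of "R a b" for a b, OF R(2)]
  note t2 = sd_comp_table[of "\<lambda>a b. sd_comp s (R a b) \<beta>" for \<beta>, OF c]
  show "sd_block s R 1 1 = 1/2 * (R 1 2 1 2 + s * R 1 2 3 4 + s * (R 3 4 1 2 + s * R 3 4 3 4))"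
    "sd_block s R 1 2 = 1/2 * (R 1 2 1 3 - s * R 1 2 2 4 + s * (R 3 4 1 3 - s * R 3 4 2 4))"
    "sd_block s R 1 3 = 1/2 * (R 1 2 1 4 + s * R 1 2 2 3 + s * (R 3 4 1 4 + s * R 3 4 2 3))"
    "sd_block s R 2 1 = 1/2 * (R 1 3 1 2 + s * R 1 3 3 4 - s * (R 2 4 1 2 + s * R 2 4 3 4))"
    "sd_block s R 2 2 = 1/2 * (R 1 3 1 3 - s * R 1 3 2 4 - s * (R 2 4 1 3 - s * R 2 4 2 4))"
    "sd_block s R 2 3 = 1/2 * (R 1 3 1 4 + s * R 1 3 2 3 - s * (R 2 4 1 4 + s * R 2 4 2 3))"
    "sd_block s R 3 1 = 1/2 * (R 1 4 1 2 + s * R 1 4 3 4 + s * (R 2 3 1 2 + s * R 2 3 3 4))"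
    "sd_block s R 3 2 = 1/2 * (R 1 4 1 3 - s * R 1 4 2 4 + s * (R 2 3 1 3 - s * R 2 3 2 4))"
    "sd_block s R 3 3 = 1/2 * (R 1 4 1 4 + s * R 1 4 2 3 + s * (R 2 3 1 4 + s * R 2 3 2 3))"
    unfolding eq unfolding t2 unfolding t by (simp_all add: algebra_simps)
qed

text \<open>The trace-free Ricci part of a curvature tensor exchanges the two halves of the
  bivectors, so it is invisible in a diagonal block. Only the scalar part remains, as 1/12 of the
  scalar curvature times the identity.\<close>

lemma sd_block_weyl_part:
  assumes R: "curvature_like R" and s: "s * s = 1"
  shows "sd_block s (weyl_part R) \<alpha> \<beta> = sd_block s R \<alpha> \<beta> - (\<Sum>e\<in>UNIV. ricci_tr R e e) / 12 * kd \<alpha> \<beta>"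
proof -
  note rs = ricci_tr_sym[OF R, of 2 1] ricci_tr_sym[OF R, of 3 1] ricci_tr_sym[OF R, of 4 1]
    ricci_tr_sym[OF R, of 3 2] ricci_tr_sym[OF R, of 4 2] ricci_tr_sym[OF R, of 4 3]
  have s2: "s * (s * x) = x" for x using s by (simp add: mult.assoc[symmetric])
  have "\<forall>\<alpha> \<beta>. sd_block s (weyl_part R) \<alpha> \<beta>
      = sd_block s R \<alpha> \<beta> - (\<Sum>e\<in>UNIV. ricci_tr R e e) / 12 * kd \<alpha> \<beta>"
    unfolding forall_3 sd_block_table[OF R] sd_block_table[OF weyl_part_curvature_like[OF R]]
      weyl_part_def sum_4
    by (simp add: kd_def rs s2 distrib_left right_diff_distrib add_divide_distrib diff_divide_distrib)
  then show ?thesis by blast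
qed

text \<open>A trace-free curvature tensor has no block between the two halves: projecting one index
  pair already puts the other pair into the same half. The trace of the block vanishes because the
  Ricci trace kills the sum of the traces of both blocks and the cyclic identity kills their
  difference.\<close>

lemma weyl_self_dual:
  assumes W: "curvature_like W" and tr: "\<And>a c. ricci_tr W a c = 0" and s: "s * s = 1"
  shows "sd_comp s (W a b) \<alpha> = 2 * (\<Sum>\<beta>\<in>UNIV. sd_block s W \<alpha> \<beta> * sd s \<beta> a b)"
    and "sd_block s W \<alpha> \<beta> = sd_block s W \<beta> \<alpha>"
    and "(\<Sum>\<alpha>\<in>UNIV. sd_block s W \<alpha> \<alpha>) = 0"
proof -
  have R: "W b a c d = - W a b c d" "W a b d c = - W a b c d" for a b c d
    using assms[unfolded curvature_like_def] by blast+
  have R2: "W a b c d = - W a b d c" for a b c d using R(2)[of a b c d] by simp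
  have z: "W a a c d = 0" "W a b c c = 0" for a b c d using R(1)[of a a c d] R(2)[of a b c c] by auto
  note p = curvature_like_pair[OF W]
  have B: "W 1 4 2 3 = W 1 3 2 4 - W 1 2 3 4"
    using W[unfolded curvature_like_def] p[of 1 4 2 3] R(1)[of 1 3 2 4]
    by (metis (no_types, lifting) add.commute add_diff_cancel_left' diff_minus_eq_add eq_neg_iff_add_eq_0 minus_diff_eq)
  have T: "W a 1 c 1 + W a 2 c 2 + W a 3 c 3 + W a 4 c 4 = 0" for a c
    using tr[of a c] by (simp add: ricci_tr_def sum_4)
  note can = R(1)[of 2 1] R(1)[of 3 1] R(1)[of 4 1] R(1)[of 3 2] R(1)[of 4 2] R(1)[of 4 3]
    R(2)[of _ _ 2 1] R(2)[of _ _ 3 1] R(2)[of _ _ 4 1] R(2)[of _ _ 3 2] R(2)[of _ _ 4 2] R(2)[of _ _ 4 3]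
    p[of 1 3 1 2] p[of 1 4 1 2] p[of 2 3 1 2] p[of 2 4 1 2] p[of 3 4 1 2]
    p[of 1 4 1 3] p[of 2 3 1 3] p[of 2 4 1 3] p[of 3 4 1 3]
    p[of 2 3 1 4] p[of 2 4 1 4] p[of 3 4 1 4] p[of 2 4 2 3] p[of 3 4 2 3] p[of 3 4 2 4] z
  \<comment> \<open>The ten trace equations, solved for ten components. Together with B they leave
    ten independent components, five for each half.\<close>
  have e: "W 1 4 1 4 = - W 1 2 1 2 - W 1 3 1 3" "W 2 3 2 3 = - W 1 2 1 2 - W 1 3 1 3"
    "W 2 4 2 4 = W 1 3 1 3" "W 3 4 3 4 = W 1 2 1 2"
    "W 1 4 2 4 = - W 1 3 2 3" "W 1 4 3 4 = W 1 2 2 3" "W 1 3 3 4 = - W 1 2 2 4"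
    "W 2 4 3 4 = - W 1 2 1 3" "W 2 3 3 4 = W 1 2 1 4" "W 2 3 2 4 = - W 1 3 1 4"
    using T[of 1 1] T[of 2 2] T[of 3 3] T[of 4 4] T[of 1 2] T[of 1 3] T[of 1 4] T[of 2 3]
      T[of 2 4] T[of 3 4]
    by (simp_all add: can)
  have s2: "s * (s * x) = x" for x using s by (simp add: mult.assoc[symmetric])
  have "\<forall>\<alpha> a b. sd_comp s (W a b) \<alpha> = 2 * (\<Sum>\<beta>\<in>UNIV. sd_block s W \<alpha> \<beta> * sd s \<beta> a b)"
    unfolding forall_3 forall_4 sum_3 sd_table sd_block_table[OF W]
      sd_comp_table[of "W a b" for a b, OF R2]
    by (simp add: can B e s2 algebra_simps)
  then show "sd_comp s (W a b) \<alpha> = 2 * (\<Sum>\<beta>\<in>UNIV. sd_block s W \<alpha> \<beta> * sd s \<beta> a b)" by blast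
  have "\<forall>\<alpha> \<beta>. sd_block s W \<alpha> \<beta> = sd_block s W \<beta> \<alpha>"
    unfolding forall_3 sd_block_table[OF W] by (simp add: can B e s2 algebra_simps)
  then show "sd_block s W \<alpha> \<beta> = sd_block s W \<beta> \<alpha>" by blast
  show "(\<Sum>\<alpha>\<in>UNIV. sd_block s W \<alpha> \<alpha>) = 0"
    unfolding sum_3 sd_block_table[OF W] by (simp add: can B e s2 algebra_simps)
qed

section \<open>Divergence equation and Weitzenboeck formula at a point\<close>

text \<open>\<open>sd_wedge Z c d e\<close> is the component \<open>(c,d,e)\<close> of the three-form
  \<open>\<Sum>\<^sub>\<beta> Z\<^sub>\<beta> \<and> \<omega>\<^sub>\<beta>\<close>.\<close>

definition sd_wedge :: "real \<Rightarrow> (4 \<Rightarrow> 3 \<Rightarrow> real) \<Rightarrow> 4 \<Rightarrow> 4 \<Rightarrow> 4 \<Rightarrow> real" where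
  "sd_wedge s Z c d e =
     (\<Sum>\<beta>\<in>UNIV. Z c \<beta> * sd s \<beta> d e + Z d \<beta> * sd s \<beta> e c + Z e \<beta> * sd s \<beta> c d)"

definition sd_apply :: "real \<Rightarrow> (4 \<Rightarrow> 3 \<Rightarrow> real) \<Rightarrow> 4 \<Rightarrow> real" where
  "sd_apply s Z a = (\<Sum>\<beta>\<in>UNIV. \<Sum>b\<in>UNIV. sd s \<beta> a b * Z b \<beta>)"

text \<open>The Hodge star takes the three-form to the one-form \<open>sd_apply s Z\<close>: their
  components agree up to order, sign and a factor s, which multiplication by s removes.\<close>

lemma sd_apply_eq_0:
  assumes s: "s * s = 1"
    and Z: "sd_wedge s Z 2 3 4 = 0" "sd_wedge s Z 1 3 4 = 0"
      "sd_wedge s Z 1 2 4 = 0" "sd_wedge s Z 1 2 3 = 0"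
  shows "sd_apply s Z a = 0"
proof -
  have s2: "s * (s * x) = x" for x using s by (simp add: mult.assoc[symmetric])
  have "s * sd_wedge s Z 2 3 4 = 0" "s * sd_wedge s Z 1 3 4 = 0"
    "s * sd_wedge s Z 1 2 4 = 0" "s * sd_wedge s Z 1 2 3 = 0" by (simp_all add: Z)
  then have "\<forall>a. sd_apply s Z a = 0"
    unfolding forall_4 sd_apply_def sd_wedge_def sum_3 sum_4 sd_table
    by (simp add: s2 s algebra_simps)
  then show ?thesis by blast
qed

text \<open>This is the quaternion relation: minus the product of J_\<gamma> and J_\<beta> is the
  identity if \<gamma> = \<beta>, and s times the sum of
  \<open>eps3 \<gamma> \<beta> \<delta>\<close> J_\<delta> otherwise.\<close>

lemma sd_apply_contract:
  assumes s: "s * s = 1"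
  shows "(\<Sum>a\<in>UNIV. sd s \<gamma> a c * sd_apply s Z a) =
    Z c \<gamma> + s * (\<Sum>\<beta>\<in>UNIV. \<Sum>\<delta>\<in>UNIV. eps3 \<gamma> \<beta> \<delta> * (\<Sum>b\<in>UNIV. sd s \<delta> c b * Z b \<beta>))"
proof -
  have s2: "s * (s * x) = x" for x using s by (simp add: mult.assoc[symmetric])
  have "\<forall>\<gamma> c. (\<Sum>a\<in>UNIV. sd s \<gamma> a c * sd_apply s Z a) =
    Z c \<gamma> + s * (\<Sum>\<beta>\<in>UNIV. \<Sum>\<delta>\<in>UNIV. eps3 \<gamma> \<beta> \<delta> * (\<Sum>b\<in>UNIV. sd s \<delta> c b * Z b \<beta>))"
    unfolding forall_4 forall_3 sd_apply_def sum_3 sum_4 sd_table eps3_table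
    by (simp add: s2 s algebra_simps)
  then show ?thesis by blast
qed

text \<open>The change of the Levi-Civita connection in the frame direction c when the metric is
  multiplied by exp(2u) and the orthonormal frame is rescaled with it; v stands for du.\<close>

definition conf_skew :: "(4 \<Rightarrow> real) \<Rightarrow> 4 \<Rightarrow> 4 \<Rightarrow> 4 \<Rightarrow> real" where
  "conf_skew v c a b = kd c a * v b - kd c b * v a"

text \<open>After wedging, the skew action of the conformal change reduces to a multiple of v: once
  v on the trace-free symmetric part A, and - 2 times v on the multiple of the identity. These are
  the weights that produce X and the law for the derivative of \<rho>. The four triples index the
  independent components of a three-form.\<close>

lemma sd_wedge_conf_skew:
  assumes s: "s * s = 1" and sym: "\<And>\<alpha> \<beta>. A \<alpha> \<beta> = A \<beta> \<alpha>" and tr: "(\<Sum>\<alpha>\<in>UNIV. A \<alpha> \<alpha>) = 0"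
    and cde: "(c, d, e) \<in> {(2,3,4), (1,3,4), (1,2,4), (1,2,3)}"
  shows "sd_wedge s (\<lambda>c \<beta>. \<Sum>\<gamma>\<in>UNIV. ad3 s (sd_comp s (conf_skew v c)) \<alpha> \<gamma> * (A \<gamma> \<beta> + \<rho> * kd \<gamma> \<beta>)) c d e
    = sd_wedge s (\<lambda>c \<beta>. v c * A \<alpha> \<beta> - 2 * \<rho> * v c * kd \<alpha> \<beta>) c d e"
proof -
  have s2: "s * (s * x) = x" for x using s by (simp add: mult.assoc[symmetric])
  have r: "A 2 1 = A 1 2" "A 3 1 = A 1 3" "A 3 2 = A 2 3" by (rule sym)+
  have t: "A 3 3 = - A 1 1 - A 2 2" using tr by (simp add: sum_3)
  have w: "conf_skew v c a b = - conf_skew v c b a" for c a b by (simp add: conf_skew_def)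
  let ?P = "\<lambda>\<alpha> c d e. sd_wedge s (\<lambda>c \<beta>. \<Sum>\<gamma>\<in>UNIV. ad3 s (sd_comp s (conf_skew v c)) \<alpha> \<gamma> * (A \<gamma> \<beta> + \<rho> * kd \<gamma> \<beta>)) c d e
    = sd_wedge s (\<lambda>c \<beta>. v c * A \<alpha> \<beta> - 2 * \<rho> * v c * kd \<alpha> \<beta>) c d e"
  have "\<forall>\<alpha>. ?P \<alpha> 2 3 4 \<and> ?P \<alpha> 1 3 4 \<and> ?P \<alpha> 1 2 4 \<and> ?P \<alpha> 1 2 3"
    unfolding sd_wedge_def sum_3 forall_3
    by (simp add: sd_table ad3_sd_comp_table[OF s w] conf_skew_def kd_def r t s2 algebra_simps)
  then show ?thesis using cde by auto
qed

lemma divergence_equation: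
  assumes s: "s * s = 1" and A: "\<And>\<alpha> \<beta>. A \<alpha> \<beta> = A \<beta> \<alpha>" "(\<Sum>\<alpha>\<in>UNIV. A \<alpha> \<alpha>) = 0"
    and P: "\<And>c \<alpha> \<beta>. P c \<alpha> \<beta> = P c \<beta> \<alpha>" "\<And>c. (\<Sum>\<alpha>\<in>UNIV. P c \<alpha> \<alpha>) = 0"
    and bianchi: "\<And>\<alpha> c d e. sd_wedge s (\<lambda>c \<beta>. P c \<alpha> \<beta> + r c * kd \<alpha> \<beta>
      + (\<Sum>\<gamma>\<in>UNIV. ad3 s (sd_comp s (conf_skew v c)) \<alpha> \<gamma> * (A \<gamma> \<beta> + \<rho> * kd \<gamma> \<beta>))) c d e = 0"
  shows "sd_apply s (\<lambda>b \<beta>. P b \<alpha> \<beta> + v b * A \<alpha> \<beta>) a = 0"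
proof -
  \<comment> \<open>The defect of the law d\<rho> = 2 \<rho> v. Its vanishing is a by-product of the
    trace argument below.\<close>
  define q where "q c = r c - 2 * \<rho> * v c" for c
  define Z where "Z \<alpha> c \<beta> = P c \<alpha> \<beta> + v c * A \<alpha> \<beta> + q c * kd \<alpha> \<beta>" for \<alpha> c \<beta>
  have add: "sd_wedge s (\<lambda>c \<beta>. X c \<beta> + Y c \<beta>) c d e = sd_wedge s X c d e + sd_wedge s Y c d e" for X Y c d e
    unfolding sd_wedge_def by (simp add: sum.distrib[symmetric] algebra_simps)
  have "sd_wedge s (Z \<alpha>) c d e = 0" if "(c, d, e) \<in> {(2,3,4), (1,3,4), (1,2,4), (1,2,3)}" for \<alpha> c d e
  proof -
    have "Z \<alpha> = (\<lambda>c \<beta>. (P c \<alpha> \<beta> + r c * kd \<alpha> \<beta>) + (v c * A \<alpha> \<beta> - 2 * \<rho> * v c * kd \<alpha> \<beta>))"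
      by (intro ext) (simp add: Z_def q_def algebra_simps)
    then show ?thesis
      using bianchi[of \<alpha> c d e] sd_wedge_conf_skew[where A = A and v = v and \<rho> = \<rho> and \<alpha> = \<alpha>, OF s A that]
      by (simp only: add)
  qed
  then have app: "sd_apply s (Z \<alpha>) a = 0" for \<alpha> a
    by (intro sd_apply_eq_0[OF s]) auto
  have c: "Z \<gamma> c \<gamma> + s * (\<Sum>\<beta>\<in>UNIV. \<Sum>\<delta>\<in>UNIV. eps3 \<gamma> \<beta> \<delta> * (\<Sum>b\<in>UNIV. sd s \<delta> c b * Z \<gamma> b \<beta>)) = 0" for c \<gamma>
    using sd_apply_contract[OF s, of \<gamma> c "Z \<gamma>"] by (simp add: app)
  have Zs: "Z \<alpha> c \<beta> = Z \<beta> c \<alpha>" for \<alpha> \<beta> c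
    by (simp add: Z_def A(1)[of \<alpha>] P(1)[of _ \<alpha>] kd_sym[of \<alpha>])
  \<comment> \<open>In the sum of \<open>c\<close> over \<gamma>, the \<open>eps3\<close> terms
    cancel because Z is symmetric in its two upper indices. What is left is the trace of Z, which is
    3 q since P and A are trace-free.\<close>
  have "Z 1 c 1 + Z 2 c 2 + Z 3 c 3 = 0" for c
    using c[of 1 c] c[of 2 c] c[of 3 c] Zs[of 2 _ 1] Zs[of 3 _ 1] Zs[of 3 _ 2]
    by (simp add: sum_3 eps3_table algebra_simps)
  moreover have "A 3 3 = - A 1 1 - A 2 2" "P c 3 3 = - P c 1 1 - P c 2 2" for c
    using P(2)[of c] A(2) by (simp_all add: sum_3)
  ultimately have "q c = 0" for c
    by (simp add: Z_def kd_def algebra_simps)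
  then have "Z \<alpha> = (\<lambda>b \<beta>. P b \<alpha> \<beta> + v b * A \<alpha> \<beta>)"
    by (intro ext) (simp add: Z_def)
  then show ?thesis using app[of \<alpha> a] by simp
qed


text \<open>In the following lemma, \<open>Y a b\<close> stands for \<open>D\<^sub>a X\<^sub>b\<close> with \<open>X = D A + v \<otimes> A\<close>. Quaternionic
  multiplication of the differentiated divergence equation expresses the trace of \<open>Y\<close> through its
  skew part, which is a curvature term.\<close>

lemma weitzenboeck:
  assumes s: "s * s = 1" and A: "\<And>\<alpha> \<beta>. A \<alpha> \<beta> = A \<beta> \<alpha>" "(\<Sum>\<alpha>\<in>UNIV. A \<alpha> \<alpha>) = 0"
    and X: "\<And>\<alpha> a. sd_apply s (\<lambda>b \<beta>. X b \<alpha> \<beta>) a = 0"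
    and Y: "\<And>\<alpha> c a. sd_apply s (\<lambda>b \<beta>. Y c b \<alpha> \<beta>) a = 0"
    and F: "\<And>a b \<alpha> \<beta>. F a b \<alpha> \<beta> = ad3 s (sd_comp s (R a b)) \<alpha> \<beta>"
    and R: "\<And>\<alpha> \<beta>. sd_block s R \<alpha> \<beta> = A \<alpha> \<beta> + sc / 12 * kd \<alpha> \<beta>"
    and skew: "\<And>a b \<alpha> \<beta>. Y a b \<alpha> \<beta> - Y b a \<alpha> \<beta> =
      (\<Sum>\<gamma>\<in>UNIV. F a b \<alpha> \<gamma> * A \<gamma> \<beta> - A \<alpha> \<gamma> * F a b \<gamma> \<beta>) + v b * X a \<alpha> \<beta> - v a * X b \<alpha> \<beta>"
  shows "(\<Sum>\<alpha>\<in>UNIV. \<Sum>\<beta>\<in>UNIV. A \<alpha> \<beta> * (\<Sum>a\<in>UNIV. Y a a \<alpha> \<beta>)) =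
    sc / 2 * (\<Sum>\<alpha>\<in>UNIV. \<Sum>\<beta>\<in>UNIV. A \<alpha> \<beta> * A \<alpha> \<beta>) - 18 * det (\<chi> i j. A i j)
    - (\<Sum>\<alpha>\<in>UNIV. \<Sum>\<beta>\<in>UNIV. A \<alpha> \<beta> * (\<Sum>a\<in>UNIV. v a * X a \<alpha> \<beta>))"
proof -
  \<comment> \<open>Four times \<open>sd_block s R\<close>, that is, half the contraction of
    \<open>sd_comp s (R c b)\<close> with \<open>sd s \<delta>\<close>. So
    \<open>ad3 s (N \<delta>)\<close> is the curvature of the bundle evaluated on the bivector
    \<delta>, and K is its commutator with A.\<close>
  define N where "N \<delta> \<epsilon> = 4 * (A \<delta> \<epsilon> + sc / 12 * kd \<delta> \<epsilon>)" for \<delta> \<epsilon>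
  define K where "K \<delta> \<alpha> \<beta> = (\<Sum>\<gamma>\<in>UNIV. ad3 s (N \<delta>) \<alpha> \<gamma> * A \<gamma> \<beta> - A \<alpha> \<gamma> * ad3 s (N \<delta>) \<gamma> \<beta>)"
    for \<delta> \<alpha> \<beta>
  have ad: "ad3 s (N \<delta>) \<alpha> \<beta> = 1/2 * (\<Sum>c\<in>UNIV. \<Sum>b\<in>UNIV. sd s \<delta> c b * F c b \<alpha> \<beta>)" for \<delta> \<alpha> \<beta>
  proof -
    have "N \<delta> \<epsilon> = 1/2 * (\<Sum>c\<in>UNIV. \<Sum>b\<in>UNIV. sd s \<delta> c b * sd_comp s (R c b) \<epsilon>)" for \<epsilon>
      unfolding N_def R[symmetric] sd_block_def by simp
    then show ?thesis
      unfolding F ad3_def by (simp add: sum_distrib_left sum_3 sum_4 algebra_simps)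
  qed
  have K: "K \<delta> \<alpha> \<beta> = 1/2 * (\<Sum>c\<in>UNIV. \<Sum>b\<in>UNIV. sd s \<delta> c b *
      (\<Sum>\<gamma>\<in>UNIV. F c b \<alpha> \<gamma> * A \<gamma> \<beta> - A \<alpha> \<gamma> * F c b \<gamma> \<beta>))" for \<delta> \<alpha> \<beta>
    unfolding K_def ad by (simp add: sum_3 sum_4 algebra_simps)
  define D where "D \<delta> \<alpha> \<beta> = (\<Sum>c\<in>UNIV. \<Sum>b\<in>UNIV. sd s \<delta> c b * Y c b \<alpha> \<beta>)" for \<delta> \<alpha> \<beta>
  define V where "V \<delta> \<alpha> \<beta> = (\<Sum>c\<in>UNIV. \<Sum>b\<in>UNIV. sd s \<delta> c b * (v c * X b \<alpha> \<beta>))" for \<delta> \<alpha> \<beta>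
  have flip: "(\<Sum>c\<in>UNIV. \<Sum>b\<in>UNIV. sd s \<delta> c b * T b c) = - (\<Sum>c\<in>UNIV. \<Sum>b\<in>UNIV. sd s \<delta> c b * T c b)"
    for T \<delta>
    by (subst sum.swap, subst sd_skew) (simp add: sum_negf)
  have DK: "D \<delta> \<alpha> \<beta> = K \<delta> \<alpha> \<beta> - V \<delta> \<alpha> \<beta>" for \<delta> \<alpha> \<beta>
  proof -
    have "2 * D \<delta> \<alpha> \<beta> = (\<Sum>c\<in>UNIV. \<Sum>b\<in>UNIV. sd s \<delta> c b * (Y c b \<alpha> \<beta> - Y b c \<alpha> \<beta>))"
      using flip[of \<delta> "\<lambda>c b. Y c b \<alpha> \<beta>"]
      by (simp add: D_def right_diff_distrib sum_subtractf)
    also have "\<dots> = 2 * K \<delta> \<alpha> \<beta> + (\<Sum>c\<in>UNIV. \<Sum>b\<in>UNIV. sd s \<delta> c b * (v b * X c \<alpha> \<beta>)) - V \<delta> \<alpha> \<beta>"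
      unfolding skew K V_def by (simp add: right_diff_distrib distrib_left sum_subtractf sum.distrib)
    also have "\<dots> = 2 * K \<delta> \<alpha> \<beta> - 2 * V \<delta> \<alpha> \<beta>"
      using flip[of \<delta> "\<lambda>c b. v c * X b \<alpha> \<beta>"] by (simp add: V_def)
    finally show ?thesis by simp
  qed
  \<comment> \<open>Contract the equation for Y with J_\<gamma>, using the differentiation index as
    the free one. The diagonal part is the trace of Y; the rest sees Y only against the skew
    J_\<delta>, hence only its skew part.\<close>
  have Ytr: "(\<Sum>c\<in>UNIV. Y c c \<alpha> \<gamma>) = - s * (\<Sum>\<beta>\<in>UNIV. \<Sum>\<delta>\<in>UNIV. eps3 \<gamma> \<beta> \<delta> * D \<delta> \<alpha> \<beta>)" for \<alpha> \<gamma>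
  proof -
    have "0 = (\<Sum>c\<in>UNIV. Y c c \<alpha> \<gamma> + s * (\<Sum>\<beta>\<in>UNIV. \<Sum>\<delta>\<in>UNIV. eps3 \<gamma> \<beta> \<delta> *
        (\<Sum>b\<in>UNIV. sd s \<delta> c b * Y c b \<alpha> \<beta>)))"
      using sd_apply_contract[OF s, of \<gamma> _ "\<lambda>b \<beta>. Y c b \<alpha> \<beta>" for c] by (simp add: Y)
    also have "\<dots> = (\<Sum>c\<in>UNIV. Y c c \<alpha> \<gamma>) + s * (\<Sum>\<beta>\<in>UNIV. \<Sum>\<delta>\<in>UNIV. eps3 \<gamma> \<beta> \<delta> * D \<delta> \<alpha> \<beta>)"
      unfolding D_def by (simp add: sum_3 sum_4 algebra_simps)
    finally show ?thesis by simp
  qed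
  \<comment> \<open>The same contraction of X with v, which converts the first order terms V of the
    skew part back into v paired with X.\<close>
  have Xtr: "(\<Sum>c\<in>UNIV. v c * X c \<alpha> \<gamma>) = - s * (\<Sum>\<beta>\<in>UNIV. \<Sum>\<delta>\<in>UNIV. eps3 \<gamma> \<beta> \<delta> * V \<delta> \<alpha> \<beta>)" for \<alpha> \<gamma>
  proof -
    have "0 = (\<Sum>c\<in>UNIV. v c * (X c \<alpha> \<gamma> + s * (\<Sum>\<beta>\<in>UNIV. \<Sum>\<delta>\<in>UNIV. eps3 \<gamma> \<beta> \<delta> *
        (\<Sum>b\<in>UNIV. sd s \<delta> c b * X b \<alpha> \<beta>))))"
      using sd_apply_contract[OF s, of \<gamma> _ "\<lambda>b \<beta>. X b \<alpha> \<beta>"] by (simp add: X)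
    also have "\<dots> = (\<Sum>c\<in>UNIV. v c * X c \<alpha> \<gamma>) + s * (\<Sum>\<beta>\<in>UNIV. \<Sum>\<delta>\<in>UNIV. eps3 \<gamma> \<beta> \<delta> * V \<delta> \<alpha> \<beta>)"
      unfolding V_def by (simp add: sum_3 sum_4 algebra_simps)
    finally show ?thesis by simp
  qed
  have "(\<Sum>c\<in>UNIV. Y c c \<alpha> \<gamma>)
      = - s * (\<Sum>\<beta>\<in>UNIV. \<Sum>\<delta>\<in>UNIV. eps3 \<gamma> \<beta> \<delta> * K \<delta> \<alpha> \<beta>) - (\<Sum>c\<in>UNIV. v c * X c \<alpha> \<gamma>)" for \<alpha> \<gamma>
    unfolding Ytr Xtr DK by (simp add: right_diff_distrib sum_subtractf)
  then have 1: "(\<Sum>\<alpha>\<in>UNIV. \<Sum>\<beta>\<in>UNIV. A \<alpha> \<beta> * (\<Sum>a\<in>UNIV. Y a a \<alpha> \<beta>)) =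
    - s * (\<Sum>\<alpha>\<in>UNIV. \<Sum>\<gamma>\<in>UNIV. A \<alpha> \<gamma> * (\<Sum>\<beta>\<in>UNIV. \<Sum>\<delta>\<in>UNIV. eps3 \<gamma> \<beta> \<delta> * K \<delta> \<alpha> \<beta>))
    - (\<Sum>\<alpha>\<in>UNIV. \<Sum>\<beta>\<in>UNIV. A \<alpha> \<beta> * (\<Sum>a\<in>UNIV. v a * X a \<alpha> \<beta>))"
    by (simp add: right_diff_distrib sum_subtractf sum_negf sum_distrib_left mult.left_commute)
  have s2: "s * (s * x) = x" for x using s by (simp add: mult.assoc[symmetric])
  have r: "A 2 1 = A 1 2" "A 3 1 = A 1 3" "A 3 2 = A 2 3" by (rule A)+
  have t: "A 3 3 = - A 1 1 - A 2 2" using A(2) by (simp add: sum_3)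
  \<comment> \<open>The part of N linear in A contributes - 6 tr A^3, which is - 18 det A because A
    is trace-free; the scalar part contributes the multiple of |A|^2.\<close>
  have 2: "- s * (\<Sum>\<alpha>\<in>UNIV. \<Sum>\<gamma>\<in>UNIV. A \<alpha> \<gamma> * (\<Sum>\<beta>\<in>UNIV. \<Sum>\<delta>\<in>UNIV. eps3 \<gamma> \<beta> \<delta> * K \<delta> \<alpha> \<beta>))
    = sc / 2 * (\<Sum>\<alpha>\<in>UNIV. \<Sum>\<beta>\<in>UNIV. A \<alpha> \<beta> * A \<alpha> \<beta>) - 18 * det (\<chi> i j. A i j)"
    unfolding K_def sum_3 eps3_table ad3_table N_def det_3 r kd_def
    by (simp add: s2 r t algebra_simps add_divide_distrib)
  show ?thesis unfolding 1 2 ..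
qed

section \<open>Connection matrices\<close>

definition mpd :: "4 \<Rightarrow> (real^4 \<Rightarrow> real^'n^'m) \<Rightarrow> real^4 \<Rightarrow> real^'n^'m" where
  "mpd i M x = (\<chi> a b. pd i (\<lambda>y. M y $ a $ b) x)"

definition msmooth_on :: "(real^4 \<Rightarrow> real^'n^'m) \<Rightarrow> (real^4) set \<Rightarrow> bool" where
  "msmooth_on M S \<longleftrightarrow> (\<forall>a b. smooth_on (\<lambda>y. M y $ a $ b) S)"

definition mcomm :: "real^'n^'n \<Rightarrow> real^'n^'n \<Rightarrow> real^'n^'n" where
  "mcomm A B = A ** B - B ** A"

definition curv :: "(4 \<Rightarrow> real^4 \<Rightarrow> real^'n^'n) \<Rightarrow> 4 \<Rightarrow> 4 \<Rightarrow> real^4 \<Rightarrow> real^'n^'n" where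
  "curv w i j x = mpd i (w j) x - mpd j (w i) x + mcomm (w i x) (w j x)"

text \<open>Covariant derivative of a function with values in matrices. Applied to a curvature it
  ignores the two form indices, so no Christoffel symbols occur; they would cancel in a cyclic sum
  anyway.\<close>

definition ad_deriv :: "(4 \<Rightarrow> real^4 \<Rightarrow> real^'n^'n) \<Rightarrow> 4 \<Rightarrow> (real^4 \<Rightarrow> real^'n^'n) \<Rightarrow> real^4 \<Rightarrow> real^'n^'n" where
  "ad_deriv w i M x = mpd i M x + mcomm (w i x) (M x)"

lemma msmooth_on_nth: "msmooth_on M S \<Longrightarrow> smooth_on (\<lambda>y. M y $ a $ b) S"
  by (simp add: msmooth_on_def)

lemma msmooth_on_differentiable:
  "msmooth_on M S \<Longrightarrow> x \<in> S \<Longrightarrow> (\<lambda>y. M y $ a $ b) differentiable (at x)"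
  by (rule smooth_on_differentiable[OF msmooth_on_nth])

lemma msmooth_on_add: "open S \<Longrightarrow> msmooth_on M S \<Longrightarrow> msmooth_on N S \<Longrightarrow> msmooth_on (\<lambda>y. M y + N y) S"
  by (simp add: msmooth_on_def smooth_on_add)

lemma msmooth_on_diff: "open S \<Longrightarrow> msmooth_on M S \<Longrightarrow> msmooth_on N S \<Longrightarrow> msmooth_on (\<lambda>y. M y - N y) S"
  by (simp add: msmooth_on_def smooth_on_diff)

lemma msmooth_on_mult: "open S \<Longrightarrow> msmooth_on M S \<Longrightarrow> msmooth_on N S \<Longrightarrow> msmooth_on (\<lambda>y. M y ** N y) S"
  by (simp add: msmooth_on_def matrix_matrix_mult_def smooth_on_sum smooth_on_mult)

lemma msmooth_on_transpose: "msmooth_on M S \<Longrightarrow> msmooth_on (\<lambda>y. transpose (M y)) S"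
  by (simp add: msmooth_on_def transpose_def)

lemma msmooth_on_mpd: "msmooth_on M S \<Longrightarrow> msmooth_on (mpd i M) S"
  by (simp add: msmooth_on_def mpd_def smooth_on_pd')

lemma msmooth_on_mcomm: "open S \<Longrightarrow> msmooth_on M S \<Longrightarrow> msmooth_on N S \<Longrightarrow> msmooth_on (\<lambda>y. mcomm (M y) (N y)) S"
  unfolding mcomm_def by (intro msmooth_on_diff msmooth_on_mult)

lemma msmooth_on_curv: "open S \<Longrightarrow> (\<And>i. msmooth_on (w i) S) \<Longrightarrow> msmooth_on (curv w i j) S"
  unfolding curv_def [abs_def]
  by (intro msmooth_on_diff msmooth_on_add msmooth_on_mcomm msmooth_on_mpd)

lemmas msmooth_intros = msmooth_on_add msmooth_on_diff msmooth_on_mult msmooth_on_transpose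
  msmooth_on_mpd msmooth_on_mcomm msmooth_on_curv

lemma mpd_add:
  "msmooth_on M S \<Longrightarrow> msmooth_on N S \<Longrightarrow> x \<in> S \<Longrightarrow> mpd i (\<lambda>y. M y + N y) x = mpd i M x + mpd i N x"
  by (simp add: mpd_def vec_eq_iff pd_add msmooth_on_differentiable)

lemma mpd_diff:
  "msmooth_on M S \<Longrightarrow> msmooth_on N S \<Longrightarrow> x \<in> S \<Longrightarrow> mpd i (\<lambda>y. M y - N y) x = mpd i M x - mpd i N x"
  by (simp add: mpd_def vec_eq_iff pd_diff msmooth_on_differentiable)

lemma mpd_mult:
  assumes "msmooth_on M S" "msmooth_on N S" "x \<in> S"
  shows "mpd i (\<lambda>y. M y ** N y) x = mpd i M x ** N x + M x ** mpd i N x"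
  using msmooth_on_differentiable[OF assms(1,3)] msmooth_on_differentiable[OF assms(2,3)]
  by (simp add: mpd_def vec_eq_iff matrix_matrix_mult_def pd_sum pd_mult sum.distrib
      differentiable_mult)

lemma mpd_mcomm:
  assumes "open S" "msmooth_on M S" "msmooth_on N S" "x \<in> S"
  shows "mpd i (\<lambda>y. mcomm (M y) (N y)) x = mcomm (mpd i M x) (N x) + mcomm (M x) (mpd i N x)"
  unfolding mcomm_def
  using assms by (simp add: mpd_diff[of _ S] mpd_mult[of _ S] msmooth_on_mult)

lemma mpd_transpose: "mpd i (\<lambda>y. transpose (M y)) x = transpose (mpd i M x)"
  by (simp add: mpd_def transpose_def vec_eq_iff)

lemma mpd_const [simp]: "mpd i (\<lambda>y. M) x = 0"
  by (simp add: mpd_def vec_eq_iff)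

lemma mpd_cong:
  assumes "open S" "x \<in> S" "\<And>y. y \<in> S \<Longrightarrow> M y = N y"
  shows "mpd i M x = mpd i N x"
proof -
  have "pd i (\<lambda>y. M y $ a $ b) x = pd i (\<lambda>y. N y $ a $ b) x" for a b
    by (rule pd_cong_open[OF assms(1,2)]) (simp add: assms(3))
  then show ?thesis by (simp add: mpd_def)
qed

lemma mpd_commute:
  "open S \<Longrightarrow> msmooth_on M S \<Longrightarrow> x \<in> S \<Longrightarrow> mpd i (mpd j M) x = mpd j (mpd i M) x"
  using pd_commute[OF _ msmooth_on_nth, of S M x i j] by (simp add: mpd_def vec_eq_iff)

lemma matrix_ring_simps:
  fixes A B :: "real^'n^'m" and M N :: "real^'k^'n" and K :: "real^'l^'k"
  shows "A ** (M + N) = A ** M + A ** N" "(A + B) ** M = A ** M + B ** M"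
    "A ** (M - N) = A ** M - A ** N" "(A - B) ** M = A ** M - B ** M"
    "A ** (- M) = - (A ** M)" "(- A) ** M = - (A ** M)" "A ** (M ** K) = A ** M ** K"
  by ((simp add: matrix_matrix_mult_def vec_eq_iff sum.distrib sum_subtractf sum_negf
      algebra_simps; fail) | rule matrix_mul_assoc)+

lemma mcomm_simps:
  "mcomm (A + B) M = mcomm A M + mcomm B M" "mcomm (A - B) M = mcomm A M - mcomm B M"
  "mcomm M (A + B) = mcomm M A + mcomm M B" "mcomm M (A - B) = mcomm M A - mcomm M B"
  by (simp_all add: mcomm_def matrix_ring_simps)

lemma mcomm_jacobi: "mcomm (mcomm A B) M = mcomm A (mcomm B M) - mcomm B (mcomm A M)"
  by (simp add: mcomm_def matrix_ring_simps)

lemma mcomm_swap: "mcomm A B = - mcomm B A"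
  by (simp add: mcomm_def)

lemma ad_deriv_commute:
  assumes "open S" "\<And>i. msmooth_on (w i) S" "msmooth_on M S" "x \<in> S"
  shows "ad_deriv w i (ad_deriv w j M) x - ad_deriv w j (ad_deriv w i M) x = mcomm (curv w i j x) (M x)"
proof -
  have "ad_deriv w i (ad_deriv w j M) x = mpd i (mpd j M) x + mcomm (mpd i (w j) x) (M x)
      + mcomm (w j x) (mpd i M x) + mcomm (w i x) (mpd j M x) + mcomm (w i x) (mcomm (w j x) (M x))" for i j
    unfolding ad_deriv_def[abs_def]
    using assms by (simp add: mpd_add[of _ S] mpd_mcomm[of S] msmooth_intros mcomm_simps)
  then show ?thesis
    by (simp add: curv_def mcomm_simps mcomm_jacobi mpd_commute[OF assms(1,3,4), of i j])
qed

lemma second_bianchi: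
  assumes "open S" "\<And>i. msmooth_on (w i) S" "x \<in> S"
  shows "ad_deriv w i (curv w j k) x + ad_deriv w j (curv w k i) x + ad_deriv w k (curv w i j) x = 0"
proof -
  have "mpd i (curv w j k) x = mpd i (mpd j (w k)) x - mpd i (mpd k (w j)) x
      + mcomm (mpd i (w j) x) (w k x) + mcomm (w j x) (mpd i (w k) x)" for i j k
    unfolding curv_def[abs_def]
    using assms by (simp add: mpd_add[of _ S] mpd_diff[of _ S] mpd_mcomm[of S] msmooth_intros)
  then show ?thesis
    unfolding ad_deriv_def
    by (simp add: curv_def mcomm_simps mpd_commute[OF assms(1,2,3), of j i] mpd_commute[OF assms(1,2,3), of k i]
        mpd_commute[OF assms(1,2,3), of k j] mcomm_swap[of "mpd _ _ _"])
      (simp add: mcomm_def matrix_ring_simps)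
qed

text \<open>The assumption on C says that C intertwines the connections d + u and d + w. Its
  integrability condition, equality of the mixed derivatives of C, is the intertwining of the
  curvatures.\<close>

lemma curv_gauge:
  assumes S: "open S" "\<And>i. msmooth_on (w i) S" "\<And>i. msmooth_on (u i) S" "msmooth_on C S"
    and g: "\<And>i y. y \<in> S \<Longrightarrow> mpd i C y = C y ** u i y - w i y ** C y" and x: "x \<in> S"
  shows "C x ** curv u i j x = curv w i j x ** C x"
proof -
  have "mpd i (mpd j C) x = C x ** u i x ** u j x - w i x ** C x ** u j x + C x ** mpd i (u j) x
      - mpd i (w j) x ** C x - w j x ** C x ** u i x + w j x ** w i x ** C x" for i j
  proof -
    have "mpd i (mpd j C) x = mpd i (\<lambda>y. C y ** u j y - w j y ** C y) x"
      by (rule mpd_cong[OF S(1) x g])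
    also have "\<dots> = mpd i C x ** u j x + C x ** mpd i (u j) x - (mpd i (w j) x ** C x + w j x ** mpd i C x)"
      using S x by (simp add: mpd_diff[of _ S] mpd_mult[of _ S] msmooth_intros)
    finally show ?thesis by (simp add: g[OF x] matrix_ring_simps)
  qed
  from this[of i j] this[of j i] mpd_commute[OF S(1,4) x, of i j] show ?thesis
    by (simp add: curv_def mcomm_def matrix_ring_simps algebra_simps)
qed

lemma curv_add:
  assumes "open S" "\<And>i. msmooth_on (w i) S" "\<And>i. msmooth_on (b i) S" "x \<in> S"
  shows "curv (\<lambda>i y. w i y + b i y) i j x
    = curv w i j x + ad_deriv w i (b j) x - ad_deriv w j (b i) x + mcomm (b i x) (b j x)"
  unfolding curv_def ad_deriv_def using assms
  by (simp add: mpd_add[of _ S] mcomm_simps mcomm_swap[of "b i x" "w j x"])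

section \<open>Orthonormal frames\<close>

definition fr2 :: "real^4^4 \<Rightarrow> (4 \<Rightarrow> 4 \<Rightarrow> real) \<Rightarrow> 4 \<Rightarrow> 4 \<Rightarrow> real" where
  "fr2 C S a b = (\<Sum>i\<in>UNIV. \<Sum>j\<in>UNIV. S i j * C $ i $ a * C $ j $ b)"

definition fr4 :: "real^4^4 \<Rightarrow> tensor4 \<Rightarrow> tensor4" where
  "fr4 C T a b c d = fr2 C (\<lambda>i j. fr2 C (T i j) c d) a b"

lemma fr2_linear:
  "fr2 C (\<lambda>i j. S i j + T i j) a b = fr2 C S a b + fr2 C T a b"
  "fr2 C (\<lambda>i j. S i j - T i j) a b = fr2 C S a b - fr2 C T a b"
  "fr2 C (\<lambda>i j. r * S i j) a b = r * fr2 C S a b"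
  "fr2 C (\<lambda>i j. S i j * r) a b = fr2 C S a b * r"
  "fr2 C (\<lambda>i j. - S i j) a b = - fr2 C S a b"
  by (simp_all add: fr2_def sum.distrib[symmetric] sum_subtractf[symmetric] sum_negf[symmetric]
      sum_distrib_left sum_distrib_right algebra_simps)

lemma fr2_sum: "fr2 C (\<lambda>i j. \<Sum>k\<in>K. S k i j) a b = (\<Sum>k\<in>K. fr2 C (S k) a b)"
  by (induction K rule: infinite_finite_induct) (simp_all add: fr2_linear, simp_all add: fr2_def)

lemma fr2_matrix: "fr2 C S a b = (transpose C ** (\<chi> i j. S i j) ** C) $ a $ b"
proof -
  have "(transpose C ** (\<chi> i j. S i j) ** C) $ a $ b
      = (\<Sum>j\<in>UNIV. \<Sum>i\<in>UNIV. S i j * C $ i $ a * C $ j $ b)"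
    by (simp add: matrix_matrix_mult_def transpose_def sum_distrib_right sum_distrib_left mult_ac)
  also have "\<dots> = fr2 C S a b" unfolding fr2_def by (rule sum.swap)
  finally show ?thesis ..
qed

lemma fr4_expand:
  "fr4 C T a b c d = (\<Sum>i\<in>UNIV. \<Sum>j\<in>UNIV. \<Sum>k\<in>UNIV. \<Sum>l\<in>UNIV.
     T i j k l * (C $ i $ a * C $ j $ b * C $ k $ c * C $ l $ d))"
  by (simp add: fr4_def fr2_def sum_distrib_left sum_distrib_right mult_ac)

lemma sum_permute4:
  fixes f :: "'i::finite \<Rightarrow> 'i \<Rightarrow> 'i \<Rightarrow> 'i \<Rightarrow> real"
  shows "(\<Sum>i\<in>UNIV. \<Sum>j\<in>UNIV. \<Sum>k\<in>UNIV. \<Sum>l\<in>UNIV. f i j k l) = (\<Sum>i\<in>UNIV. \<Sum>k\<in>UNIV. \<Sum>j\<in>UNIV. \<Sum>l\<in>UNIV. f i j k l)"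
    "(\<Sum>i\<in>UNIV. \<Sum>j\<in>UNIV. \<Sum>k\<in>UNIV. \<Sum>l\<in>UNIV. f i j k l) = (\<Sum>i\<in>UNIV. \<Sum>l\<in>UNIV. \<Sum>j\<in>UNIV. \<Sum>k\<in>UNIV. f i j k l)"
    "(\<Sum>j\<in>UNIV. \<Sum>l\<in>UNIV. \<Sum>k\<in>UNIV. \<Sum>i\<in>UNIV. f j l k i) = (\<Sum>i\<in>UNIV. \<Sum>j\<in>UNIV. \<Sum>k\<in>UNIV. \<Sum>l\<in>UNIV. f j l k i)"
  unfolding sum.cartesian_product UNIV_Times_UNIV
    apply (rule sum.reindex_bij_witness[of _ "\<lambda>(i,k,j,l). (i,j,k,l)" "\<lambda>(i,j,k,l). (i,k,j,l)"]; auto)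
   apply (rule sum.reindex_bij_witness[of _ "\<lambda>(i,l,j,k). (i,j,k,l)" "\<lambda>(i,j,k,l). (i,l,j,k)"]; auto)
  apply (rule sum.reindex_bij_witness[of _ "\<lambda>(i,j,k,l). (j,l,k,i)" "\<lambda>(j,l,k,i). (i,j,k,l)"]; auto)
  done

lemma fr4_swap:
  "fr4 C T a b c d = fr2 C (\<lambda>i k. fr2 C (\<lambda>j l. T i j k l) b d) a c"
  "fr4 C T a b c d = fr2 C (\<lambda>i l. fr2 C (\<lambda>j k. T i j k l) b c) a d"
proof -
  show "fr4 C T a b c d = fr2 C (\<lambda>i k. fr2 C (\<lambda>j l. T i j k l) b d) a c"
    unfolding fr4_expand by (subst sum_permute4(1)) (simp add: fr2_def sum_distrib_left sum_distrib_right mult_ac)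
  show "fr4 C T a b c d = fr2 C (\<lambda>i l. fr2 C (\<lambda>j k. T i j k l) b c) a d"
    unfolding fr4_expand by (subst sum_permute4(2)) (simp add: fr2_def sum_distrib_left sum_distrib_right mult_ac)
qed

lemma fr4_linear:
  "fr4 C (\<lambda>i j k l. S i j k l + T i j k l) a b c d = fr4 C S a b c d + fr4 C T a b c d"
  "fr4 C (\<lambda>i j k l. S i j k l - T i j k l) a b c d = fr4 C S a b c d - fr4 C T a b c d"
  "fr4 C (\<lambda>i j k l. r * S i j k l) a b c d = r * fr4 C S a b c d"
  by (simp_all add: fr4_def fr2_linear)

lemma fr4_products:
  "fr4 C (\<lambda>i j k l. P i j * Q k l) a b c d = fr2 C P a b * fr2 C Q c d"
  "fr4 C (\<lambda>i j k l. P i k * Q j l) a b c d = fr2 C P a c * fr2 C Q b d"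
  "fr4 C (\<lambda>i j k l. P j l * Q i k) a b c d = fr2 C P b d * fr2 C Q a c"
  "fr4 C (\<lambda>i j k l. P i l * Q j k) a b c d = fr2 C P a d * fr2 C Q b c"
  "fr4 C (\<lambda>i j k l. P j k * Q i l) a b c d = fr2 C P b c * fr2 C Q a d"
      apply (simp add: fr4_def fr2_linear)
     apply (subst fr4_swap(1), simp add: fr2_linear)
    apply (subst fr4_swap(1), simp add: fr2_linear)
   apply (subst fr4_swap(2), simp add: fr2_linear)
  apply (subst fr4_swap(2), simp add: fr2_linear)
  done

text \<open>The columns of \<open>C x\<close> are the vectors of an orthonormal frame, the rows of \<open>H x\<close> those of the
  dual coframe, and \<open>\<omega> i\<close> is the connection matrix of the frame in the direction \<open>\<partial>\<^sub>i\<close>.\<close>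

locale oframe =
  fixes U :: "(real^4) set" and G C :: "real^4 \<Rightarrow> real^4^4"
  assumes open_U: "open U"
    and G_smooth: "msmooth_on G U" and C_smooth: "msmooth_on C U"
    and G_sym: "\<And>x. x \<in> U \<Longrightarrow> transpose (G x) = G x"
    and orthonormal: "\<And>x. x \<in> U \<Longrightarrow> transpose (C x) ** G x ** C x = mat 1"
begin

definition H :: "real^4 \<Rightarrow> real^4^4" where
  "H x = transpose (C x) ** G x"

definition \<Gamma> :: "4 \<Rightarrow> real^4 \<Rightarrow> real^4^4" where
  "\<Gamma> i x = (\<chi> m n. christoffel G x m i n)"

definition \<omega> :: "4 \<Rightarrow> real^4 \<Rightarrow> real^4^4" where
  "\<omega> i x = H x ** (mpd i C x + \<Gamma> i x ** C x)"

definition Rf :: "real^4 \<Rightarrow> tensor4" where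
  "Rf x = fr4 (C x) (riemann G x)"

lemma HC: "x \<in> U \<Longrightarrow> H x ** C x = mat 1"
  by (simp add: H_def orthonormal)

lemma CH: "x \<in> U \<Longrightarrow> C x ** H x = mat 1"
  using HC matrix_left_right_inverse by blast

lemma inv_G: "x \<in> U \<Longrightarrow> matrix_inv (G x) = C x ** transpose (C x)"
proof -
  assume x: "x \<in> U"
  have 1: "C x ** transpose (C x) ** G x = mat 1"
    using CH[OF x] by (simp add: H_def matrix_mul_assoc)
  then have "invertible (G x)" using invertible_left_inverse by blast
  then have "G x ** matrix_inv (G x) = mat 1"
    unfolding invertible_def matrix_inv_def by (rule someI2_ex) simp
  then have "C x ** transpose (C x) ** (G x ** matrix_inv (G x)) = C x ** transpose (C x)" by simp
  then show ?thesis by (simp add: matrix_mul_assoc 1)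
qed

lemma ginv_eq: "x \<in> U \<Longrightarrow> ginv (G x) i j = (\<Sum>a\<in>UNIV. C x $ i $ a * C x $ j $ a)"
  by (simp add: ginv_def inv_G matrix_matrix_mult_def transpose_def)

lemma G_ginv: "x \<in> U \<Longrightarrow> (\<Sum>m\<in>UNIV. G x $ k $ m * ginv (G x) m l) = kd k l"
proof -
  assume x: "x \<in> U"
  have "G x ** matrix_inv (G x) = mat 1"
    unfolding inv_G[OF x] using CH[OF x]
    by (subst matrix_left_right_inverse) (simp add: H_def matrix_mul_assoc)
  then have "(G x ** matrix_inv (G x)) $ k $ l = kd k l" by (simp add: mat_def kd_def)
  then show ?thesis by (simp add: matrix_matrix_mult_def ginv_def)
qed

lemma G_eq: "x \<in> U \<Longrightarrow> G x = transpose (H x) ** H x"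
proof -
  assume x: "x \<in> U"
  have "transpose (H x) ** H x = G x ** (C x ** H x)"
    by (simp add: H_def matrix_transpose_mul G_sym x matrix_mul_assoc)
  then show ?thesis by (simp add: CH x)
qed

text \<open>The frame writes the inverse metric as a polynomial in the entries of C, so no matrix
  inverse has to be differentiated.\<close>

lemma smooth_ginv: "smooth_on (\<lambda>x. ginv (G x) i j) U"
proof (rule smooth_on_cong[OF open_U])
  show "smooth_on (\<lambda>x. \<Sum>a\<in>UNIV. C x $ i $ a * C x $ j $ a) U"
    by (intro smooth_intros open_U msmooth_on_nth[OF C_smooth])
qed (simp add: ginv_eq)

lemma smooth_christoffel: "smooth_on (\<lambda>x. christoffel G x m i j) U"
  unfolding christoffel_def
  by (intro smooth_intros open_U smooth_ginv msmooth_on_nth[OF G_smooth])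

lemma H_smooth: "msmooth_on H U"
  unfolding H_def[abs_def] by (intro msmooth_intros open_U C_smooth G_smooth)

lemma \<Gamma>_smooth: "msmooth_on (\<Gamma> i) U"
  by (simp add: msmooth_on_def \<Gamma>_def smooth_christoffel)

lemma \<omega>_smooth: "msmooth_on (\<omega> i) U"
  unfolding \<omega>_def[abs_def] by (intro msmooth_intros open_U C_smooth H_smooth \<Gamma>_smooth)

lemma G_swap: "x \<in> U \<Longrightarrow> G x $ i $ j = G x $ j $ i"
  using arg_cong[OF G_sym[of x], of "\<lambda>M. M $ j $ i"] by (simp add: transpose_def)

lemma pd_G_swap: "x \<in> U \<Longrightarrow> pd k (\<lambda>y. G y $ i $ j) x = pd k (\<lambda>y. G y $ j $ i) x"
  by (rule pd_cong_open[OF open_U]) (simp_all add: G_swap[of _ i j])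

lemma christoffel_sym: "x \<in> U \<Longrightarrow> christoffel G x m i j = christoffel G x m j i"
  unfolding christoffel_def by (simp add: pd_G_swap[of x _ i j] add.commute)

lemma christoffel_lower:
  assumes "x \<in> U"
  shows "(\<Sum>m\<in>UNIV. G x $ k $ m * christoffel G x m i j) =
    1/2 * (pd i (\<lambda>y. G y $ j $ k) x + pd j (\<lambda>y. G y $ i $ k) x - pd k (\<lambda>y. G y $ i $ j) x)"
proof -
  let ?D = "\<lambda>l. pd i (\<lambda>y. G y $ j $ l) x + pd j (\<lambda>y. G y $ i $ l) x - pd l (\<lambda>y. G y $ i $ j) x"
  have "(\<Sum>m\<in>UNIV. G x $ k $ m * christoffel G x m i j)
      = (\<Sum>m\<in>UNIV. \<Sum>l\<in>UNIV. G x $ k $ m * ginv (G x) m l * (1/2 * ?D l))"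
    unfolding christoffel_def sum_distrib_left by (simp add: algebra_simps)
  also have "\<dots> = (\<Sum>l\<in>UNIV. (\<Sum>m\<in>UNIV. G x $ k $ m * ginv (G x) m l) * (1/2 * ?D l))"
    unfolding sum_distrib_right by (rule sum.swap)
  also have "\<dots> = 1/2 * ?D k" by (simp only: G_ginv[OF assms] kd_sum)
  finally show ?thesis .
qed

text \<open>Metric compatibility in matrix form: the two lowered Christoffel symbols are added so
  that all but one derivative of the metric cancel.\<close>

lemma mpd_G:
  assumes "x \<in> U"
  shows "mpd i G x = transpose (\<Gamma> i x) ** G x + G x ** \<Gamma> i x"
proof -
  have "(G x ** \<Gamma> i x) $ k $ j + (G x ** \<Gamma> i x) $ j $ k = mpd i G x $ k $ j" for k j
    unfolding matrix_matrix_mult_def \<Gamma>_def mpd_def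
    by (simp add: christoffel_lower[OF assms] pd_G_swap[OF assms, of _ j k]
        pd_G_swap[OF assms, of _ i j] pd_G_swap[OF assms, of _ i k] add_divide_distrib[symmetric])
  moreover have "transpose (\<Gamma> i x) ** G x = transpose (G x ** \<Gamma> i x)"
    by (simp add: matrix_transpose_mul G_sym assms)
  ultimately show ?thesis by (simp add: vec_eq_iff transpose_def add.commute)
qed

lemma mpd_C: "x \<in> U \<Longrightarrow> mpd i C x = C x ** \<omega> i x - \<Gamma> i x ** C x"
  by (simp add: \<omega>_def matrix_mul_assoc CH)

text \<open>Differentiate the orthonormality of the frame and insert \<open>mpd_G\<close>.\<close>

lemma \<omega>_skew: "x \<in> U \<Longrightarrow> transpose (\<omega> i x) = - \<omega> i x"
proof -
  assume x: "x \<in> U"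
  have "mpd i (\<lambda>y. transpose (C y) ** G y ** C y) x = 0"
    using mpd_cong[OF open_U x, of "\<lambda>y. transpose (C y) ** G y ** C y" "\<lambda>y. mat 1" i] orthonormal
    by simp
  moreover have "mpd i (\<lambda>y. transpose (C y) ** G y ** C y) x =
      (transpose (mpd i C x) ** G x + transpose (C x) ** mpd i G x) ** C x + transpose (C x) ** G x ** mpd i C x"
    using open_U C_smooth G_smooth x
    by (simp add: mpd_mult[of _ U] msmooth_intros mpd_transpose)
  moreover have "transpose (\<omega> i x) = (transpose (mpd i C x) + transpose (C x) ** transpose (\<Gamma> i x)) ** (G x ** C x)"
    unfolding \<omega>_def H_def
    by (simp add: matrix_transpose_mul G_sym[OF x]) (simp add: transpose_def matrix_matrix_mult_def vec_eq_iff mult.commute)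
  ultimately have "transpose (\<omega> i x) + \<omega> i x = 0"
    by (simp add: mpd_G[OF x] \<omega>_def H_def matrix_ring_simps add_ac)
  then show ?thesis by (simp add: eq_neg_iff_add_eq_0)
qed

lemma \<omega>_skew_nth: "x \<in> U \<Longrightarrow> \<omega> i x $ a $ b = - \<omega> i x $ b $ a"
  using arg_cong[OF \<omega>_skew[of x i], of "\<lambda>M. M $ b $ a"] by (simp add: transpose_def)

lemma mpd_H:
  assumes x: "x \<in> U"
  shows "mpd i H x = H x ** \<Gamma> i x - \<omega> i x ** H x"
proof -
  have "mpd i (\<lambda>y. H y ** C y) x = 0"
    using mpd_cong[OF open_U x, of "\<lambda>y. H y ** C y" "\<lambda>y. mat 1" i] HC by simp
  then have "mpd i H x ** C x = - (H x ** mpd i C x)"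
    using x by (simp add: mpd_mult[of _ U] H_smooth C_smooth eq_neg_iff_add_eq_0)
  then have "mpd i H x ** (C x ** H x) = - (H x ** C x ** \<omega> i x ** H x) + H x ** \<Gamma> i x ** (C x ** H x)"
    by (simp add: mpd_C[OF x] matrix_ring_simps)
  then show ?thesis by (simp add: CH HC x)
qed

text \<open>By \<open>mpd_C\<close>, passing from the coordinate frame to the orthonormal one is a
  change of gauge from \<open>\<Gamma>\<close> to \<open>\<omega>\<close>.\<close>

lemma curv_\<omega>:
  assumes x: "x \<in> U"
  shows "curv \<omega> i j x = H x ** curv \<Gamma> i j x ** C x"
proof -
  have "C x ** curv \<omega> i j x = curv \<Gamma> i j x ** C x"
    by (rule curv_gauge[OF open_U \<Gamma>_smooth \<omega>_smooth C_smooth mpd_C x])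
  then have "H x ** (C x ** curv \<omega> i j x) = H x ** curv \<Gamma> i j x ** C x"
    by (simp add: matrix_mul_assoc)
  then show ?thesis by (simp add: matrix_mul_assoc HC x)
qed

lemma riemann_eq: "riemann G x i j k l = (G x ** curv \<Gamma> i j x) $ k $ l"
  unfolding riemann_def
  by (simp add: matrix_matrix_mult_def curv_def mcomm_def \<Gamma>_def mpd_def sum_subtractf)

lemma fr2_riemann: "x \<in> U \<Longrightarrow> fr2 (C x) (riemann G x i j) c d = curv \<omega> i j x $ c $ d"
  by (simp add: fr2_matrix riemann_eq curv_\<omega> H_def matrix_mul_assoc)

lemma Rf_eq: "x \<in> U \<Longrightarrow> Rf x a b c d = fr2 (C x) (\<lambda>i j. curv \<omega> i j x $ c $ d) a b"
  by (simp add: Rf_def fr4_def fr2_riemann)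

lemma curv_swap: "curv w i j x = - curv w j i x"
  by (simp add: curv_def mcomm_swap[of "w i x"])

lemma mpd_skew: assumes "\<And>y. y \<in> U \<Longrightarrow> transpose (M y) = - M y" "x \<in> U" "msmooth_on M U"
  shows "transpose (mpd i M x) = - mpd i M x"
proof -
  have "mpd i (\<lambda>y. transpose (M y)) x = mpd i (\<lambda>y. 0 - M y) x"
    by (rule mpd_cong[OF open_U assms(2)]) (simp add: assms(1))
  also have "\<dots> = 0 - mpd i M x"
    using mpd_diff[of "\<lambda>y. 0" U M x i] assms by (simp add: msmooth_on_def smooth_on_const)
  finally show ?thesis by (simp add: mpd_transpose)
qed

lemma curv_skew:
  assumes x: "x \<in> U" and w: "\<And>i y. y \<in> U \<Longrightarrow> transpose (w i y) = - w i y" "\<And>i. msmooth_on (w i) U"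
  shows "curv w i j x $ a $ b = - curv w i j x $ b $ (a::4)"
proof -
  have t: "transpose (M + N) = transpose M + transpose N" "transpose (M - N) = transpose M - transpose N"
    for M N :: "real^4^4" by (simp_all add: transpose_def vec_eq_iff)
  have "transpose (curv w i j x) = - curv w i j x"
    unfolding curv_def mcomm_def
    by (simp add: t matrix_transpose_mul mpd_skew[OF w(1) x w(2)] w(1)[OF x] matrix_ring_simps)
  from arg_cong[OF this, of "\<lambda>M. M $ b $ a"] show ?thesis by (simp add: transpose_def)
qed

lemma curv_\<omega>_skew: "x \<in> U \<Longrightarrow> curv \<omega> i j x $ a $ b = - curv \<omega> i j x $ b $ a"
  by (rule curv_skew[OF _ \<omega>_skew \<omega>_smooth])

lemma curv_\<Gamma>_bianchi:
  assumes x: "x \<in> U"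
  shows "curv \<Gamma> i j x $ m $ l + curv \<Gamma> j l x $ m $ i + curv \<Gamma> l i x $ m $ j = 0"
proof -
  have p: "pd i (\<lambda>y. christoffel G y m j l) x = pd i (\<lambda>y. christoffel G y m l j) x" for i j l
    by (rule pd_cong_open[OF open_U x]) (rule christoffel_sym)
  have "curv \<Gamma> i j x $ m $ l = pd i (\<lambda>y. christoffel G y m j l) x - pd j (\<lambda>y. christoffel G y m i l) x
     + ((\<Sum>n\<in>UNIV. christoffel G x m i n * christoffel G x n j l)
        - (\<Sum>n\<in>UNIV. christoffel G x m j n * christoffel G x n i l))" for i j l
    by (simp add: matrix_matrix_mult_def curv_def mcomm_def \<Gamma>_def mpd_def)
  then show ?thesis
    by (simp add: p[of _ l i] p[of _ l j] p[of _ j i] christoffel_sym[OF x, of _ l i]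
        christoffel_sym[OF x, of _ l j] christoffel_sym[OF x, of _ j i])
qed

lemma riemann_bianchi:
  assumes x: "x \<in> U"
  shows "riemann G x i j k l + riemann G x j l k i + riemann G x l i k j = 0"
proof -
  have "riemann G x i j k l + riemann G x j l k i + riemann G x l i k j =
    (\<Sum>m\<in>UNIV. G x $ k $ m * (curv \<Gamma> i j x $ m $ l + curv \<Gamma> j l x $ m $ i + curv \<Gamma> l i x $ m $ j))"
    by (simp add: riemann_eq matrix_matrix_mult_def sum.distrib distrib_left)
  then show ?thesis by (simp add: curv_\<Gamma>_bianchi[OF x])
qed

lemma curvature_like_Rf:
  assumes x: "x \<in> U"
  shows "curvature_like (Rf x)"
  unfolding curvature_like_def
proof (intro conjI allI)
  fix a b c d
  show 1: "Rf x a b d c = - Rf x a b c d" for a b c d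
    unfolding Rf_eq[OF x] by (subst curv_\<omega>_skew[OF x]) (rule fr2_linear)
  have sw: "fr2 (C x) S b a = fr2 (C x) (\<lambda>i j. S j i) a b" for S a b
    unfolding fr2_def by (subst sum.swap) (simp add: mult_ac)
  show "Rf x b a c d = - Rf x a b c d"
    unfolding Rf_eq[OF x] by (subst sw, subst curv_swap) (simp add: fr2_linear)
  have "Rf x a b d c + Rf x b c d a + Rf x c a d b = 0" for a b c d
  proof -
    \<comment> \<open>All three terms are rewritten against this one monomial in the frame, so that
      the coordinate identity can be applied under the sum.\<close>
    let ?K = "\<lambda>i j k l. C x $ i $ a * C x $ j $ b * C x $ k $ d * C x $ l $ c"
    have 2: "Rf x b c d a = (\<Sum>i\<in>UNIV. \<Sum>j\<in>UNIV. \<Sum>k\<in>UNIV. \<Sum>l\<in>UNIV. riemann G x j l k i * ?K i j k l)"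
      unfolding Rf_def fr4_expand by (subst sum_permute4(3)) (simp add: mult_ac)
    have 3: "Rf x c a d b = (\<Sum>i\<in>UNIV. \<Sum>j\<in>UNIV. \<Sum>k\<in>UNIV. \<Sum>l\<in>UNIV. riemann G x l i k j * ?K i j k l)"
      unfolding Rf_def fr4_expand by (subst sum_permute4(3), subst sum_permute4(3)) (simp add: mult_ac)
    have 1: "Rf x a b d c = (\<Sum>i\<in>UNIV. \<Sum>j\<in>UNIV. \<Sum>k\<in>UNIV. \<Sum>l\<in>UNIV. riemann G x i j k l * ?K i j k l)"
      unfolding Rf_def fr4_expand ..
    have "Rf x a b d c + Rf x b c d a + Rf x c a d b = (\<Sum>i\<in>UNIV. \<Sum>j\<in>UNIV. \<Sum>k\<in>UNIV. \<Sum>l\<in>UNIV.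
        (riemann G x i j k l + riemann G x j l k i + riemann G x l i k j) * ?K i j k l)"
      unfolding 1 2 3 by (simp only: sum.distrib distrib_right)
    then show ?thesis by (simp add: riemann_bianchi[OF x])
  qed
  then show "Rf x a b c d + Rf x b c a d + Rf x c a b d = 0"
    using 1[of a b c d] 1[of b c a d] 1[of c a b d] by (smt (verit))
qed

end

lemma fr2_prod: "fr2 C (\<lambda>i j. p i * q j) a b = (\<Sum>i\<in>UNIV. p i * C $ i $ a) * (\<Sum>j\<in>UNIV. q j * C $ j $ b)"
  by (simp add: fr2_def sum_product mult_ac)

lemma smooth_on_fr2 [smooth_intros]:
  assumes "open S" "msmooth_on C S" "\<And>i j. smooth_on (\<lambda>x. T x i j) S"
  shows "smooth_on (\<lambda>x. fr2 (C x) (T x) a b) S"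
  unfolding fr2_def by (intro smooth_intros assms msmooth_on_nth[OF assms(2)])

lemma smooth_on_cdivide [smooth_intros]:
  "open S \<Longrightarrow> smooth_on F S \<Longrightarrow> smooth_on (\<lambda>y. F y / c) S"
  using smooth_on_mult[OF _ _ smooth_on_const[of "inverse c"], of S F] by (simp add: divide_inverse)

lemma matrix_scaleR:
  fixes M :: "real^'n^'m" and N :: "real^'k^'n"
  shows "M ** (r *\<^sub>R N) = r *\<^sub>R (M ** N)" "(r *\<^sub>R M) ** N = r *\<^sub>R (M ** N)"
  by (simp_all add: matrix_matrix_mult_def vec_eq_iff sum_distrib_left mult_ac)

section \<open>Ricci, scalar and Weyl curvature in an orthonormal frame\<close>

context oframe
begin

lemma fr2_G: "x \<in> U \<Longrightarrow> fr2 (C x) (\<lambda>i j. G x $ i $ j) a b = kd a b"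
  by (simp add: fr2_matrix orthonormal mat_def kd_def)

text \<open>The inverse metric is C times its transpose, so every contraction with it is a plain
  trace of frame components.\<close>

lemma ginv_trace:
  assumes "x \<in> U"
  shows "(\<Sum>j\<in>UNIV. \<Sum>l\<in>UNIV. ginv (G x) j l * q j l) = (\<Sum>b\<in>UNIV. fr2 (C x) q b b)"
proof -
  have "(\<Sum>b\<in>UNIV. fr2 (C x) q b b)
      = (\<Sum>j\<in>UNIV. \<Sum>b\<in>UNIV. \<Sum>l\<in>UNIV. q j l * C x $ j $ b * C x $ l $ b)"
    unfolding fr2_def by (rule sum.swap)
  also have "\<dots> = (\<Sum>j\<in>UNIV. \<Sum>l\<in>UNIV. \<Sum>b\<in>UNIV. q j l * C x $ j $ b * C x $ l $ b)"
    by (rule sum.cong[OF refl]) (rule sum.swap)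
  finally show ?thesis by (simp add: ginv_eq[OF assms] sum_distrib_left sum_distrib_right mult_ac)
qed

lemma fr2_ricci: "x \<in> U \<Longrightarrow> fr2 (C x) (ricci G x) a c = ricci_tr (Rf x) a c"
  unfolding ricci_def[abs_def] ricci_tr_def Rf_def fr4_swap(1)
  by (simp add: ginv_trace fr2_sum)

lemma scalar_curv_eq: "x \<in> U \<Longrightarrow> scalar_curv G x = (\<Sum>e\<in>UNIV. ricci_tr (Rf x) e e)"
  by (simp add: scalar_curv_def ginv_trace fr2_ricci)

lemma fr4_weyl:
  assumes x: "x \<in> U"
  shows "fr4 (C x) (weyl G x) = weyl_part (Rf x)"
proof (intro ext)
  fix a b c d
  have "fr4 (C x) (weyl G x) a b c d = Rf x a b c d
     - 1/2 * (fr4 (C x) (\<lambda>i j k l. G x $ i $ k * ricci G x j l) a b c d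
        + fr4 (C x) (\<lambda>i j k l. G x $ j $ l * ricci G x i k) a b c d
        - fr4 (C x) (\<lambda>i j k l. G x $ i $ l * ricci G x j k) a b c d
        - fr4 (C x) (\<lambda>i j k l. G x $ j $ k * ricci G x i l) a b c d)
     + scalar_curv G x / 6 * (fr4 (C x) (\<lambda>i j k l. G x $ i $ k * G x $ j $ l) a b c d
        - fr4 (C x) (\<lambda>i j k l. G x $ i $ l * G x $ j $ k) a b c d)"
    unfolding weyl_def[abs_def] Rf_def by (simp only: fr4_linear)
  also have "\<dots> = weyl_part (Rf x) a b c d"
    unfolding fr4_products(2)[of _ "\<lambda>i k. G x $ i $ k" "\<lambda>j l. ricci G x j l"]
      fr4_products(3)[of _ "\<lambda>i k. G x $ i $ k" "\<lambda>j l. ricci G x j l"]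
      fr4_products(4)[of _ "\<lambda>i k. G x $ i $ k" "\<lambda>j l. ricci G x j l"]
      fr4_products(5)[of _ "\<lambda>i k. G x $ i $ k" "\<lambda>j l. ricci G x j l"]
      fr4_products(2)[of _ "\<lambda>i k. G x $ i $ k" "\<lambda>j l. G x $ j $ l"]
      fr4_products(4)[of _ "\<lambda>i k. G x $ i $ k" "\<lambda>j l. G x $ j $ l"]
    unfolding weyl_part_def by (simp add: fr2_G[OF x] fr2_ricci[OF x] scalar_curv_eq[OF x])
  finally show "fr4 (C x) (weyl G x) a b c d = weyl_part (Rf x) a b c d" .
qed

lemma smooth_riemann: "smooth_on (\<lambda>x. riemann G x i j k l) U"
  unfolding riemann_def
  by (intro smooth_intros open_U smooth_christoffel msmooth_on_nth[OF G_smooth])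

lemma smooth_ricci: "smooth_on (\<lambda>x. ricci G x i j) U"
  unfolding ricci_def by (intro smooth_intros open_U smooth_riemann smooth_ginv)

lemma smooth_scalar_curv: "smooth_on (scalar_curv G) U"
  unfolding scalar_curv_def[abs_def] by (intro smooth_intros open_U smooth_ricci smooth_ginv)

lemma smooth_weyl: "smooth_on (\<lambda>x. weyl G x i j k l) U"
  unfolding weyl_def divide_inverse
  by (intro smooth_intros open_U smooth_riemann smooth_ricci smooth_scalar_curv[unfolded eta_contract_eq]
      msmooth_on_nth[OF G_smooth])

end

text \<open>\<open>A\<close> is the matrix of \<open>W\<^sup>\<plusminus>\<close> in the orthonormal basis \<open>sd s / \<surd>2\<close>, \<open>w \<beta>\<close> is the two-form with frame
  components \<open>sd s \<beta>\<close>, and \<open>\<nabla>\<^sub>i w\<^sub>\<beta> = \<Sum>\<^sub>\<gamma> \<Theta>\<^sub>i\<^sub>\<gamma>\<^sub>\<beta> w\<^sub>\<gamma>\<close>, so that \<open>ad_deriv \<Theta> i A\<close> is the matrix of \<open>\<nabla>\<^sub>i W\<^sup>\<plusminus>\<close>.\<close>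

locale oframe_sign = oframe +
  fixes s :: real
  assumes sign: "s * s = 1"
begin

definition A :: "real^4 \<Rightarrow> real^3^3" where
  "A x = (\<chi> \<alpha> \<beta>. sd_block s (fr4 (C x) (weyl G x)) \<alpha> \<beta>)"

definition \<Theta> :: "4 \<Rightarrow> real^4 \<Rightarrow> real^3^3" where
  "\<Theta> i x = (\<chi> \<alpha> \<beta>. ad3 s (sd_comp s (\<lambda>a b. \<omega> i x $ a $ b)) \<alpha> \<beta>)"

definition J :: "3 \<Rightarrow> real^4^4" where
  "J \<beta> = (\<chi> a b. sd s \<beta> a b)"

definition w :: "3 \<Rightarrow> real^4 \<Rightarrow> real^4^4" where
  "w \<beta> x = transpose (H x) ** J \<beta> ** H x"

lemma A_smooth: "msmooth_on A U"
  unfolding msmooth_on_def A_def sd_block_def sd_comp_def fr4_def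
  by (simp, intro allI smooth_intros open_U C_smooth smooth_weyl)

lemma A_sym: "x \<in> U \<Longrightarrow> A x $ \<alpha> $ \<beta> = A x $ \<beta> $ \<alpha>"
  and A_trace: "x \<in> U \<Longrightarrow> (\<Sum>\<alpha>\<in>UNIV. A x $ \<alpha> $ \<alpha>) = 0"
  and weyl_sd_comp: "x \<in> U \<Longrightarrow> sd_comp s (weyl_part (Rf x) a b) \<alpha> = 2 * (\<Sum>\<beta>\<in>UNIV. A x $ \<alpha> $ \<beta> * sd s \<beta> a b)"
  and Rf_block: "x \<in> U \<Longrightarrow> sd_block s (Rf x) \<alpha> \<beta> = A x $ \<alpha> $ \<beta> + scalar_curv G x / 12 * kd \<alpha> \<beta>"
  using weyl_self_dual[OF weyl_part_curvature_like[OF curvature_like_Rf] weyl_part_trace[OF curvature_like_Rf] sign, of x]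
    sd_block_weyl_part[OF curvature_like_Rf sign, of x]
  by (simp_all add: A_def fr4_weyl scalar_curv_eq)

lemma \<Theta>_smooth: "msmooth_on (\<Theta> i) U"
  unfolding msmooth_on_def \<Theta>_def ad3_def sd_comp_def
  by (simp, intro allI smooth_intros open_U msmooth_on_nth[OF \<omega>_smooth])

lemma \<Theta>_skew: "\<Theta> i x $ \<alpha> $ \<beta> = - \<Theta> i x $ \<beta> $ \<alpha>"
  unfolding \<Theta>_def by (simp add: ad3_skew[of s _ \<alpha>])

lemma pd_sd_comp:
  assumes "x \<in> S" "msmooth_on M S"
  shows "pd i (\<lambda>y. sd_comp s (\<lambda>a b. M y $ a $ b) \<gamma>) x = sd_comp s (\<lambda>a b. mpd i M x $ a $ b) \<gamma>"
  unfolding sd_comp_def using msmooth_on_differentiable[OF assms(2,1)]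
  by (simp add: pd_sum pd_cmult mpd_def differentiable_sum differentiable_mult)

lemma ad3_add: "ad3 s (\<lambda>\<gamma>. n \<gamma> + m \<gamma>) \<alpha> \<beta> = ad3 s n \<alpha> \<beta> + ad3 s m \<alpha> \<beta>"
  and ad3_diff: "ad3 s (\<lambda>\<gamma>. n \<gamma> - m \<gamma>) \<alpha> \<beta> = ad3 s n \<alpha> \<beta> - ad3 s m \<alpha> \<beta>"
  by (simp_all add: ad3_def sum_3 algebra_simps)

lemma sd_comp_add: "sd_comp s (\<lambda>a b. u a b + u' a b) = (\<lambda>\<gamma>. sd_comp s u \<gamma> + sd_comp s u' \<gamma>)"
  and sd_comp_diff: "sd_comp s (\<lambda>a b. u a b - u' a b) = (\<lambda>\<gamma>. sd_comp s u \<gamma> - sd_comp s u' \<gamma>)"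
  by (simp_all add: fun_eq_iff sd_comp_def sum.distrib sum_subtractf algebra_simps)

text \<open>The projection is linear, so it commutes with the derivatives; the quadratic part of the
  curvature is respected by \<open>ad3_commutator\<close>.\<close>

lemma curv_\<Theta>:
  assumes x: "x \<in> U"
  shows "curv \<Theta> i j x $ \<alpha> $ \<beta> = ad3 s (sd_comp s (\<lambda>a b. curv \<omega> i j x $ a $ b)) \<alpha> \<beta>"
proof -
  have d: "mpd i (\<Theta> j) x $ \<alpha> $ \<beta> = ad3 s (sd_comp s (\<lambda>a b. mpd i (\<omega> j) x $ a $ b)) \<alpha> \<beta>" for i j
  proof -
    let ?n = "\<lambda>\<gamma> y. sd_comp s (\<lambda>a b. \<omega> j y $ a $ b) \<gamma>"
    have n: "smooth_on (?n \<gamma>) U" for \<gamma>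
      unfolding sd_comp_def by (intro smooth_intros open_U msmooth_on_nth[OF \<omega>_smooth])
    have diff: "?n \<gamma> differentiable (at x)" "(\<lambda>y. r * ?n \<gamma> y) differentiable (at x)"
      "(\<lambda>y. \<Sum>\<gamma>\<in>UNIV. eps3 \<gamma> \<beta> \<alpha> * ?n \<gamma> y) differentiable (at x)" for \<gamma> r
      by (intro smooth_on_differentiable[OF _ x] smooth_intros open_U n)+
    show ?thesis
      unfolding mpd_def[of i "\<Theta> j"] \<Theta>_def ad3_def vec_lambda_beta pd_cmult[OF diff(3)] pd_sum[OF diff(2)]
        pd_cmult[OF diff(1)] pd_sd_comp[OF x \<omega>_smooth] ..
  qed
  have "mcomm (\<Theta> i x) (\<Theta> j x) $ \<alpha> $ \<beta> = ad3 s (sd_comp s (\<lambda>a b. mcomm (\<omega> i x) (\<omega> j x) $ a $ b)) \<alpha> \<beta>"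
    using ad3_commutator[where w = "\<lambda>a b. \<omega> i x $ a $ b" and u = "\<lambda>a b. \<omega> j x $ a $ b"
      and \<alpha> = \<alpha> and \<beta> = \<beta>, OF sign \<omega>_skew_nth[OF x] \<omega>_skew_nth[OF x]]
    by (simp add: mcomm_def matrix_matrix_mult_def \<Theta>_def sum_subtractf)
  then show ?thesis
    unfolding curv_def by (simp add: d sd_comp_add sd_comp_diff ad3_add ad3_diff)
qed

lemma mcomm_J:
  assumes x: "x \<in> U"
  shows "mcomm (\<omega> i x) (J \<alpha>) $ a $ b = (\<Sum>\<beta>\<in>UNIV. \<Theta> i x $ \<beta> $ \<alpha> * sd s \<beta> a b)"
  using sd_commutator[where w = "\<lambda>a b. \<omega> i x $ a $ b" and a = a and \<alpha> = \<alpha> and b = b,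
      OF sign \<omega>_skew_nth[OF x]]
  by (simp add: mcomm_def matrix_matrix_mult_def \<Theta>_def J_def sum_subtractf)

lemma J_nth: "J \<beta> $ a $ b = sd s \<beta> a b"
  by (simp add: J_def)

lemma w_nth: "w \<beta> x $ i $ j = (\<Sum>a\<in>UNIV. \<Sum>b\<in>UNIV. sd s \<beta> a b * (H x $ a $ i * H x $ b $ j))"
proof -
  have "w \<beta> x $ i $ j = (\<Sum>b\<in>UNIV. \<Sum>a\<in>UNIV. sd s \<beta> a b * (H x $ a $ i * H x $ b $ j))"
    by (simp add: w_def J_def matrix_matrix_mult_def transpose_def sum_distrib_left sum_distrib_right mult_ac)
  also have "\<dots> = (\<Sum>a\<in>UNIV. \<Sum>b\<in>UNIV. sd s \<beta> a b * (H x $ a $ i * H x $ b $ j))"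
    by (rule sum.swap)
  finally show ?thesis .
qed

lemma w_smooth: "msmooth_on (w \<beta>) U"
proof -
  have "msmooth_on (\<lambda>y. J \<beta>) U" by (simp add: msmooth_on_def smooth_on_const)
  then show ?thesis unfolding w_def[abs_def] by (intro msmooth_intros open_U H_smooth)
qed

text \<open>The \<open>\<Gamma>\<close> terms belong to the two form indices. The rotation of the
  coframe leaves the bracket of \<open>\<omega>\<close> with J, which \<open>mcomm_J\<close>
  expresses through \<open>\<Theta>\<close>.\<close>

lemma mpd_w:
  assumes x: "x \<in> U"
  shows "mpd i (w \<beta>) x = transpose (\<Gamma> i x) ** w \<beta> x + w \<beta> x ** \<Gamma> i x
    + (\<Sum>\<gamma>\<in>UNIV. \<Theta> i x $ \<gamma> $ \<beta> *\<^sub>R w \<gamma> x)"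
proof -
  have J: "msmooth_on (\<lambda>y. J \<beta>) U" by (simp add: msmooth_on_def smooth_on_const)
  have t: "transpose (M - N) = transpose M - transpose N" for M N :: "real^4^4"
    by (simp add: transpose_def vec_eq_iff)
  have "mpd i (w \<beta>) x = transpose (mpd i H x) ** J \<beta> ** H x + transpose (H x) ** J \<beta> ** mpd i H x"
    unfolding w_def[abs_def] using x J H_smooth open_U
    by (simp add: mpd_mult[of _ U] msmooth_intros mpd_transpose)
  also have "\<dots> = transpose (\<Gamma> i x) ** w \<beta> x + w \<beta> x ** \<Gamma> i x
      + transpose (H x) ** mcomm (\<omega> i x) (J \<beta>) ** H x"
    by (simp add: mpd_H[OF x] t matrix_transpose_mul \<omega>_skew[OF x] matrix_ring_simps w_def mcomm_def)
  also have "mcomm (\<omega> i x) (J \<beta>) = (\<Sum>\<gamma>\<in>UNIV. \<Theta> i x $ \<gamma> $ \<beta> *\<^sub>R J \<gamma>)"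
    by (simp add: vec_eq_iff mcomm_J[OF x] J_nth)
  also have "transpose (H x) ** (\<Sum>\<gamma>\<in>UNIV. \<Theta> i x $ \<gamma> $ \<beta> *\<^sub>R J \<gamma>) ** H x
      = (\<Sum>\<gamma>\<in>UNIV. \<Theta> i x $ \<gamma> $ \<beta> *\<^sub>R w \<gamma> x)"
    by (simp add: sum_3 w_def matrix_ring_simps matrix_scaleR)
  finally show ?thesis .
qed

end

lemma sd_comp_commutator:
  assumes s: "s * s = 1" and w: "\<And>a b. w a b = - w b a" and u: "\<And>a b. u a b = - u b a"
  shows "sd_comp s (\<lambda>a b. \<Sum>c\<in>UNIV. w a c * u c b - u a c * w c b) \<alpha> =
    (\<Sum>\<beta>\<in>UNIV. ad3 s (sd_comp s w) \<alpha> \<beta> * sd_comp s u \<beta>)"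
proof -
  let ?c = "\<lambda>a b. \<Sum>c\<in>UNIV. w a c * u c b - u a c * w c b"
  have c: "?c a b = - ?c b a" for a b
    unfolding sum_negf[symmetric]
    by (rule sum.cong) (use w u in \<open>metis (no_types, opaque_lifting) minus_diff_eq minus_mult_minus mult.commute\<close>)+
  have r: "w 2 1 = - w 1 2" "w 3 1 = - w 1 3" "w 4 1 = - w 1 4"
      "w 3 2 = - w 2 3" "w 4 2 = - w 2 4" "w 4 3 = - w 3 4"
      "u 2 1 = - u 1 2" "u 3 1 = - u 1 3" "u 4 1 = - u 1 4"
      "u 3 2 = - u 2 3" "u 4 2 = - u 2 4" "u 4 3 = - u 3 4"
    by (rule w u)+
  have s2: "s * (s * x) = x" for x using s by (simp add: mult.assoc[symmetric])
  have "\<forall>\<alpha>. sd_comp s ?c \<alpha> = (\<Sum>\<beta>\<in>UNIV. ad3 s (sd_comp s w) \<alpha> \<beta> * sd_comp s u \<beta>)"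
    unfolding forall_3 sum_3 ad3_sd_comp_table[OF s w] sd_comp_table[OF u] sd_comp_table[OF c]
    unfolding sum_4 skew_diag[of w, OF w] skew_diag[of u, OF u]
    unfolding r
    by (simp add: s2 algebra_simps)
  then show ?thesis by blast
qed

context oframe
begin

lemma fr2_inverse:
  assumes x: "x \<in> U"
  shows "S i j = (\<Sum>c\<in>UNIV. \<Sum>d\<in>UNIV. fr2 (C x) S c d * (H x $ c $ i * H x $ d $ j))"
proof -
  have t: "transpose (H x) ** transpose (C x) = mat 1"
    using CH[OF x] matrix_transpose_mul[of "C x" "H x"] by simp
  have "(\<chi> i j. S i j) = transpose (H x) ** transpose (C x) ** (\<chi> i j. S i j) ** (C x ** H x)"
    by (simp add: t CH[OF x])
  also have "\<dots> = transpose (H x) ** (\<chi> c d. fr2 (C x) S c d) ** H x"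
    by (simp add: fr2_matrix vec_lambda_eta matrix_mul_assoc)
  finally have "(\<chi> i j. S i j) = transpose (H x) ** (\<chi> c d. fr2 (C x) S c d) ** H x" .
  from arg_cong[OF this, of "\<lambda>M. M $ i $ j"]
  have "S i j = (transpose (H x) ** (\<chi> c d. fr2 (C x) S c d) ** H x) $ i $ j" by simp
  also have "\<dots> = (\<Sum>d\<in>UNIV. \<Sum>c\<in>UNIV. fr2 (C x) S c d * (H x $ c $ i * H x $ d $ j))"
    by (simp add: matrix_matrix_mult_def transpose_def sum_distrib_left sum_distrib_right mult_ac)
  also have "\<dots> = (\<Sum>c\<in>UNIV. \<Sum>d\<in>UNIV. fr2 (C x) S c d * (H x $ c $ i * H x $ d $ j))"
    by (rule sum.swap)
  finally show ?thesis .
qed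

lemma HC_nth: "x \<in> U \<Longrightarrow> (\<Sum>i\<in>UNIV. H x $ a $ i * C x $ i $ b) = kd a b"
proof -
  assume x: "x \<in> U"
  have "(H x ** C x) $ a $ b = kd a b" by (simp add: HC[OF x] mat_def kd_def)
  then show ?thesis by (simp add: matrix_matrix_mult_def)
qed

end

section \<open>Conformally Einstein metrics\<close>

locale conf_einstein = oframe_sign +
  fixes F L :: "real^4 \<Rightarrow> real"
  assumes F_smooth: "smooth_on F U" and L_smooth: "smooth_on L U"
    and soliton: "\<And>x i j. x \<in> U \<Longrightarrow>
      ricci G x i j + hessian G F x i j + 1/2 * (pd i F x * pd j F x) = L x * G x $ i $ j"
begin

text \<open>Frame components of du, where exp(- F) = exp(2u).\<close>

definition v :: "real^4 \<Rightarrow> 4 \<Rightarrow> real" where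
  "v x b = - 1/2 * (\<Sum>m\<in>UNIV. C x $ m $ b * pd m F x)"

text \<open>\<open>\<omega> + bm\<close> is the Levi-Civita connection of the Einstein metric \<open>exp (- F) G\<close> in the frame
  rescaled to be orthonormal for it.\<close>

definition bm :: "4 \<Rightarrow> real^4 \<Rightarrow> real^4^4" where
  "bm i x = (\<chi> a b. H x $ a $ i * v x b - H x $ b $ i * v x a)"

definition Tm :: "4 \<Rightarrow> real^4 \<Rightarrow> 4 \<Rightarrow> real" where
  "Tm i x b = - 1/2 * (\<Sum>m\<in>UNIV. C x $ m $ b * hessian G F x i m)"

text \<open>If the Ricci tensor of exp(- F) G is 3 k times that metric, this is k exp(- F): the
  curvature of the Einstein metric still takes its two arguments in the frame that is orthonormal
  for G. Half of it times G is the Schouten tensor of the Einstein metric.\<close>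

definition \<rho> :: "real^4 \<Rightarrow> real" where
  "\<rho> x = L x - scalar_curv G x / 6 - (\<Sum>a\<in>UNIV. v x a * v x a)"

definition \<omega>b :: "4 \<Rightarrow> real^4 \<Rightarrow> real^4^4" where
  "\<omega>b i x = \<omega> i x + bm i x"

lemma v_smooth: "smooth_on (\<lambda>x. v x b) U"
  unfolding v_def by (intro smooth_intros open_U msmooth_on_nth[OF C_smooth] F_smooth)

lemma bm_smooth: "msmooth_on (bm i) U"
  unfolding msmooth_on_def bm_def vec_lambda_beta
  by (intro allI smooth_intros open_U msmooth_on_nth[OF H_smooth] v_smooth)

lemma \<omega>b_smooth: "msmooth_on (\<omega>b i) U"
  unfolding \<omega>b_def[abs_def] by (intro msmooth_intros open_U bm_smooth \<omega>_smooth)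

lemma \<rho>_smooth: "smooth_on \<rho> U"
  unfolding \<rho>_def[abs_def]
  by (intro smooth_intros open_U v_smooth L_smooth[unfolded eta_contract_eq] smooth_scalar_curv[unfolded eta_contract_eq])

lemma pd_H:
  assumes x: "x \<in> U"
  shows "pd i (\<lambda>y. H y $ a $ j) x =
    (\<Sum>m\<in>UNIV. H x $ a $ m * christoffel G x m i j) - (\<Sum>c\<in>UNIV. \<omega> i x $ a $ c * H x $ c $ j)"
  using arg_cong[OF mpd_H[OF x, of i], of "\<lambda>M. M $ a $ j"]
  by (simp add: mpd_def matrix_matrix_mult_def \<Gamma>_def)

lemma pd_C:
  assumes x: "x \<in> U"
  shows "pd i (\<lambda>y. C y $ m $ b) x =
    (\<Sum>c\<in>UNIV. C x $ m $ c * \<omega> i x $ c $ b) - (\<Sum>n\<in>UNIV. christoffel G x m i n * C x $ n $ b)"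
  using arg_cong[OF mpd_C[OF x, of i], of "\<lambda>M. M $ m $ b"]
  by (simp add: mpd_def matrix_matrix_mult_def \<Gamma>_def)

text \<open>So \<open>Tm i x b\<close> is the component b of the covariant derivative of v along the
  i-th coordinate.\<close>

lemma pd_v:
  assumes x: "x \<in> U"
  shows "pd i (\<lambda>y. v y b) x = Tm i x b - (\<Sum>c\<in>UNIV. \<omega> i x $ b $ c * v x c)"
proof -
  have d: "(\<lambda>y. C y $ m $ b) differentiable (at x)" "(\<lambda>y. pd m F y) differentiable (at x)"
    "(\<lambda>y. C y $ m $ b * pd m F y) differentiable (at x)"
    "(\<lambda>y. \<Sum>m\<in>UNIV. C y $ m $ b * pd m F y) differentiable (at x)" for m
    by (intro smooth_on_differentiable[OF _ x] smooth_intros open_U msmooth_on_nth[OF C_smooth] F_smooth)+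
  have "pd i (\<lambda>y. v y b) x = - 1/2 * (\<Sum>m\<in>UNIV. pd i (\<lambda>y. C y $ m $ b) x * pd m F x
      + C x $ m $ b * pd i (pd m F) x)"
    unfolding v_def pd_cmult[OF d(4)] pd_sum[OF d(3)] pd_mult[OF d(1,2)] ..
  also have "\<dots> = - 1/2 * ((\<Sum>m\<in>UNIV. \<Sum>c\<in>UNIV. C x $ m $ c * \<omega> i x $ c $ b * pd m F x)
      - (\<Sum>m\<in>UNIV. \<Sum>n\<in>UNIV. christoffel G x m i n * C x $ n $ b * pd m F x)
      + (\<Sum>m\<in>UNIV. C x $ m $ b * pd i (pd m F) x))"
    by (simp add: pd_C[OF x] sum.distrib sum_subtractf sum_distrib_right left_diff_distrib)
  also have "(\<Sum>m\<in>UNIV. \<Sum>n\<in>UNIV. christoffel G x m i n * C x $ n $ b * pd m F x)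
     = (\<Sum>n\<in>UNIV. \<Sum>m\<in>UNIV. christoffel G x m i n * C x $ n $ b * pd m F x)"
    by (rule sum.swap)
  also have "(\<Sum>m\<in>UNIV. \<Sum>c\<in>UNIV. C x $ m $ c * \<omega> i x $ c $ b * pd m F x)
     = (\<Sum>c\<in>UNIV. \<Sum>m\<in>UNIV. C x $ m $ c * - \<omega> i x $ b $ c * pd m F x)"
    by (subst sum.swap, subst \<omega>_skew_nth[OF x]) simp
  finally show ?thesis
    unfolding Tm_def hessian_def v_def
    by (simp add: sum_distrib_left sum_negf sum_subtractf right_diff_distrib algebra_simps)
qed

lemma ad_deriv_bm:
  assumes x: "x \<in> U"
  shows "ad_deriv \<omega> i (bm j) x $ a $ b =
    (\<Sum>m\<in>UNIV. H x $ a $ m * christoffel G x m i j) * v x b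
    - (\<Sum>m\<in>UNIV. H x $ b $ m * christoffel G x m i j) * v x a
    + H x $ a $ j * Tm i x b - H x $ b $ j * Tm i x a"
proof -
  have d: "(\<lambda>y. H y $ a $ j) differentiable (at x)" "(\<lambda>y. v y b) differentiable (at x)"
     "(\<lambda>y. H y $ a $ j * v y b) differentiable (at x)" for a b
    by (intro smooth_on_differentiable[OF _ x] smooth_intros open_U msmooth_on_nth[OF H_smooth] v_smooth)+
  have "mpd i (bm j) x $ a $ b = pd i (\<lambda>y. H y $ a $ j) x * v x b + H x $ a $ j * pd i (\<lambda>y. v y b) x
    - (pd i (\<lambda>y. H y $ b $ j) x * v x a + H x $ b $ j * pd i (\<lambda>y. v y a) x)"
    unfolding mpd_def bm_def vec_lambda_beta pd_diff[OF d(3,3)] pd_mult[OF d(1,2)] ..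
  moreover have "mcomm (\<omega> i x) (bm j x) $ a $ b =
      (\<Sum>c\<in>UNIV. \<omega> i x $ a $ c * H x $ c $ j) * v x b - H x $ b $ j * (\<Sum>c\<in>UNIV. \<omega> i x $ a $ c * v x c)
      + (H x $ a $ j * (\<Sum>c\<in>UNIV. \<omega> i x $ b $ c * v x c) - (\<Sum>c\<in>UNIV. \<omega> i x $ b $ c * H x $ c $ j) * v x a)"
  proof -
    have "mcomm (\<omega> i x) (bm j x) $ a $ b = (\<Sum>c\<in>UNIV. \<omega> i x $ a $ c * (H x $ c $ j * v x b - H x $ b $ j * v x c))
       + (\<Sum>c\<in>UNIV. (H x $ a $ j * v x c - H x $ c $ j * v x a) * \<omega> i x $ b $ c)"
      using \<omega>_skew_nth[OF x, of i _ b]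
      by (simp add: mcomm_def matrix_matrix_mult_def bm_def sum_negf)
    then show ?thesis
      by (simp add: sum_subtractf sum_distrib_left sum_distrib_right algebra_simps)
  qed
  ultimately show ?thesis
    unfolding ad_deriv_def by (simp add: pd_H[OF x] pd_v[OF x] algebra_simps)
qed

text \<open>Here the hypothesis trades the Hessian of F for the Ricci tensor.\<close>

lemma fr2_soliton:
  assumes x: "x \<in> U"
  shows "(\<Sum>i\<in>UNIV. Tm i x b * C x $ i $ a) = - 1/2 * L x * kd a b + 1/2 * ricci_tr (Rf x) a b + v x a * v x b"
proof -
  have Fa: "(\<Sum>i\<in>UNIV. pd i F x * C x $ i $ a) = - 2 * v x a" for a
    unfolding v_def by (simp add: mult.commute)
  have "fr2 (C x) (\<lambda>i j. ricci G x i j + hessian G F x i j + 1/2 * (pd i F x * pd j F x)) a b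
      = L x * kd a b"
    unfolding soliton[OF x] by (simp add: fr2_linear fr2_G[OF x])
  then have "ricci_tr (Rf x) a b + fr2 (C x) (hessian G F x) a b + 2 * v x a * v x b = L x * kd a b"
    unfolding fr2_linear fr2_prod Fa by (simp add: fr2_ricci[OF x])
  moreover have "(\<Sum>i\<in>UNIV. Tm i x b * C x $ i $ a) = - 1/2 * fr2 (C x) (hessian G F x) a b"
    unfolding Tm_def fr2_def by (simp add: sum_distrib_left sum_distrib_right mult_ac)
  ultimately show ?thesis by (simp add: field_simps)
qed

text \<open>The derivative of \<open>bm\<close> contributes \<open>Tm\<close> wedged with the
  coframe, and its square contributes terms in v. After \<open>fr2_soliton\<close> the products of
  components of v cancel, the Ricci terms reduce \<open>Rf\<close> to its Weyl part, and the
  multiples of the identity collect in \<open>\<rho>\<close>.\<close>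

lemma curv_\<omega>b:
  assumes x: "x \<in> U"
  shows "fr2 (C x) (\<lambda>i j. curv \<omega>b i j x $ a $ b) c d
    = weyl_part (Rf x) c d a b + \<rho> x * (kd c a * kd d b - kd c b * kd d a)"
proof -
  define h where "h a i = H x $ a $ i" for a i
  define u where "u i = (\<Sum>e\<in>UNIV. v x e * h e i)" for i
  define V where "V = (\<Sum>e\<in>UNIV. v x e * v x e)"
  have bb: "mcomm (bm i x) (bm j x) $ a $ b = h a i * (v x b * u j) + u i * (v x a * h b j) - V * (h a i * h b j)
      - (u i * (v x b * h a j)) - (h b i * (v x a * u j)) + V * (h b i * h a j)" for i j
  proof -
    have "mcomm (bm i x) (bm j x) $ a $ b =
       (\<Sum>e\<in>UNIV. (h a i * v x e - h e i * v x a) * (h e j * v x b - h b j * v x e)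
         - (h a j * v x e - h e j * v x a) * (h e i * v x b - h b i * v x e))"
      by (simp add: mcomm_def matrix_matrix_mult_def bm_def h_def sum_subtractf)
    also have "\<dots> = (\<Sum>e\<in>UNIV. h a i * v x b * (v x e * h e j) + v x a * h b j * (v x e * h e i) - h a i * h b j * (v x e * v x e)
      - h a j * v x b * (v x e * h e i) - v x a * h b i * (v x e * h e j) + h b i * h a j * (v x e * v x e))"
      by (rule sum.cong) (auto simp: algebra_simps)
    also have "\<dots> = h a i * v x b * u j + v x a * h b j * u i - h a i * h b j * V
      - h a j * v x b * u i - v x a * h b i * u j + h b i * h a j * V"
      unfolding sum.distrib sum_subtractf sum_distrib_left[symmetric] u_def V_def ..
    finally show ?thesis by (simp add: algebra_simps)
  qed
  have cv: "curv \<omega>b i j x $ a $ b = curv \<omega> i j x $ a $ b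
      + (Tm i x b * h a j - Tm i x a * h b j) - (h a i * Tm j x b - h b i * Tm j x a)
      + (h a i * (v x b * u j) + u i * (v x a * h b j) - V * (h a i * h b j)
      - (u i * (v x b * h a j)) - (h b i * (v x a * u j)) + V * (h b i * h a j))" for i j
    unfolding \<omega>b_def[abs_def]
    by (simp add: curv_add[OF open_U \<omega>_smooth bm_smooth x] ad_deriv_bm[OF x] bb
       christoffel_sym[OF x, of _ j i] h_def[symmetric] algebra_simps)
  have h: "(\<Sum>i\<in>UNIV. h a i * C x $ i $ b) = kd a b" for a b
    using HC_nth[OF x] by (simp add: h_def)
  have u: "(\<Sum>i\<in>UNIV. u i * C x $ i $ c) = v x c" for c
  proof -
    have "(\<Sum>i\<in>UNIV. u i * C x $ i $ c) = (\<Sum>e\<in>UNIV. v x e * (\<Sum>i\<in>UNIV. h e i * C x $ i $ c))"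
      unfolding u_def sum_distrib_left sum_distrib_right mult.assoc by (rule sum.swap)
    then show ?thesis by (simp add: h)
  qed
  have su: "(\<Sum>i\<in>UNIV. r * u i * C x $ i $ c) = r * v x c" "(\<Sum>i\<in>UNIV. r * h a i * C x $ i $ c) = r * kd a c" for r a c
    using u h by (simp_all add: sum_distrib_left[symmetric] mult.assoc)
  note t = fr2_soliton[OF x]
  have "fr2 (C x) (\<lambda>i j. curv \<omega>b i j x $ a $ b) c d = Rf x c d a b
      + ((- 1/2 * L x * kd c b + 1/2 * ricci_tr (Rf x) c b + v x c * v x b) * kd a d
        - (- 1/2 * L x * kd c a + 1/2 * ricci_tr (Rf x) c a + v x c * v x a) * kd b d)
      - (kd a c * (- 1/2 * L x * kd d b + 1/2 * ricci_tr (Rf x) d b + v x d * v x b)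
        - kd b c * (- 1/2 * L x * kd d a + 1/2 * ricci_tr (Rf x) d a + v x d * v x a))
      + (kd a c * (v x b * v x d) + v x c * (v x a * kd b d) - V * (kd a c * kd b d)
      - (v x c * (v x b * kd a d)) - (kd b c * (v x a * v x d)) + V * (kd b c * kd a d))"
    unfolding cv fr2_linear fr2_prod su t h u by (simp add: Rf_eq[OF x])
  also have "\<dots> = weyl_part (Rf x) c d a b + \<rho> x * (kd c a * kd d b - kd c b * kd d a)"
    unfolding weyl_part_def \<rho>_def V_def[symmetric] scalar_curv_eq[OF x]
    by (simp add: kd_sym[of c a] kd_sym[of d b] kd_sym[of c b] kd_sym[of d a] field_simps)
  finally show ?thesis .
qed

end

lemma sum_permute3:
  fixes f :: "'i::finite \<Rightarrow> 'i \<Rightarrow> 'i \<Rightarrow> real"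
  shows "(\<Sum>i\<in>UNIV. \<Sum>j\<in>UNIV. \<Sum>k\<in>UNIV. f i j k) = (\<Sum>j\<in>UNIV. \<Sum>k\<in>UNIV. \<Sum>i\<in>UNIV. f i j k)"
    "(\<Sum>i\<in>UNIV. \<Sum>j\<in>UNIV. \<Sum>k\<in>UNIV. f i j k) = (\<Sum>k\<in>UNIV. \<Sum>i\<in>UNIV. \<Sum>j\<in>UNIV. f i j k)"
  unfolding sum.cartesian_product UNIV_Times_UNIV
   apply (rule sum.reindex_bij_witness[of _ "\<lambda>(j,k,i). (i,j,k)" "\<lambda>(i,j,k). (j,k,i)"]; auto)
  apply (rule sum.reindex_bij_witness[of _ "\<lambda>(k,i,j). (i,j,k)" "\<lambda>(i,j,k). (k,i,j)"]; auto)
  done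

lemma sd_comp_sum: "sd_comp s (\<lambda>a b. \<Sum>i\<in>K. w i a b) = (\<lambda>\<gamma>. \<Sum>i\<in>K. sd_comp s (w i) \<gamma>)"
proof
  fix \<gamma>
  show "sd_comp s (\<lambda>a b. \<Sum>i\<in>K. w i a b) \<gamma> = (\<Sum>i\<in>K. sd_comp s (w i) \<gamma>)"
    by (induction K rule: infinite_finite_induct)
      (simp_all add: sd_comp_def distrib_left sum.distrib)
qed

lemma sd_comp_cmult: "sd_comp s (\<lambda>a b. r * w a b) = (\<lambda>\<gamma>. r * sd_comp s w \<gamma>)"
  by (simp add: fun_eq_iff sd_comp_def sum_distrib_left mult_ac)

lemma ad3_sum: "ad3 s (\<lambda>\<gamma>. \<Sum>i\<in>K. n i \<gamma>) \<alpha> \<beta> = (\<Sum>i\<in>K. ad3 s (n i) \<alpha> \<beta>)"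
  by (induction K rule: infinite_finite_induct) (simp_all add: ad3_def sum_3 algebra_simps)

lemma ad3_cmult: "ad3 s (\<lambda>\<gamma>. r * n \<gamma>) \<alpha> \<beta> = r * ad3 s n \<alpha> \<beta>"
  by (simp add: ad3_def sum_distrib_left mult_ac)

lemma sd_comp_kd: "sd_comp s (\<lambda>a b. kd c a * kd d b - kd c b * kd d a) \<alpha> = 2 * sd s \<alpha> c d"
proof -
  have "sd_comp s (\<lambda>a b. kd c a * kd d b - kd c b * kd d a) \<alpha> =
      (\<Sum>a\<in>UNIV. kd c a * (\<Sum>b\<in>UNIV. kd d b * sd s \<alpha> a b)) - (\<Sum>a\<in>UNIV. kd d a * (\<Sum>b\<in>UNIV. kd c b * sd s \<alpha> a b))"
    unfolding sd_comp_def by (simp only: right_diff_distrib sum_subtractf sum_distrib_left mult_ac)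
  then show ?thesis by (simp add: sd_skew[of s \<alpha> d c])
qed

context oframe_sign
begin

lemma w_skew: "w \<beta> x $ i $ j = - w \<beta> x $ j $ i"
  unfolding w_nth
  by (subst sum.swap, subst sd_skew) (simp add: sum_negf mult_ac)

lemma fr2_w:
  assumes x: "x \<in> U"
  shows "fr2 (C x) (\<lambda>i j. w \<beta> x $ i $ j) a b = sd s \<beta> a b"
proof -
  have t: "transpose (C x) ** transpose (H x) = mat 1"
    using HC[OF x] matrix_transpose_mul[of "H x" "C x"] by simp
  have "fr2 (C x) (\<lambda>i j. w \<beta> x $ i $ j) a b = (transpose (C x) ** transpose (H x) ** J \<beta> ** (H x ** C x)) $ a $ b"
    by (simp add: fr2_matrix vec_lambda_eta w_def matrix_mul_assoc)
  then show ?thesis by (simp add: t HC[OF x] J_nth)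
qed

lemma mpd_w_nth:
  assumes x: "x \<in> U"
  shows "pd i (\<lambda>y. w \<beta> y $ j $ k) x =
    (\<Sum>m\<in>UNIV. christoffel G x m i j * w \<beta> x $ m $ k) + (\<Sum>m\<in>UNIV. w \<beta> x $ j $ m * christoffel G x m i k)
    + (\<Sum>\<gamma>\<in>UNIV. \<Theta> i x $ \<gamma> $ \<beta> * w \<gamma> x $ j $ k)"
  using arg_cong[OF mpd_w[OF x, of i \<beta>], of "\<lambda>M. M $ j $ k"]
  by (simp add: mpd_def matrix_matrix_mult_def \<Gamma>_def transpose_def)

end

section \<open>The second Bianchi identity of the Einstein connection, projected to one half\<close>

context conf_einstein
begin

lemma \<omega>b_skew: "x \<in> U \<Longrightarrow> transpose (\<omega>b i x) = - \<omega>b i x"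
proof -
  assume x: "x \<in> U"
  have "\<omega>b i x $ b $ a = - \<omega>b i x $ a $ b" for a b
    using \<omega>_skew_nth[OF x, of i b a] by (simp add: \<omega>b_def bm_def)
  then show ?thesis unfolding vec_eq_iff transpose_def vec_lambda_beta vector_uminus_component by blast
qed

lemma curv_\<omega>b_sd:
  assumes x: "x \<in> U"
  shows "sd_comp s (\<lambda>a b. curv \<omega>b j k x $ a $ b) \<alpha>
    = 2 * (\<Sum>\<beta>\<in>UNIV. (A x $ \<alpha> $ \<beta> + \<rho> x * kd \<alpha> \<beta>) * w \<beta> x $ j $ k)"
proof -
  let ?h = "\<lambda>c d. H x $ c $ j * H x $ d $ k"
  have "curv \<omega>b j k x $ a $ b = (\<Sum>c\<in>UNIV. \<Sum>d\<in>UNIV.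
      ?h c d * (weyl_part (Rf x) c d a b + \<rho> x * (kd c a * kd d b - kd c b * kd d a)))" for a b
    using fr2_inverse[OF x, of "\<lambda>i j. curv \<omega>b i j x $ a $ b" j k]
    by (simp add: curv_\<omega>b[OF x] mult.commute)
  then have "(\<lambda>a b. curv \<omega>b j k x $ a $ b) = (\<lambda>a b. \<Sum>c\<in>UNIV. \<Sum>d\<in>UNIV.
      ?h c d * (weyl_part (Rf x) c d a b + \<rho> x * (kd c a * kd d b - kd c b * kd d a)))"
    by (simp only:)
  then have "sd_comp s (\<lambda>a b. curv \<omega>b j k x $ a $ b) \<alpha> = sd_comp s (\<lambda>a b. \<Sum>c\<in>UNIV. \<Sum>d\<in>UNIV.
      ?h c d * (weyl_part (Rf x) c d a b + \<rho> x * (kd c a * kd d b - kd c b * kd d a))) \<alpha>"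
    by (simp only:)
  also have "\<dots> = (\<Sum>c\<in>UNIV. \<Sum>d\<in>UNIV.
      ?h c d * (2 * (\<Sum>\<beta>\<in>UNIV. A x $ \<alpha> $ \<beta> * sd s \<beta> c d) + \<rho> x * (2 * sd s \<alpha> c d)))"
    unfolding sd_comp_sum unfolding sd_comp_cmult unfolding sd_comp_add sd_comp_cmult sd_comp_kd
    unfolding weyl_sd_comp[OF x] ..
  also have "\<dots> = (\<Sum>c\<in>UNIV. \<Sum>d\<in>UNIV. \<Sum>\<beta>\<in>UNIV.
      2 * (A x $ \<alpha> $ \<beta> + \<rho> x * kd \<alpha> \<beta>) * (sd s \<beta> c d * ?h c d))"
  proof (intro sum.cong refl)
    fix c d
    have "(\<Sum>\<beta>\<in>UNIV. 2 * (A x $ \<alpha> $ \<beta> + \<rho> x * kd \<alpha> \<beta>) * (sd s \<beta> c d * ?h c d))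
      = (\<Sum>\<beta>\<in>UNIV. 2 * ?h c d * (A x $ \<alpha> $ \<beta> * sd s \<beta> c d)) + (\<Sum>\<beta>\<in>UNIV. kd \<alpha> \<beta> * (2 * \<rho> x * sd s \<beta> c d * ?h c d))"
      unfolding sum.distrib[symmetric] by (intro sum.cong refl) (simp add: algebra_simps)
    then show "?h c d * (2 * (\<Sum>\<beta>\<in>UNIV. A x $ \<alpha> $ \<beta> * sd s \<beta> c d) + \<rho> x * (2 * sd s \<alpha> c d))
      = (\<Sum>\<beta>\<in>UNIV. 2 * (A x $ \<alpha> $ \<beta> + \<rho> x * kd \<alpha> \<beta>) * (sd s \<beta> c d * ?h c d))"
      unfolding sum_distrib_left[symmetric] kd_sum by (simp add: algebra_simps)
  qed
  also have "\<dots> = (\<Sum>\<beta>\<in>UNIV. \<Sum>c\<in>UNIV. \<Sum>d\<in>UNIV.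
      2 * (A x $ \<alpha> $ \<beta> + \<rho> x * kd \<alpha> \<beta>) * (sd s \<beta> c d * ?h c d))"
    by (subst sum.swap[of _ UNIV "UNIV :: 3 set"], rule sum.cong[OF refl], subst sum.swap[of _ UNIV "UNIV :: 3 set"]) simp
  finally show ?thesis by (simp only: w_nth sum_distrib_left mult.assoc)
qed

text \<open>Half the coefficient of \<open>w \<beta>\<close> in the derivative, along the i-th
  coordinate, of the projected curvature \<open>curv_\<omega>b_sd\<close>. The last sum is the
  action of the conformal change of connection.\<close>

definition bianchi_coeff :: "3 \<Rightarrow> real^4 \<Rightarrow> 4 \<Rightarrow> 3 \<Rightarrow> real" where
  "bianchi_coeff \<alpha> x i \<beta> = ad_deriv \<Theta> i A x $ \<alpha> $ \<beta> + pd i \<rho> x * kd \<alpha> \<beta>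
     + (\<Sum>\<gamma>\<in>UNIV. ad3 s (sd_comp s (\<lambda>a b. bm i x $ a $ b)) \<alpha> \<gamma> * (A x $ \<gamma> $ \<beta> + \<rho> x * kd \<gamma> \<beta>))"

text \<open>\<open>\<Theta>\<close> arises twice, from differentiating the forms w and from the
  bracket with the connection; together the two contributions make the covariant derivative of A.
  The Christoffel terms are kept apart because they disappear only in the cyclic sum.\<close>

lemma bianchi_term:
  assumes x: "x \<in> U"
  shows "sd_comp s (\<lambda>a b. ad_deriv \<omega>b i (curv \<omega>b j k) x $ a $ b) \<alpha>
    = 2 * (\<Sum>\<beta>\<in>UNIV. bianchi_coeff \<alpha> x i \<beta> * w \<beta> x $ j $ k)
    + 2 * (\<Sum>\<beta>\<in>UNIV. (A x $ \<alpha> $ \<beta> + \<rho> x * kd \<alpha> \<beta>) *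
        ((\<Sum>m\<in>UNIV. christoffel G x m i j * w \<beta> x $ m $ k) + (\<Sum>m\<in>UNIV. w \<beta> x $ j $ m * christoffel G x m i k)))"
proof -
  define g where "g \<beta> = (\<Sum>m\<in>UNIV. christoffel G x m i j * w \<beta> x $ m $ k) + (\<Sum>m\<in>UNIV. w \<beta> x $ j $ m * christoffel G x m i k)" for \<beta>
  define M where "M \<alpha> \<beta> = A x $ \<alpha> $ \<beta> + \<rho> x * kd \<alpha> \<beta>" for \<alpha> \<beta>
  define a where "a \<alpha> \<beta> = ad3 s (sd_comp s (\<lambda>a b. bm i x $ a $ b)) \<alpha> \<beta>" for \<alpha> \<beta>
  define W where "W \<beta> = w \<beta> x $ j $ k" for \<beta>
  have "sd_comp s (\<lambda>a b. mpd i (curv \<omega>b j k) x $ a $ b) \<alpha>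
      = pd i (\<lambda>y. sd_comp s (\<lambda>a b. curv \<omega>b j k y $ a $ b) \<alpha>) x"
    by (rule pd_sd_comp[OF x, symmetric]) (intro msmooth_intros open_U \<omega>b_smooth)
  also have "\<dots> = pd i (\<lambda>y. 2 * (\<Sum>\<beta>\<in>UNIV. (A y $ \<alpha> $ \<beta> + \<rho> y * kd \<alpha> \<beta>) * w \<beta> y $ j $ k)) x"
    by (rule pd_cong_open[OF open_U x curv_\<omega>b_sd])
  also have "\<dots> = 2 * (\<Sum>\<beta>\<in>UNIV. (mpd i A x $ \<alpha> $ \<beta> + pd i \<rho> x * kd \<alpha> \<beta>) * W \<beta>
      + M \<alpha> \<beta> * (g \<beta> + (\<Sum>\<gamma>\<in>UNIV. \<Theta> i x $ \<gamma> $ \<beta> * W \<gamma>)))"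
  proof -
    have d: "(\<lambda>y. A y $ \<alpha> $ \<beta>) differentiable (at x)" "\<rho> differentiable (at x)" "(\<lambda>y. kd \<alpha> \<beta>) differentiable (at x)"
      "(\<lambda>y. \<rho> y * kd \<alpha> \<beta>) differentiable (at x)"
      "(\<lambda>y. A y $ \<alpha> $ \<beta> + \<rho> y * kd \<alpha> \<beta>) differentiable (at x)" "(\<lambda>y. w \<beta> y $ j $ k) differentiable (at x)"
      "(\<lambda>y. (A y $ \<alpha> $ \<beta> + \<rho> y * kd \<alpha> \<beta>) * w \<beta> y $ j $ k) differentiable (at x)"
      "(\<lambda>y. \<Sum>\<beta>\<in>UNIV. (A y $ \<alpha> $ \<beta> + \<rho> y * kd \<alpha> \<beta>) * w \<beta> y $ j $ k) differentiable (at x)" for \<beta>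
      by (intro smooth_on_differentiable[OF _ x] smooth_intros open_U msmooth_on_nth[OF A_smooth]
          msmooth_on_nth[OF w_smooth] \<rho>_smooth[unfolded eta_contract_eq] \<rho>_smooth)+
    have "mpd i A x $ \<alpha> $ \<beta> = pd i (\<lambda>y. A y $ \<alpha> $ \<beta>) x" for \<beta> by (simp add: mpd_def)
    then show ?thesis
      unfolding pd_cmult[OF d(8)] pd_sum[OF d(7)] pd_mult[OF d(5,6)] pd_add[OF d(1,4)] pd_mult[OF d(2,3)]
        mpd_w_nth[OF x] W_def M_def g_def by simp
  qed
  finally have 1: "sd_comp s (\<lambda>a b. mpd i (curv \<omega>b j k) x $ a $ b) \<alpha> = \<dots>" .
  have sk: "\<omega>b i x $ a $ b = - \<omega>b i x $ b $ a" for a b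
    using arg_cong[OF \<omega>b_skew[OF x, of i], of "\<lambda>M. M $ b $ a"] by (simp add: transpose_def)
  have "sd_comp s (\<lambda>a b. mcomm (\<omega>b i x) (curv \<omega>b j k x) $ a $ b) \<alpha>
      = (\<Sum>\<beta>\<in>UNIV. ad3 s (sd_comp s (\<lambda>a b. \<omega>b i x $ a $ b)) \<alpha> \<beta> * sd_comp s (\<lambda>a b. curv \<omega>b j k x $ a $ b) \<beta>)"
    using sd_comp_commutator[where w = "\<lambda>a b. \<omega>b i x $ a $ b" and u = "\<lambda>a b. curv \<omega>b j k x $ a $ b" and \<alpha> = \<alpha>,
        OF sign sk curv_skew[OF x \<omega>b_skew \<omega>b_smooth]]
    by (simp add: mcomm_def matrix_matrix_mult_def sum_subtractf)
  also have "\<dots> = (\<Sum>\<beta>\<in>UNIV. (\<Theta> i x $ \<alpha> $ \<beta> + a \<alpha> \<beta>) * (2 * (\<Sum>\<gamma>\<in>UNIV. M \<beta> \<gamma> * W \<gamma>)))"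
    unfolding curv_\<omega>b_sd[OF x] M_def W_def \<omega>b_def a_def \<Theta>_def
    by (simp add: sd_comp_add ad3_add)
  finally have 2: "sd_comp s (\<lambda>a b. mcomm (\<omega>b i x) (curv \<omega>b j k x) $ a $ b) \<alpha> = \<dots>" .
  have z: "\<Theta> i x $ 1 $ 1 = 0" "\<Theta> i x $ 2 $ 2 = 0" "\<Theta> i x $ 3 $ 3 = 0" "\<Theta> i x $ 2 $ 1 = - \<Theta> i x $ 1 $ 2"
    "\<Theta> i x $ 3 $ 1 = - \<Theta> i x $ 1 $ 3" "\<Theta> i x $ 3 $ 2 = - \<Theta> i x $ 2 $ 3"
    using \<Theta>_skew[of i x 1 1] \<Theta>_skew[of i x 2 2] \<Theta>_skew[of i x 3 3]
      \<Theta>_skew[of i x 2 1] \<Theta>_skew[of i x 3 1] \<Theta>_skew[of i x 3 2] by auto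
  have "\<forall>\<alpha>. 2 * (\<Sum>\<beta>\<in>UNIV. (mpd i A x $ \<alpha> $ \<beta> + pd i \<rho> x * kd \<alpha> \<beta>) * W \<beta>
      + M \<alpha> \<beta> * (g \<beta> + (\<Sum>\<gamma>\<in>UNIV. \<Theta> i x $ \<gamma> $ \<beta> * W \<gamma>)))
     + (\<Sum>\<beta>\<in>UNIV. (\<Theta> i x $ \<alpha> $ \<beta> + a \<alpha> \<beta>) * (2 * (\<Sum>\<gamma>\<in>UNIV. M \<beta> \<gamma> * W \<gamma>)))
     = 2 * (\<Sum>\<beta>\<in>UNIV. bianchi_coeff \<alpha> x i \<beta> * W \<beta>) + 2 * (\<Sum>\<beta>\<in>UNIV. M \<alpha> \<beta> * g \<beta>)"
    unfolding bianchi_coeff_def ad_deriv_def a_def[symmetric]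
    unfolding forall_3 sum_3 M_def
    by (simp add: kd_def z mcomm_def matrix_matrix_mult_def sum_3 algebra_simps)
  then show ?thesis
    using 1 2 unfolding ad_deriv_def g_def M_def W_def by (simp add: sd_comp_add)
qed

lemma bianchi_coord:
  assumes x: "x \<in> U"
  shows "(\<Sum>\<beta>\<in>UNIV. bianchi_coeff \<alpha> x i \<beta> * w \<beta> x $ j $ k + bianchi_coeff \<alpha> x j \<beta> * w \<beta> x $ k $ i
    + bianchi_coeff \<alpha> x k \<beta> * w \<beta> x $ i $ j) = 0"
proof -
  let ?K = "\<lambda>i j k \<beta>. (\<Sum>m\<in>UNIV. christoffel G x m i j * w \<beta> x $ m $ k) + (\<Sum>m\<in>UNIV. w \<beta> x $ j $ m * christoffel G x m i k)"
  \<comment> \<open>Absence of torsion: the Christoffel symbols are symmetric in the lower indices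
    while w is skew.\<close>
  have K: "?K i j k \<beta> + ?K j k i \<beta> + ?K k i j \<beta> = 0" for \<beta>
    by (simp add: christoffel_sym[OF x, of _ j i] christoffel_sym[OF x, of _ k i] christoffel_sym[OF x, of _ k j]
        w_skew[of \<beta> x i] w_skew[of \<beta> x j] w_skew[of \<beta> x k] sum_negf mult.commute)
  let ?M = "\<lambda>\<beta>. A x $ \<alpha> $ \<beta> + \<rho> x * kd \<alpha> \<beta>"
  have K2: "(\<Sum>\<beta>\<in>UNIV. ?M \<beta> * ?K i j k \<beta>) + (\<Sum>\<beta>\<in>UNIV. ?M \<beta> * ?K j k i \<beta>) + (\<Sum>\<beta>\<in>UNIV. ?M \<beta> * ?K k i j \<beta>) = 0"
  proof -
    have "(\<Sum>\<beta>\<in>UNIV. ?M \<beta> * ?K i j k \<beta>) + (\<Sum>\<beta>\<in>UNIV. ?M \<beta> * ?K j k i \<beta>) + (\<Sum>\<beta>\<in>UNIV. ?M \<beta> * ?K k i j \<beta>)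
      = (\<Sum>\<beta>\<in>UNIV. ?M \<beta> * (?K i j k \<beta> + ?K j k i \<beta> + ?K k i j \<beta>))"
      by (simp only: distrib_left sum.distrib)
    then show ?thesis by (simp only: K) simp
  qed
  have "sd_comp s (\<lambda>a b. ad_deriv \<omega>b i (curv \<omega>b j k) x $ a $ b) \<alpha>
     + sd_comp s (\<lambda>a b. ad_deriv \<omega>b j (curv \<omega>b k i) x $ a $ b) \<alpha>
     + sd_comp s (\<lambda>a b. ad_deriv \<omega>b k (curv \<omega>b i j) x $ a $ b) \<alpha> = sd_comp s (\<lambda>a b. 0) \<alpha>"
    using arg_cong[OF second_bianchi[where w = \<omega>b and i = i and j = j and k = k, OF open_U \<omega>b_smooth x], of "\<lambda>M. sd_comp s (\<lambda>a b. M $ a $ b) \<alpha>"]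
    by (simp add: sd_comp_add)
  then show ?thesis
    using K2 unfolding bianchi_term[OF x] by (simp add: sum.distrib sd_comp_def)
qed

lemma bianchi_frame:
  assumes x: "x \<in> U"
  shows "sd_wedge s (\<lambda>c \<beta>. \<Sum>i\<in>UNIV. bianchi_coeff \<alpha> x i \<beta> * C x $ i $ c) c d e = 0"
proof -
  let ?Z = "bianchi_coeff \<alpha> x" and ?W = "\<lambda>\<beta> j k. w \<beta> x $ j $ k"
  let ?C = "\<lambda>i j k. C x $ i $ c * C x $ j $ d * C x $ k $ e"
  have p: "(\<Sum>i\<in>UNIV. z i * p i) * (\<Sum>j\<in>UNIV. \<Sum>k\<in>UNIV. W j k * q j * r k)
     = (\<Sum>i\<in>UNIV. \<Sum>j\<in>UNIV. \<Sum>k\<in>UNIV. z i * W j k * (p i * q j * r k))" for z p q r :: "4 \<Rightarrow> real" and W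
    unfolding sum_distrib_right by (simp only: sum_distrib_left mult_ac)
  have 1: "(\<Sum>i\<in>UNIV. ?Z i \<beta> * C x $ i $ c) * sd s \<beta> d e = (\<Sum>i\<in>UNIV. \<Sum>j\<in>UNIV. \<Sum>k\<in>UNIV. ?Z i \<beta> * ?W \<beta> j k * ?C i j k)" for \<beta>
    unfolding fr2_w[OF x, symmetric] fr2_def p ..
  have 2: "(\<Sum>i\<in>UNIV. ?Z i \<beta> * C x $ i $ d) * sd s \<beta> e c = (\<Sum>i\<in>UNIV. \<Sum>j\<in>UNIV. \<Sum>k\<in>UNIV. ?Z j \<beta> * ?W \<beta> k i * ?C i j k)" for \<beta>
    unfolding fr2_w[OF x, symmetric] fr2_def p by (subst sum_permute3(2)) (simp add: mult_ac)
  have 3: "(\<Sum>i\<in>UNIV. ?Z i \<beta> * C x $ i $ e) * sd s \<beta> c d = (\<Sum>i\<in>UNIV. \<Sum>j\<in>UNIV. \<Sum>k\<in>UNIV. ?Z k \<beta> * ?W \<beta> i j * ?C i j k)" for \<beta>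
    unfolding fr2_w[OF x, symmetric] fr2_def p by (subst sum_permute3(1)) (simp add: mult_ac)
  have "sd_wedge s (\<lambda>c \<beta>. \<Sum>i\<in>UNIV. ?Z i \<beta> * C x $ i $ c) c d e
    = (\<Sum>\<beta>\<in>UNIV. \<Sum>i\<in>UNIV. \<Sum>j\<in>UNIV. \<Sum>k\<in>UNIV. (?Z i \<beta> * ?W \<beta> j k + ?Z j \<beta> * ?W \<beta> k i + ?Z k \<beta> * ?W \<beta> i j) * ?C i j k)"
    unfolding sd_wedge_def 1 2 3 by (simp add: sum.distrib distrib_right)
  also have "\<dots> = (\<Sum>i\<in>UNIV. \<Sum>j\<in>UNIV. \<Sum>k\<in>UNIV. \<Sum>\<beta>\<in>UNIV. (?Z i \<beta> * ?W \<beta> j k + ?Z j \<beta> * ?W \<beta> k i + ?Z k \<beta> * ?W \<beta> i j) * ?C i j k)"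
    by (subst sum.swap, rule sum.cong[OF refl], subst sum.swap, rule sum.cong[OF refl], subst sum.swap) simp
  also have "\<dots> = 0"
    unfolding sum_distrib_right[symmetric] bianchi_coord[OF x] by simp
  finally show ?thesis .
qed

lemma A_deriv_sym:
  assumes x: "x \<in> U"
  shows "ad_deriv \<Theta> i A x $ \<alpha> $ \<beta> = ad_deriv \<Theta> i A x $ \<beta> $ \<alpha>"
proof -
  have "mpd i A x $ \<alpha> $ \<beta> = mpd i A x $ \<beta> $ \<alpha>"
    unfolding mpd_def vec_lambda_beta by (rule pd_cong_open[OF open_U x A_sym])
  moreover have "(\<Theta> i x ** A x) $ \<alpha> $ \<beta> = - (A x ** \<Theta> i x) $ \<beta> $ \<alpha>" for \<alpha> \<beta>
    unfolding matrix_matrix_mult_def vec_lambda_beta sum_negf[symmetric]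
    by (intro sum.cong refl) (metis A_sym[OF x] \<Theta>_skew mult.commute mult_minus_right)
  ultimately show ?thesis
    by (simp add: ad_deriv_def mcomm_def)
qed

lemma A_deriv_trace:
  assumes x: "x \<in> U"
  shows "(\<Sum>\<alpha>\<in>UNIV. ad_deriv \<Theta> i A x $ \<alpha> $ \<alpha>) = 0"
proof -
  have "(\<Sum>\<alpha>\<in>UNIV. mpd i A x $ \<alpha> $ \<alpha>) = pd i (\<lambda>y. \<Sum>\<alpha>\<in>UNIV. A y $ \<alpha> $ \<alpha>) x"
    using msmooth_on_differentiable[OF A_smooth x] by (simp add: mpd_def pd_sum)
  also have "\<dots> = pd i (\<lambda>y. 0) x" by (rule pd_cong_open[OF open_U x A_trace])
  finally show ?thesis
    by (simp add: ad_deriv_def mcomm_def matrix_matrix_mult_def sum_3 algebra_simps)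
qed

definition Xf :: "real^4 \<Rightarrow> 4 \<Rightarrow> 3 \<Rightarrow> 3 \<Rightarrow> real" where
  "Xf x b \<alpha> \<beta> = (\<Sum>i\<in>UNIV. ad_deriv \<Theta> i A x $ \<alpha> $ \<beta> * C x $ i $ b) + v x b * A x $ \<alpha> $ \<beta>"

lemma divergence_free:
  assumes x: "x \<in> U"
  shows "sd_apply s (\<lambda>b \<beta>. Xf x b \<alpha> \<beta>) a = 0"
  unfolding Xf_def
proof (rule divergence_equation[where A = "\<lambda>\<alpha> \<beta>. A x $ \<alpha> $ \<beta>" and v = "v x"
      and P = "\<lambda>b \<alpha> \<beta>. \<Sum>i\<in>UNIV. ad_deriv \<Theta> i A x $ \<alpha> $ \<beta> * C x $ i $ b" and r = "\<lambda>c. \<Sum>i\<in>UNIV. pd i \<rho> x * C x $ i $ c" and \<rho> = "\<rho> x",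
      OF sign A_sym[OF x] A_trace[OF x]])
  show "(\<Sum>i\<in>UNIV. ad_deriv \<Theta> i A x $ \<alpha> $ \<beta> * C x $ i $ c) = (\<Sum>i\<in>UNIV. ad_deriv \<Theta> i A x $ \<beta> $ \<alpha> * C x $ i $ c)" for c \<alpha> \<beta>
    by (simp add: A_deriv_sym[OF x, of _ \<alpha>])
  show "(\<Sum>\<alpha>\<in>UNIV. \<Sum>i\<in>UNIV. ad_deriv \<Theta> i A x $ \<alpha> $ \<alpha> * C x $ i $ c) = 0" for c
    by (subst sum.swap) (simp add: sum_distrib_right[symmetric] A_deriv_trace[OF x])
  fix \<alpha> c d e
  \<comment> \<open>The matrix \<open>bm\<close> evaluated on the frame vector c is the conformal
    change of the pointwise lemma.\<close>
  have b: "conf_skew (v x) c = (\<lambda>a b. \<Sum>i\<in>UNIV. C x $ i $ c * bm i x $ a $ b)" for c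
  proof (intro ext)
    fix a b
    have "(\<Sum>i\<in>UNIV. C x $ i $ c * bm i x $ a $ b) =
       (\<Sum>i\<in>UNIV. H x $ a $ i * C x $ i $ c) * v x b - (\<Sum>i\<in>UNIV. H x $ b $ i * C x $ i $ c) * v x a"
      by (simp add: bm_def sum_distrib_left sum_distrib_right sum_subtractf algebra_simps)
    then show "conf_skew (v x) c a b = (\<Sum>i\<in>UNIV. C x $ i $ c * bm i x $ a $ b)"
      by (simp add: HC_nth[OF x] conf_skew_def kd_sym)
  qed
  have "(\<Sum>i\<in>UNIV. ad_deriv \<Theta> i A x $ \<alpha> $ \<beta> * C x $ i $ c) + (\<Sum>i\<in>UNIV. pd i \<rho> x * C x $ i $ c) * kd \<alpha> \<beta>
     + (\<Sum>\<gamma>\<in>UNIV. ad3 s (sd_comp s (conf_skew (v x) c)) \<alpha> \<gamma> * (A x $ \<gamma> $ \<beta> + \<rho> x * kd \<gamma> \<beta>))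
     = (\<Sum>i\<in>UNIV. bianchi_coeff \<alpha> x i \<beta> * C x $ i $ c)" for c \<beta>
  proof -
    have "(\<Sum>\<gamma>\<in>UNIV. ad3 s (sd_comp s (conf_skew (v x) c)) \<alpha> \<gamma> * (A x $ \<gamma> $ \<beta> + \<rho> x * kd \<gamma> \<beta>))
      = (\<Sum>\<gamma>\<in>UNIV. \<Sum>i\<in>UNIV. ad3 s (sd_comp s (\<lambda>a b. bm i x $ a $ b)) \<alpha> \<gamma> * (A x $ \<gamma> $ \<beta> + \<rho> x * kd \<gamma> \<beta>) * C x $ i $ c)"
      unfolding b sd_comp_sum ad3_sum sd_comp_cmult ad3_cmult sum_distrib_right by (simp only: mult_ac)
    also have "\<dots> = (\<Sum>i\<in>UNIV. \<Sum>\<gamma>\<in>UNIV. ad3 s (sd_comp s (\<lambda>a b. bm i x $ a $ b)) \<alpha> \<gamma> * (A x $ \<gamma> $ \<beta> + \<rho> x * kd \<gamma> \<beta>) * C x $ i $ c)"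
      by (rule sum.swap)
    finally have "(\<Sum>\<gamma>\<in>UNIV. ad3 s (sd_comp s (conf_skew (v x) c)) \<alpha> \<gamma> * (A x $ \<gamma> $ \<beta> + \<rho> x * kd \<gamma> \<beta>)) = \<dots>" .
    moreover have "(\<Sum>i\<in>UNIV. pd i \<rho> x * C x $ i $ c) * kd \<alpha> \<beta> = (\<Sum>i\<in>UNIV. pd i \<rho> x * kd \<alpha> \<beta> * C x $ i $ c)"
      unfolding sum_distrib_right by (simp only: mult_ac)
    ultimately show ?thesis
      by (simp only: bianchi_coeff_def distrib_right[of _ _ "C x $ _ $ _"] sum.distrib sum_distrib_right)
  qed
  then show "sd_wedge s (\<lambda>c \<beta>. (\<Sum>i\<in>UNIV. ad_deriv \<Theta> i A x $ \<alpha> $ \<beta> * C x $ i $ c)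
     + (\<Sum>i\<in>UNIV. pd i \<rho> x * C x $ i $ c) * kd \<alpha> \<beta>
     + (\<Sum>\<gamma>\<in>UNIV. ad3 s (sd_comp s (conf_skew (v x) c)) \<alpha> \<gamma> * (A x $ \<gamma> $ \<beta> + \<rho> x * kd \<gamma> \<beta>))) c d e = 0"
    using bianchi_frame[OF x, of \<alpha> c d e] by simp
qed

end

section \<open>Inner product of 3 by 3 matrices and derivatives compatible with it\<close>

definition mdot :: "real^3^3 \<Rightarrow> real^3^3 \<Rightarrow> real" where
  "mdot M N = (\<Sum>\<alpha>\<in>UNIV. \<Sum>\<beta>\<in>UNIV. M $ \<alpha> $ \<beta> * N $ \<alpha> $ \<beta>)"

lemma mdot_linear:
  "mdot M (N + N') = mdot M N + mdot M N'" "mdot M (N - N') = mdot M N - mdot M N'"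
  "mdot M (r *\<^sub>R N) = r * mdot M N" "mdot M N = mdot N M"
  "mdot M (sum K I) = (\<Sum>i\<in>I. mdot M (K i))"
proof -
  show "mdot M N = mdot N M" by (simp add: mdot_def mult.commute)
  show add: "mdot M (N + N') = mdot M N + mdot M N'" for N N'
    by (simp add: mdot_def distrib_left sum.distrib)
  show "mdot M (N - N') = mdot M N - mdot M N'" "mdot M (r *\<^sub>R N) = r * mdot M N"
    by (simp_all add: mdot_def right_diff_distrib sum_subtractf sum_distrib_left mult_ac)
  show "mdot M (sum K I) = (\<Sum>i\<in>I. mdot M (K i))"
    by (induction I rule: infinite_finite_induct) (simp_all add: add, simp_all add: mdot_def)
qed

lemma mdot_linear_left:
  "mdot (sum K I) N = (\<Sum>i\<in>I. mdot (K i) N)" "mdot (r *\<^sub>R M) N = r * mdot M N"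
  using mdot_linear(3)[of N r M] mdot_linear(5)[of N K I] by (simp_all only: mdot_linear(4)[of N])

text \<open>The bracket with a skew matrix is skew for \<open>mdot\<close>, so the ordinary
  derivative of an inner product can be computed with covariant ones.\<close>

lemma pd_mdot:
  assumes S: "open S" "x \<in> S" and M: "msmooth_on M S" "msmooth_on N S"
    and w: "\<And>\<alpha> \<beta>. w i x $ \<alpha> $ \<beta> = - w i x $ \<beta> $ \<alpha>"
  shows "pd i (\<lambda>y. mdot (M y) (N y)) x = mdot (ad_deriv w i M x) (N x) + mdot (M x) (ad_deriv w i N x)"
proof -
  have "pd i (\<lambda>y. mdot (M y) (N y)) x = mdot (mpd i M x) (N x) + mdot (M x) (mpd i N x)"
    using msmooth_on_differentiable[OF M(1) S(2)] msmooth_on_differentiable[OF M(2) S(2)]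
    unfolding mdot_def mpd_def
    by (simp add: pd_sum pd_mult differentiable_sum differentiable_mult sum.distrib)
  moreover have "mdot (mcomm (w i x) (M x)) (N x) + mdot (M x) (mcomm (w i x) (N x)) = 0"
    using w[of 1 1] w[of 2 2] w[of 3 3] w[of 2 1] w[of 3 1] w[of 3 2]
    by (simp add: mdot_def mcomm_def matrix_matrix_mult_def sum_3 algebra_simps)
  ultimately show ?thesis
    by (simp add: ad_deriv_def mdot_linear mdot_linear(4)[of _ "N x"])
qed

lemma ad_deriv_add_scaleR:
  assumes "x \<in> S" "msmooth_on P S" "msmooth_on M S" "smooth_on f S"
  shows "ad_deriv w i (\<lambda>y. P y + f y *\<^sub>R M y) x = ad_deriv w i P x + pd i f x *\<^sub>R M x + f x *\<^sub>R ad_deriv w i M x"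
proof -
  have "mpd i (\<lambda>y. P y + f y *\<^sub>R M y) x = mpd i P x + (pd i f x *\<^sub>R M x + f x *\<^sub>R mpd i M x)"
    using msmooth_on_differentiable[OF assms(2,1)] msmooth_on_differentiable[OF assms(3,1)]
      smooth_on_differentiable[OF assms(4,1)]
    by (simp add: mpd_def vec_eq_iff pd_add pd_mult differentiable_mult)
  moreover have "mcomm (w i x) (P x + f x *\<^sub>R M x) = mcomm (w i x) (P x) + f x *\<^sub>R mcomm (w i x) (M x)"
    by (simp add: mcomm_simps) (simp add: mcomm_def matrix_scaleR scaleR_diff_right)
  ultimately show ?thesis
    unfolding ad_deriv_def by (simp add: algebra_simps)
qed

text \<open>The contraction \<^const>\<open>sd_apply\<close> commutes with infinitesimal rotations of the frame.\<close>

lemma sd_apply_rotate: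
  assumes s: "s * s = 1" and w: "\<And>a b. w a b = - w b a"
  shows "sd_apply s (\<lambda>b \<beta>. - (\<Sum>e\<in>UNIV. w e b * Z e \<beta>) - (\<Sum>\<gamma>\<in>UNIV. Z b \<gamma> * ad3 s (sd_comp s w) \<gamma> \<beta>)) a
    = (\<Sum>c\<in>UNIV. w a c * sd_apply s Z c)"
proof -
  have r: "w 2 1 = - w 1 2" "w 3 1 = - w 1 3" "w 4 1 = - w 1 4"
      "w 3 2 = - w 2 3" "w 4 2 = - w 2 4" "w 4 3 = - w 3 4"
    by (rule w)+
  have s2: "s * (s * x) = x" for x using s by (simp add: mult.assoc[symmetric])
  have "\<forall>a. sd_apply s (\<lambda>b \<beta>. - (\<Sum>e\<in>UNIV. w e b * Z e \<beta>) - (\<Sum>\<gamma>\<in>UNIV. Z b \<gamma> * ad3 s (sd_comp s w) \<gamma> \<beta>)) a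
    = (\<Sum>c\<in>UNIV. w a c * sd_apply s Z c)"
    unfolding forall_4 sd_apply_def sum_3 sum_4 ad3_sd_comp_table[OF s w] sd_table skew_diag[of w, OF w]
    unfolding r by (simp add: s2 algebra_simps)
  then show ?thesis by blast
qed

lemma sd_apply_linear:
  "sd_apply s (\<lambda>b \<beta>. Y b \<beta> + Z b \<beta>) a = sd_apply s Y a + sd_apply s Z a"
  "sd_apply s (\<lambda>b \<beta>. r * Z b \<beta>) a = r * sd_apply s Z a"
  "sd_apply s (\<lambda>b \<beta>. \<Sum>i\<in>I. K i b \<beta>) a = (\<Sum>i\<in>I. sd_apply s (K i) a)"
proof -
  show add: "sd_apply s (\<lambda>b \<beta>. Y b \<beta> + Z b \<beta>) a = sd_apply s Y a + sd_apply s Z a" for Y Z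
    by (simp add: sd_apply_def distrib_left sum.distrib)
  show "sd_apply s (\<lambda>b \<beta>. r * Z b \<beta>) a = r * sd_apply s Z a"
    by (simp add: sd_apply_def sum_distrib_left mult_ac)
  show "sd_apply s (\<lambda>b \<beta>. \<Sum>i\<in>I. K i b \<beta>) a = (\<Sum>i\<in>I. sd_apply s (K i) a)"
    by (induction I rule: infinite_finite_induct) (simp_all add: add, simp_all add: sd_apply_def)
qed

section \<open>Differentiating the first order system, and the Bochner formula for A\<close>

context conf_einstein
begin

definition \<phi> :: "4 \<Rightarrow> real^4 \<Rightarrow> real" where
  "\<phi> i x = - 1/2 * pd i F x"

definition Xm :: "4 \<Rightarrow> real^4 \<Rightarrow> real^3^3" where
  "Xm i x = ad_deriv \<Theta> i A x + \<phi> i x *\<^sub>R A x"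

text \<open>Covariant derivative of X, with the Christoffel correction for its form index; this
  makes the frame components \<open>Yf\<close> those of a tensor.\<close>

definition Ym :: "4 \<Rightarrow> 4 \<Rightarrow> real^4 \<Rightarrow> real^3^3" where
  "Ym i j x = ad_deriv \<Theta> i (Xm j) x - (\<Sum>m\<in>UNIV. christoffel G x m i j *\<^sub>R Xm m x)"

lemma \<phi>_smooth: "smooth_on (\<phi> i) U"
  unfolding \<phi>_def[abs_def] by (intro smooth_intros open_U F_smooth)

lemma DA_smooth: "msmooth_on (ad_deriv \<Theta> i A) U"
  unfolding ad_deriv_def[abs_def] by (intro msmooth_intros open_U A_smooth \<Theta>_smooth)

lemma Xm_smooth: "msmooth_on (Xm i) U"
  unfolding Xm_def[abs_def]
  by (rule msmooth_on_add[OF open_U DA_smooth])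
    (simp add: msmooth_on_def smooth_on_mult[OF open_U] \<phi>_smooth[unfolded eta_contract_eq] \<phi>_smooth msmooth_on_nth[OF A_smooth])

lemma v_eq: "v x b = (\<Sum>m\<in>UNIV. \<phi> m x * C x $ m $ b)"
  unfolding v_def \<phi>_def sum_distrib_left by (simp add: mult_ac)

lemma Xf_eq: "Xf x b \<alpha> \<beta> = (\<Sum>i\<in>UNIV. Xm i x $ \<alpha> $ \<beta> * C x $ i $ b)"
  by (simp add: Xf_def v_eq Xm_def sum.distrib sum_distrib_left algebra_simps)

text \<open>The terms are grouped for \<open>sd_apply\<close>: the middle ones rotate b and \<beta>
  together, which is the shape of \<open>sd_apply_rotate\<close>, and the last one acts on \<alpha>,
  which \<open>sd_apply\<close> does not touch.\<close>

lemma Y_contract: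
  assumes x: "x \<in> U"
  shows "(\<Sum>j\<in>UNIV. Ym i j x $ \<alpha> $ \<beta> * C x $ j $ b) = pd i (\<lambda>y. Xf y b \<alpha> \<beta>) x
     + (- (\<Sum>e\<in>UNIV. \<omega> i x $ e $ b * Xf x e \<alpha> \<beta>) - (\<Sum>\<gamma>\<in>UNIV. Xf x b \<alpha> \<gamma> * \<Theta> i x $ \<gamma> $ \<beta>))
     + (\<Sum>\<gamma>\<in>UNIV. \<Theta> i x $ \<alpha> $ \<gamma> * Xf x b \<gamma> \<beta>)"
proof -
  have d: "(\<lambda>y. Xm j y $ \<alpha> $ \<beta>) differentiable (at x)" "(\<lambda>y. C y $ j $ b) differentiable (at x)"
    "(\<lambda>y. Xm j y $ \<alpha> $ \<beta> * C y $ j $ b) differentiable (at x)" for j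
    by (intro smooth_on_differentiable[OF _ x] smooth_intros open_U msmooth_on_nth[OF Xm_smooth]
        msmooth_on_nth[OF C_smooth])+
  have "pd i (\<lambda>y. Xf y b \<alpha> \<beta>) x = (\<Sum>j\<in>UNIV. mpd i (Xm j) x $ \<alpha> $ \<beta> * C x $ j $ b + Xm j x $ \<alpha> $ \<beta> * pd i (\<lambda>y. C y $ j $ b) x)"
    unfolding Xf_eq pd_sum[OF d(3)] pd_mult[OF d(1,2)] mpd_def by simp
  also have "\<dots> = (\<Sum>j\<in>UNIV. mpd i (Xm j) x $ \<alpha> $ \<beta> * C x $ j $ b)
      + (\<Sum>j\<in>UNIV. \<Sum>e\<in>UNIV. Xm j x $ \<alpha> $ \<beta> * (C x $ j $ e * \<omega> i x $ e $ b))
      - (\<Sum>j\<in>UNIV. \<Sum>n\<in>UNIV. Xm j x $ \<alpha> $ \<beta> * (christoffel G x j i n * C x $ n $ b))"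
    unfolding pd_C[OF x] right_diff_distrib sum.distrib sum_subtractf sum_distrib_left by simp
  also have "(\<Sum>j\<in>UNIV. \<Sum>e\<in>UNIV. Xm j x $ \<alpha> $ \<beta> * (C x $ j $ e * \<omega> i x $ e $ b))
      = (\<Sum>e\<in>UNIV. \<Sum>j\<in>UNIV. Xm j x $ \<alpha> $ \<beta> * (C x $ j $ e * \<omega> i x $ e $ b))"
    by (rule sum.swap)
  also have "\<dots> = (\<Sum>e\<in>UNIV. \<omega> i x $ e $ b * Xf x e \<alpha> \<beta>)"
    unfolding Xf_eq sum_distrib_left by (simp only: mult_ac)
  also have "(\<Sum>j\<in>UNIV. \<Sum>n\<in>UNIV. Xm j x $ \<alpha> $ \<beta> * (christoffel G x j i n * C x $ n $ b))
      = (\<Sum>n\<in>UNIV. \<Sum>j\<in>UNIV. Xm j x $ \<alpha> $ \<beta> * (christoffel G x j i n * C x $ n $ b))"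
    by (rule sum.swap)
  finally have 1: "pd i (\<lambda>y. Xf y b \<alpha> \<beta>) x = (\<Sum>j\<in>UNIV. mpd i (Xm j) x $ \<alpha> $ \<beta> * C x $ j $ b)
      + (\<Sum>e\<in>UNIV. \<omega> i x $ e $ b * Xf x e \<alpha> \<beta>)
      - (\<Sum>n\<in>UNIV. \<Sum>j\<in>UNIV. Xm j x $ \<alpha> $ \<beta> * (christoffel G x j i n * C x $ n $ b))" .
  have 2: "(\<Sum>j\<in>UNIV. C x $ j $ b * mcomm (\<Theta> i x) (Xm j x) $ \<alpha> $ \<beta>)
      = (\<Sum>\<gamma>\<in>UNIV. \<Theta> i x $ \<alpha> $ \<gamma> * Xf x b \<gamma> \<beta>) - (\<Sum>\<gamma>\<in>UNIV. Xf x b \<alpha> \<gamma> * \<Theta> i x $ \<gamma> $ \<beta>)"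
    by (simp add: mcomm_def matrix_matrix_mult_def Xf_eq sum_3 sum_4 algebra_simps)
  show ?thesis
    unfolding 1 Ym_def ad_deriv_def
    by (simp add: sum_subtractf sum.distrib 2 sum_distrib_left algebra_simps)
qed

definition Yf :: "real^4 \<Rightarrow> 4 \<Rightarrow> 4 \<Rightarrow> 3 \<Rightarrow> 3 \<Rightarrow> real" where
  "Yf x c b \<alpha> \<beta> = fr2 (C x) (\<lambda>i j. Ym i j x $ \<alpha> $ \<beta>) c b"

lemma Yf_divergence:
  assumes x: "x \<in> U"
  shows "sd_apply s (\<lambda>b \<beta>. Yf x c b \<alpha> \<beta>) a = 0"
proof -
  have "sd_apply s (\<lambda>b \<beta>. \<Sum>j\<in>UNIV. Ym i j x $ \<alpha> $ \<beta> * C x $ j $ b) a = 0" for i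
  proof -
    have diff: "(\<lambda>y. Xf y b \<alpha> \<beta>) differentiable (at x)" "(\<lambda>y. r * Xf y b \<alpha> \<beta>) differentiable (at x)"
      "(\<lambda>y. \<Sum>b\<in>UNIV. sd s \<beta> a b * Xf y b \<alpha> \<beta>) differentiable (at x)" for b \<alpha> \<beta> a r
      unfolding Xf_eq
      by (intro smooth_on_differentiable[OF _ x] smooth_intros open_U msmooth_on_nth[OF Xm_smooth]
          msmooth_on_nth[OF C_smooth])+
    have "sd_apply s (\<lambda>b \<beta>. pd i (\<lambda>y. Xf y b \<alpha> \<beta>) x) a = pd i (\<lambda>y. sd_apply s (\<lambda>b \<beta>. Xf y b \<alpha> \<beta>) a) x"
      unfolding sd_apply_def pd_sum[OF diff(3)] pd_sum[OF diff(2)] pd_cmult[OF diff(1)] ..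
    also have "\<dots> = pd i (\<lambda>y. 0) x"
      by (rule pd_cong_open[OF open_U x divergence_free])
    finally have 1: "sd_apply s (\<lambda>b \<beta>. pd i (\<lambda>y. Xf y b \<alpha> \<beta>) x) a = 0" by simp
    have 2: "sd_apply s (\<lambda>b \<beta>. - (\<Sum>e\<in>UNIV. \<omega> i x $ e $ b * Xf x e \<alpha> \<beta>) - (\<Sum>\<gamma>\<in>UNIV. Xf x b \<alpha> \<gamma> * \<Theta> i x $ \<gamma> $ \<beta>)) a = 0"
      using sd_apply_rotate[where w = "\<lambda>a b. \<omega> i x $ a $ b" and Z = "\<lambda>b \<beta>. Xf x b \<alpha> \<beta>" and a = a,
          OF sign \<omega>_skew_nth[OF x]]
      by (simp add: \<Theta>_def divergence_free[OF x])
    have 3: "sd_apply s (\<lambda>b \<beta>. \<Sum>\<gamma>\<in>UNIV. \<Theta> i x $ \<alpha> $ \<gamma> * Xf x b \<gamma> \<beta>) a = 0"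
      unfolding sd_apply_linear divergence_free[OF x] by simp
    show ?thesis unfolding Y_contract[OF x] sd_apply_linear(1) 1 2 3 by simp
  qed
  moreover have "Yf x c b \<alpha> \<beta> = (\<Sum>i\<in>UNIV. C x $ i $ c * (\<Sum>j\<in>UNIV. Ym i j x $ \<alpha> $ \<beta> * C x $ j $ b))" for b \<beta>
    by (simp add: Yf_def fr2_def sum_distrib_left mult_ac)
  ultimately show ?thesis by (simp add: sd_apply_linear)
qed

lemma DXm:
  assumes x: "x \<in> U"
  shows "ad_deriv \<Theta> i (Xm j) x
    = ad_deriv \<Theta> i (ad_deriv \<Theta> j A) x + pd i (\<phi> j) x *\<^sub>R A x + \<phi> j x *\<^sub>R ad_deriv \<Theta> i A x"
  unfolding Xm_def[abs_def]
  by (rule ad_deriv_add_scaleR[OF x DA_smooth A_smooth \<phi>_smooth])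

lemma pd_\<phi>: "x \<in> U \<Longrightarrow> pd i (\<phi> j) x = - 1/2 * pd i (pd j F) x"
  unfolding \<phi>_def[abs_def]
  by (rule pd_cmult[OF smooth_on_differentiable[OF smooth_on_pd[OF F_smooth]], unfolded eta_contract_eq])

text \<open>The Christoffel correction and the second derivatives of F are symmetric in i and j, so
  only the curvature of \<open>\<Theta>\<close> and first order terms survive.\<close>

lemma Ym_skew:
  assumes x: "x \<in> U"
  shows "Ym i j x - Ym j i x = mcomm (curv \<Theta> i j x) (A x) + \<phi> j x *\<^sub>R Xm i x - \<phi> i x *\<^sub>R Xm j x"
proof -
  have "Ym i j x - Ym j i x = ad_deriv \<Theta> i (Xm j) x - ad_deriv \<Theta> j (Xm i) x"
    by (simp add: Ym_def christoffel_sym[OF x, of _ j i])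
  also have "\<dots> = mcomm (curv \<Theta> i j x) (A x) + \<phi> j x *\<^sub>R ad_deriv \<Theta> i A x - \<phi> i x *\<^sub>R ad_deriv \<Theta> j A x"
    using ad_deriv_commute[where w = \<Theta> and i = i and j = j, OF open_U \<Theta>_smooth A_smooth x]
    by (simp add: DXm[OF x] pd_\<phi>[OF x] pd_commute[OF open_U F_smooth x, of j i] algebra_simps)
  finally show ?thesis by (simp add: Xm_def algebra_simps)
qed

lemma curv_\<Theta>_frame:
  assumes x: "x \<in> U"
  shows "fr2 (C x) (\<lambda>i j. curv \<Theta> i j x $ \<alpha> $ \<beta>) a b = ad3 s (sd_comp s (Rf x a b)) \<alpha> \<beta>"
proof -
  have "Rf x a b = (\<lambda>c d. \<Sum>i\<in>UNIV. \<Sum>j\<in>UNIV. (C x $ i $ a * C x $ j $ b) * curv \<omega> i j x $ c $ d)"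
    by (simp add: fun_eq_iff Rf_eq[OF x] fr2_def mult_ac)
  then have "ad3 s (sd_comp s (Rf x a b)) \<alpha> \<beta> = (\<Sum>i\<in>UNIV. \<Sum>j\<in>UNIV. (C x $ i $ a * C x $ j $ b) *
      ad3 s (sd_comp s (\<lambda>c d. curv \<omega> i j x $ c $ d)) \<alpha> \<beta>)"
    by (simp only: sd_comp_sum sd_comp_cmult ad3_sum ad3_cmult)
  then show ?thesis by (simp add: fr2_def curv_\<Theta>[OF x] mult_ac)
qed

definition Pf :: "real^4 \<Rightarrow> 4 \<Rightarrow> real^3^3" where
  "Pf x b = (\<Sum>i\<in>UNIV. C x $ i $ b *\<^sub>R ad_deriv \<Theta> i A x)"

lemma weitzenboeck_A:
  assumes x: "x \<in> U"
  shows "(\<Sum>a\<in>UNIV. fr2 (C x) (\<lambda>i j. mdot (A x) (Ym i j x)) a a) =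
    scalar_curv G x / 2 * mdot (A x) (A x) - 18 * det (A x)
    - (\<Sum>a\<in>UNIV. v x a * (mdot (A x) (Pf x a) + v x a * mdot (A x) (A x)))"
proof -
  have skew: "Yf x a b \<alpha> \<beta> - Yf x b a \<alpha> \<beta> =
      (\<Sum>\<gamma>\<in>UNIV. fr2 (C x) (\<lambda>i j. curv \<Theta> i j x $ \<alpha> $ \<gamma>) a b * A x $ \<gamma> $ \<beta>
         - A x $ \<alpha> $ \<gamma> * fr2 (C x) (\<lambda>i j. curv \<Theta> i j x $ \<gamma> $ \<beta>) a b)
      + v x b * Xf x a \<alpha> \<beta> - v x a * Xf x b \<alpha> \<beta>" for a b \<alpha> \<beta>
  proof -
    have sw: "Yf x b a \<alpha> \<beta> = fr2 (C x) (\<lambda>i j. Ym j i x $ \<alpha> $ \<beta>) a b"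
      unfolding Yf_def fr2_def by (subst sum.swap) (simp add: mult_ac)
    have "Ym i j x $ \<alpha> $ \<beta> - Ym j i x $ \<alpha> $ \<beta> =
       ((\<Sum>\<gamma>\<in>UNIV. curv \<Theta> i j x $ \<alpha> $ \<gamma> * A x $ \<gamma> $ \<beta>) - (\<Sum>\<gamma>\<in>UNIV. A x $ \<alpha> $ \<gamma> * curv \<Theta> i j x $ \<gamma> $ \<beta>))
       + Xm i x $ \<alpha> $ \<beta> * \<phi> j x - \<phi> i x * Xm j x $ \<alpha> $ \<beta>" for i j
      using arg_cong[OF Ym_skew[OF x, of i j], of "\<lambda>M. M $ \<alpha> $ \<beta>"]
      by (simp add: mcomm_def matrix_matrix_mult_def)
    then have "Yf x a b \<alpha> \<beta> - Yf x b a \<alpha> \<beta> = fr2 (C x) (\<lambda>i j.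
       ((\<Sum>\<gamma>\<in>UNIV. curv \<Theta> i j x $ \<alpha> $ \<gamma> * A x $ \<gamma> $ \<beta>) - (\<Sum>\<gamma>\<in>UNIV. A x $ \<alpha> $ \<gamma> * curv \<Theta> i j x $ \<gamma> $ \<beta>))
       + Xm i x $ \<alpha> $ \<beta> * \<phi> j x - \<phi> i x * Xm j x $ \<alpha> $ \<beta>) a b"
      unfolding sw unfolding Yf_def fr2_linear(2)[symmetric] by (simp only:)
    then show ?thesis
      unfolding fr2_linear fr2_sum fr2_prod Xf_eq[symmetric] v_eq[symmetric] sum_subtractf by simp
  qed
  have Yt: "(\<Sum>a\<in>UNIV. fr2 (C x) (\<lambda>i j. mdot (A x) (Ym i j x)) a a)
      = (\<Sum>\<alpha>\<in>UNIV. \<Sum>\<beta>\<in>UNIV. A x $ \<alpha> $ \<beta> * (\<Sum>a\<in>UNIV. Yf x a a \<alpha> \<beta>))"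
    unfolding mdot_def fr2_sum fr2_linear Yf_def[symmetric]
    by (subst sum.swap, rule sum.cong[OF refl], subst sum.swap) (simp add: sum_distrib_left)
  have Xt: "(\<Sum>\<alpha>\<in>UNIV. \<Sum>\<beta>\<in>UNIV. A x $ \<alpha> $ \<beta> * (\<Sum>a\<in>UNIV. v x a * Xf x a \<alpha> \<beta>))
      = (\<Sum>a\<in>UNIV. v x a * (mdot (A x) (Pf x a) + v x a * mdot (A x) (A x)))"
    by (simp add: Xf_def mdot_def Pf_def sum_3 sum_4 algebra_simps)
  show ?thesis
    unfolding Yt Xt[symmetric]
    using weitzenboeck[where A = "\<lambda>\<alpha> \<beta>. A x $ \<alpha> $ \<beta>" and X = "Xf x" and Y = "Yf x" and v = "v x"
      and F = "\<lambda>a b \<alpha> \<beta>. fr2 (C x) (\<lambda>i j. curv \<Theta> i j x $ \<alpha> $ \<beta>) a b" and R = "Rf x"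
      and sc = "scalar_curv G x", OF sign A_sym[OF x] A_trace[OF x] divergence_free[OF x] Yf_divergence[OF x]
        curv_\<Theta>_frame[OF x] Rf_block[OF x] skew]
    by (simp add: mdot_def vec_lambda_eta)
qed

lemma fr2_mdot_deriv:
  "fr2 (C x) (\<lambda>i j. mdot (ad_deriv \<Theta> i A x) (ad_deriv \<Theta> j A x)) b b = mdot (Pf x b) (Pf x b)"
proof -
  have "mdot (Pf x b) (Pf x b) = (\<Sum>i\<in>UNIV. C x $ i $ b *
      (\<Sum>j\<in>UNIV. C x $ j $ b * mdot (ad_deriv \<Theta> i A x) (ad_deriv \<Theta> j A x)))"
    unfolding Pf_def mdot_linear_left mdot_linear(5) mdot_linear(3)
    by (intro sum.cong refl arg_cong2[where f = "(*)"] mdot_linear(4))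
  then show ?thesis unfolding fr2_def by (simp add: sum_distrib_left mult_ac)
qed

lemma drift_laplacian_A:
  assumes x: "x \<in> U"
  shows "drift_laplacian G F (\<lambda>y. mdot (A y) (A y)) x =
    2 * (\<Sum>b\<in>UNIV. mdot (Pf x b) (Pf x b)) + (4 * L x - grad_inner G F F x) * mdot (A x) (A x) - 36 * det (A x)"
proof -
  let ?q = "\<lambda>y. mdot (A y) (A y)"
  let ?P = "\<lambda>i. ad_deriv \<Theta> i A"
  have pd1: "pd j ?q y = 2 * mdot (A y) (?P j y)" if "y \<in> U" for j y
    using pd_mdot[where w = \<Theta>, OF open_U that A_smooth A_smooth \<Theta>_skew]
    by (simp add: mdot_linear(4)[of _ "A y"])
  have sm: "smooth_on (\<lambda>y. mdot (A y) (?P j y)) U" for j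
    unfolding mdot_def by (intro smooth_intros open_U msmooth_on_nth[OF A_smooth] msmooth_on_nth[OF DA_smooth])
  have pd2: "pd i (pd j ?q) x = 2 * mdot (?P i x) (?P j x) + 2 * mdot (A x) (ad_deriv \<Theta> i (?P j) x)" for i j
  proof -
    have "pd i (pd j ?q) x = pd i (\<lambda>y. 2 * mdot (A y) (?P j y)) x"
      by (rule pd_cong_open[OF open_U x pd1])
    also have "\<dots> = 2 * pd i (\<lambda>y. mdot (A y) (?P j y)) x"
      by (rule pd_cmult[OF smooth_on_differentiable[OF sm x]])
    also have "\<dots> = 2 * (mdot (?P i x) (?P j x) + mdot (A x) (ad_deriv \<Theta> i (?P j) x))"
      using pd_mdot[where w = \<Theta>, OF open_U x A_smooth DA_smooth \<Theta>_skew] by simp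
    finally show ?thesis by simp
  qed
  \<comment> \<open>X differs from the derivative of A by \<phi> tensor A, and the covariant
    derivative of \<phi> is - 1/2 times the Hessian of F. Hence replacing second derivatives of A by
    \<open>Ym\<close> produces the Hessian of F times |A|^2.\<close>
  have hess: "hessian G ?q x i j = 2 * mdot (?P i x) (?P j x) + 2 * mdot (A x) (Ym i j x)
      + hessian G F x i j * mdot (A x) (A x) - 2 * (mdot (A x) (?P i x) * \<phi> j x)" for i j
  proof -
    have "ad_deriv \<Theta> i (?P j) x = Ym i j x + (\<Sum>m\<in>UNIV. christoffel G x m i j *\<^sub>R Xm m x)
        - pd i (\<phi> j) x *\<^sub>R A x - \<phi> j x *\<^sub>R ?P i x"
      unfolding Ym_def DXm[OF x] by (simp add: algebra_simps)
    then have 1: "mdot (A x) (ad_deriv \<Theta> i (?P j) x) = mdot (A x) (Ym i j x)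
        + (\<Sum>m\<in>UNIV. christoffel G x m i j * (mdot (A x) (?P m x) + \<phi> m x * mdot (A x) (A x)))
        - pd i (\<phi> j) x * mdot (A x) (A x) - \<phi> j x * mdot (A x) (?P i x)"
      by (simp add: mdot_linear(1-3,5) Xm_def)
    have 2: "hessian G F x i j = - 2 * (pd i (\<phi> j) x - (\<Sum>m\<in>UNIV. christoffel G x m i j * \<phi> m x))"
      unfolding hessian_def pd_\<phi>[OF x] \<phi>_def by (simp add: sum_distrib_left sum_negf mult_ac sum_divide_distrib[symmetric])
    show ?thesis
      unfolding hessian_def[of _ ?q] pd2 pd1[OF x] 1 2
      by (simp add: sum.distrib sum_distrib_left sum_distrib_right sum_negf algebra_simps)
  qed
  have AP: "(\<Sum>i\<in>UNIV. mdot (A x) (?P i x) * C x $ i $ b) = mdot (A x) (Pf x b)" for b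
    unfolding Pf_def mdot_linear(3,5) by (simp add: mult.commute)
  have lap: "laplacian G ?q x = 2 * (\<Sum>b\<in>UNIV. mdot (Pf x b) (Pf x b))
      + 2 * (\<Sum>b\<in>UNIV. fr2 (C x) (\<lambda>i j. mdot (A x) (Ym i j x)) b b)
      + (\<Sum>b\<in>UNIV. fr2 (C x) (hessian G F x) b b) * mdot (A x) (A x)
      - 2 * (\<Sum>b\<in>UNIV. mdot (A x) (Pf x b) * v x b)"
    unfolding laplacian_def ginv_trace[OF x] hess fr2_linear fr2_prod AP v_eq[symmetric] fr2_mdot_deriv
    by (simp add: sum.distrib sum_subtractf sum_distrib_left sum_distrib_right)
  have Fv: "(\<Sum>i\<in>UNIV. pd i F x * C x $ i $ b) = - 2 * v x b" for b
    unfolding v_def by (simp add: mult.commute)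
  have gF: "grad_inner G F F x = 4 * (\<Sum>b\<in>UNIV. v x b * v x b)"
    unfolding grad_inner_def mult.assoc ginv_trace[OF x] fr2_prod Fv by (simp add: sum_distrib_left)
  have gq: "grad_inner G F ?q x = - 4 * (\<Sum>b\<in>UNIV. v x b * mdot (A x) (Pf x b))"
  proof -
    have "(\<Sum>j\<in>UNIV. pd j ?q x * C x $ j $ b) = 2 * mdot (A x) (Pf x b)" for b
      unfolding pd1[OF x] AP[symmetric] by (simp add: sum_distrib_left mult.assoc)
    then show ?thesis
      unfolding grad_inner_def mult.assoc ginv_trace[OF x] fr2_prod Fv by (simp add: sum_distrib_left)
  qed
  have tr: "scalar_curv G x + (\<Sum>b\<in>UNIV. fr2 (C x) (hessian G F x) b b) + 2 * (\<Sum>b\<in>UNIV. v x b * v x b) = 4 * L x"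
  proof -
    have "fr2 (C x) (\<lambda>i j. ricci G x i j + hessian G F x i j + 1/2 * (pd i F x * pd j F x)) b b
      = L x * kd b b" for b
      unfolding soliton[OF x] by (simp add: fr2_linear fr2_G[OF x])
    then have "ricci_tr (Rf x) b b + fr2 (C x) (hessian G F x) b b + 2 * (v x b * v x b) = L x" for b
      unfolding fr2_linear fr2_prod Fv by (simp add: fr2_ricci[OF x])
    then have "(\<Sum>b\<in>UNIV. ricci_tr (Rf x) b b + fr2 (C x) (hessian G F x) b b + 2 * (v x b * v x b)) = 4 * L x"
      by simp
    then show ?thesis by (simp add: sum.distrib sum_distrib_left scalar_curv_eq[OF x])
  qed
  have L: "4 * L x = scalar_curv G x + (\<Sum>b\<in>UNIV. fr2 (C x) (hessian G F x) b b) + 2 * (\<Sum>b\<in>UNIV. v x b * v x b)"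
    using tr by simp
  \<comment> \<open>The pairings of A with its derivative along v add up to - 4 in the Laplacian and
    cancel the drift term. The factor of |A|^2 is scalar curvature plus Laplacian of F minus 2
    |v|^2, that is 4 L - 4 |v|^2, and 4 |v|^2 is the squared gradient of F.\<close>
  show ?thesis
    unfolding drift_laplacian_def lap gq gF L weitzenboeck_A[OF x]
    by (simp add: sum.distrib sum_distrib_left sum_distrib_right sum_subtractf sum_negf algebra_simps)
qed

end

section \<open>The self-dual part of the Weyl tensor in a frame\<close>

lemma vector_4 [simp]:
  "(vector [x,y,z,w] :: 'a::zero^4) $ 1 = x" "(vector [x,y,z,w] :: 'a::zero^4) $ 2 = y"
  "(vector [x,y,z,w] :: 'a::zero^4) $ 3 = z" "(vector [x,y,z,w] :: 'a::zero^4) $ 4 = w"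
  unfolding vector_def by simp_all

lemma det_4:
  "det (A :: 'a::comm_ring_1^4^4) =
     A$1$1 * (A$2$2 * A$3$3 * A$4$4 + A$2$3 * A$3$4 * A$4$2 + A$2$4 * A$3$2 * A$4$3
       - A$2$2 * A$3$4 * A$4$3 - A$2$3 * A$3$2 * A$4$4 - A$2$4 * A$3$3 * A$4$2)
   - A$1$2 * (A$2$1 * A$3$3 * A$4$4 + A$2$3 * A$3$4 * A$4$1 + A$2$4 * A$3$1 * A$4$3
       - A$2$1 * A$3$4 * A$4$3 - A$2$3 * A$3$1 * A$4$4 - A$2$4 * A$3$3 * A$4$1)
   + A$1$3 * (A$2$1 * A$3$2 * A$4$4 + A$2$2 * A$3$4 * A$4$1 + A$2$4 * A$3$1 * A$4$2
       - A$2$1 * A$3$4 * A$4$2 - A$2$2 * A$3$1 * A$4$4 - A$2$4 * A$3$2 * A$4$1)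
   - A$1$4 * (A$2$1 * A$3$2 * A$4$3 + A$2$2 * A$3$3 * A$4$1 + A$2$3 * A$3$1 * A$4$2
       - A$2$1 * A$3$3 * A$4$2 - A$2$2 * A$3$1 * A$4$3 - A$2$3 * A$3$2 * A$4$1)"
proof -
  have f: "finite {2::4, 3, 4}" "1 \<notin> {2::4, 3, 4}" "finite {3::4, 4}" "2 \<notin> {3::4, 4}"
    "finite {4::4}" "3 \<notin> {4::4}"
    by auto
  show ?thesis
    unfolding det_def UNIV_4
    unfolding sum_over_permutations_insert[OF f(1,2)]
    unfolding sum_over_permutations_insert[OF f(3,4)]
    unfolding sum_over_permutations_insert[OF f(5,6)]
    unfolding permutes_sing
    by (simp add: sign_swap_id permutation_swap_id sign_compose sign_id swap_id_eq
        permutation_compose algebra_simps)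
qed

section \<open>The alternating symbol and its contraction with a bivector\<close>

definition eps4 :: tensor4 where
  "eps4 i j k l = det (vector [axis i 1, axis j 1, axis k 1, axis l 1] :: real^4^4)"

lemma eps4_expand:
  "(\<Sum>i\<in>UNIV. \<Sum>j\<in>UNIV. \<Sum>k\<in>UNIV. \<Sum>l\<in>UNIV. eps4 i j k l * (p $ i * q $ j * r $ k * t $ l))
   = det (vector [p, q, r, t] :: real^4^4)"
proof -
  have 1: "(\<Sum>i\<in>UNIV. \<Sum>j\<in>UNIV. \<Sum>k\<in>UNIV. \<Sum>l\<in>UNIV.
      (kd i a * kd j b * kd k c * kd l d) * (p $ i * q $ j * r $ k * t $ l)) = p $ a * q $ b * r $ c * t $ d"
    for a b c d
  proof -
    have "(\<Sum>i\<in>UNIV. \<Sum>j\<in>UNIV. \<Sum>k\<in>UNIV. \<Sum>l\<in>UNIV.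
        (kd i a * kd j b * kd k c * kd l d) * (p $ i * q $ j * r $ k * t $ l))
      = (\<Sum>i\<in>UNIV. kd i a * (p $ i * (\<Sum>j\<in>UNIV. kd j b * (q $ j * (\<Sum>k\<in>UNIV. kd k c * (r $ k * (\<Sum>l\<in>UNIV. kd l d * t $ l)))))))"
      by (simp only: sum_distrib_left mult_ac)
    then show ?thesis by simp
  qed
  have ax: "axis i 1 $ a = (kd i a :: real)" for i a :: 4
    by (simp add: axis_def kd_def)
  show ?thesis
    unfolding eps4_def det_4 vector_4 ax
    by (simp only: distrib_left distrib_right left_diff_distrib right_diff_distrib sum.distrib sum_subtractf
       mult.assoc[symmetric] 1[unfolded mult.assoc[symmetric]])
qed

text \<open>On the left is half of the identity plus s times the star. On the right is the
  orthogonal projection to the span of the \<open>sd s\<close>, whose double sums of squares equal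
  4.\<close>

lemma eps4_contract:
  assumes a: "\<And>m n. a m n = - a n m" and s: "s * s = 1"
  shows "1/2 * (a c d + s * (1/2 * (\<Sum>m\<in>UNIV. \<Sum>n\<in>UNIV. eps4 m n c d * a m n)))
    = 1/4 * (\<Sum>\<alpha>\<in>UNIV. sd_comp s a \<alpha> * sd s \<alpha> c d)"
proof -
  have ax: "axis i 1 $ a = (kd i a :: real)" for i a :: 4
    by (simp add: axis_def kd_def)
  have k: "kd 1 (2::4) = 0" "kd 1 (3::4) = 0" "kd 1 (4::4) = 0" "kd 2 (1::4) = 0" "kd 2 (3::4) = 0" "kd 2 (4::4) = 0"
    "kd 3 (1::4) = 0" "kd 3 (2::4) = 0" "kd 3 (4::4) = 0" "kd 4 (1::4) = 0" "kd 4 (2::4) = 0" "kd 4 (3::4) = 0"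
    by (simp_all add: kd_def)
  have r: "a 2 1 = - a 1 2" "a 3 1 = - a 1 3" "a 4 1 = - a 1 4"
      "a 3 2 = - a 2 3" "a 4 2 = - a 2 4" "a 4 3 = - a 3 4"
    by (rule a)+
  have s2: "s * (s * x) = x" for x using s by (simp add: mult.assoc[symmetric])
  have h: "(\<Sum>m\<in>UNIV. \<Sum>n\<in>UNIV. kd m p * kd n q * x * y * a m n) = a p q * x * y" for p q x y
  proof -
    have "(\<Sum>m\<in>UNIV. \<Sum>n\<in>UNIV. kd m p * kd n q * x * y * a m n)
      = (\<Sum>m\<in>UNIV. kd m p * (\<Sum>n\<in>UNIV. kd n q * (a m n * x * y)))"
      by (simp only: sum_distrib_left mult_ac)
    then show ?thesis by simp
  qed
  have e: "(\<Sum>m\<in>UNIV. \<Sum>n\<in>UNIV. eps4 m n c d * a m n) =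
      (2) * a 1 2 * kd c 3 * kd d 4 + (-2) * a 1 2 * kd c 4 * kd d 3 + (-2) * a 1 3 * kd c 2 * kd d 4
      + (2) * a 1 3 * kd c 4 * kd d 2 + (2) * a 1 4 * kd c 2 * kd d 3 + (-2) * a 1 4 * kd c 3 * kd d 2
      + (2) * a 2 3 * kd c 1 * kd d 4 + (-2) * a 2 3 * kd c 4 * kd d 1 + (-2) * a 2 4 * kd c 1 * kd d 3
      + (2) * a 2 4 * kd c 3 * kd d 1 + (2) * a 3 4 * kd c 1 * kd d 2 + (-2) * a 3 4 * kd c 2 * kd d 1" for c d
    unfolding eps4_def det_4 vector_4 ax
    by (simp only: distrib_left distrib_right left_diff_distrib right_diff_distrib sum.distrib sum_subtractf
       mult.assoc[symmetric] h) (simp add: r)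
  have "\<forall>c d. 1/2 * (a c d + s * (1/2 * (\<Sum>m\<in>UNIV. \<Sum>n\<in>UNIV. eps4 m n c d * a m n)))
    = 1/4 * (\<Sum>\<alpha>\<in>UNIV. sd_comp s a \<alpha> * sd s \<alpha> c d)"
    unfolding e forall_4 sum_3 sd_comp_table[OF a] sd_table skew_diag[of a, OF a]
    by (simp add: k r s2 algebra_simps)
  then show ?thesis by blast
qed

lemma sum_permute4_outer:
  fixes f :: "'i::finite \<Rightarrow> 'i \<Rightarrow> 'i \<Rightarrow> 'i \<Rightarrow> real"
  shows "(\<Sum>i\<in>UNIV. \<Sum>j\<in>UNIV. \<Sum>m\<in>UNIV. \<Sum>n\<in>UNIV. f i j m n) = (\<Sum>m\<in>UNIV. \<Sum>n\<in>UNIV. \<Sum>i\<in>UNIV. \<Sum>j\<in>UNIV. f i j m n)"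
  unfolding sum.cartesian_product UNIV_Times_UNIV
  by (rule sum.reindex_bij_witness[of _ "\<lambda>(m,n,i,j). (i,j,m,n)" "\<lambda>(i,j,m,n). (m,n,i,j)"]; auto)

text \<open>\<open>up C a\<close> is the bivector with frame components \<open>a\<close>.\<close>

definition up :: "real^4^4 \<Rightarrow> (4 \<Rightarrow> 4 \<Rightarrow> real) \<Rightarrow> real^4^4" where
  "up C a = C ** (\<chi> m n. a m n) ** transpose C"

lemma up_nth: "up C a $ i $ j = (\<Sum>m\<in>UNIV. \<Sum>n\<in>UNIV. a m n * C $ i $ m * C $ j $ n)"
proof -
  have "up C a $ i $ j = (\<Sum>n\<in>UNIV. \<Sum>m\<in>UNIV. a m n * C $ i $ m * C $ j $ n)"
    by (simp add: up_def matrix_matrix_mult_def transpose_def sum_distrib_left sum_distrib_right mult_ac)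
  also have "\<dots> = (\<Sum>m\<in>UNIV. \<Sum>n\<in>UNIV. a m n * C $ i $ m * C $ j $ n)" by (rule sum.swap)
  finally show ?thesis .
qed

lemma pair_up: "(\<Sum>i\<in>UNIV. \<Sum>j\<in>UNIV. S i j * up C a $ i $ j) = (\<Sum>m\<in>UNIV. \<Sum>n\<in>UNIV. fr2 C S m n * a m n)"
proof -
  have "(\<Sum>i\<in>UNIV. \<Sum>j\<in>UNIV. S i j * up C a $ i $ j)
      = (\<Sum>i\<in>UNIV. \<Sum>j\<in>UNIV. \<Sum>m\<in>UNIV. \<Sum>n\<in>UNIV. S i j * C $ i $ m * C $ j $ n * a m n)"
    by (simp add: up_nth sum_distrib_left mult_ac)
  also have "\<dots> = (\<Sum>m\<in>UNIV. \<Sum>n\<in>UNIV. \<Sum>i\<in>UNIV. \<Sum>j\<in>UNIV. S i j * C $ i $ m * C $ j $ n * a m n)"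
    by (rule sum_permute4_outer)
  finally show ?thesis by (simp add: fr2_def sum_distrib_right)
qed

lemma up_linear:
  "up C (\<lambda>m n. a m n + b m n) = up C a + up C b" "up C (\<lambda>m n. r * a m n) = r *\<^sub>R up C a"
  "up C (\<lambda>m n. \<Sum>k\<in>K. c k m n) = (\<Sum>k\<in>K. up C (c k))"
proof -
  show add: "up C (\<lambda>m n. a m n + b m n) = up C a + up C b" for a b
    by (simp add: vec_eq_iff up_nth distrib_right sum.distrib)
  show "up C (\<lambda>m n. r * a m n) = r *\<^sub>R up C a"
    by (simp add: vec_eq_iff up_nth sum_distrib_left mult_ac)
  show "up C (\<lambda>m n. \<Sum>k\<in>K. c k m n) = (\<Sum>k\<in>K. up C (c k))"
    by (induction K rule: infinite_finite_induct) (simp_all add: add, simp_all add: vec_eq_iff up_nth)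
qed

section \<open>Hodge star, projections and the half Weyl tensor in an oriented frame\<close>

locale oriented_frame = oframe_sign +
  assumes orientation: "\<And>x. x \<in> U \<Longrightarrow> 0 < det (C x)"
begin

text \<open>Orthonormality gives det G (det C)^2 = 1, and the orientation selects the root. With it,
  \<open>fr4_volume_form\<close> turns the volume form into \<open>eps4\<close>, so that
  \<open>sd s\<close> spans the half of sign s and not the other one.\<close>

lemma det_C: "x \<in> U \<Longrightarrow> sqrt (det (G x)) * det (C x) = 1"
proof -
  assume x: "x \<in> U"
  have "det (transpose (C x) ** G x ** C x) = 1" by (simp add: orthonormal[OF x])
  then have d: "det (G x) * (det (C x) * det (C x)) = 1" by (simp add: det_mul mult_ac)
  then have "sqrt (det (G x) * (det (C x) * det (C x))) = 1" by simp
  then show ?thesis using orientation[OF x] by (simp add: real_sqrt_mult)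
qed

lemma raise_indices:
  assumes x: "x \<in> U"
  shows "(\<Sum>a\<in>UNIV. \<Sum>b\<in>UNIV. S a b * ginv (G x) a k * ginv (G x) b l)
    = (\<Sum>c\<in>UNIV. \<Sum>d\<in>UNIV. fr2 (C x) S c d * C x $ k $ c * C x $ l $ d)"
proof -
  have g: "ginv (G x) a k = (\<Sum>c\<in>UNIV. C x $ a $ c * C x $ k $ c)" for a k
    by (rule ginv_eq[OF x])
  have "(\<Sum>a\<in>UNIV. \<Sum>b\<in>UNIV. S a b * ginv (G x) a k * ginv (G x) b l) =
    (\<Sum>a\<in>UNIV. \<Sum>b\<in>UNIV. \<Sum>c\<in>UNIV. \<Sum>d\<in>UNIV. S a b * C x $ a $ c * C x $ b $ d * (C x $ k $ c * C x $ l $ d))"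
  proof (intro sum.cong refl)
    fix a b
    have "S a b * ginv (G x) a k * ginv (G x) b l
       = S a b * ((\<Sum>c\<in>UNIV. C x $ a $ c * C x $ k $ c) * (\<Sum>d\<in>UNIV. C x $ b $ d * C x $ l $ d))"
      by (simp only: g mult.assoc)
    also have "\<dots> = (\<Sum>c\<in>UNIV. \<Sum>d\<in>UNIV. S a b * C x $ a $ c * C x $ b $ d * (C x $ k $ c * C x $ l $ d))"
      unfolding sum_product unfolding sum_distrib_left by (simp only: mult_ac)
    finally show "S a b * ginv (G x) a k * ginv (G x) b l =
      (\<Sum>c\<in>UNIV. \<Sum>d\<in>UNIV. S a b * C x $ a $ c * C x $ b $ d * (C x $ k $ c * C x $ l $ d))" .
  qed
  also have "\<dots> = (\<Sum>c\<in>UNIV. \<Sum>d\<in>UNIV. \<Sum>a\<in>UNIV. \<Sum>b\<in>UNIV. S a b * C x $ a $ c * C x $ b $ d * (C x $ k $ c * C x $ l $ d))"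
    by (rule sum_permute4_outer)
  finally show ?thesis by (simp add: fr2_def sum_distrib_right mult.assoc)
qed

lemma tensor_op_up:
  assumes x: "x \<in> U"
  shows "tensor_op (G x) T (up (C x) a)
    = up (C x) (\<lambda>c d. 1/2 * (\<Sum>m\<in>UNIV. \<Sum>n\<in>UNIV. fr4 (C x) T m n c d * a m n))"
proof -
  have "tensor_op (G x) T (up (C x) a) $ k $ l
      = up (C x) (\<lambda>c d. 1/2 * (\<Sum>m\<in>UNIV. \<Sum>n\<in>UNIV. fr4 (C x) T m n c d * a m n)) $ k $ l" for k l
  proof -
    have "tensor_op (G x) T (up (C x) a) $ k $ l = 1/2 * (\<Sum>i\<in>UNIV. \<Sum>j\<in>UNIV.
        (\<Sum>a\<in>UNIV. \<Sum>b\<in>UNIV. T i j a b * ginv (G x) a k * ginv (G x) b l) * up (C x) a $ i $ j)"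
      by (simp add: tensor_op_def sum_distrib_right)
    also have "\<dots> = 1/2 * (\<Sum>m\<in>UNIV. \<Sum>n\<in>UNIV. (\<Sum>c\<in>UNIV. \<Sum>d\<in>UNIV. fr4 (C x) T m n c d * C x $ k $ c * C x $ l $ d) * a m n)"
      unfolding raise_indices[OF x] pair_up fr2_sum fr2_linear fr4_def by (simp add: mult.commute)
    also have "\<dots> = (\<Sum>m\<in>UNIV. \<Sum>n\<in>UNIV. \<Sum>c\<in>UNIV. \<Sum>d\<in>UNIV. 1/2 * (fr4 (C x) T m n c d * a m n) * C x $ k $ c * C x $ l $ d)"
      by (simp add: sum_distrib_left sum_distrib_right mult_ac)
    also have "\<dots> = (\<Sum>c\<in>UNIV. \<Sum>d\<in>UNIV. \<Sum>m\<in>UNIV. \<Sum>n\<in>UNIV. 1/2 * (fr4 (C x) T m n c d * a m n) * C x $ k $ c * C x $ l $ d)"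
      by (rule sum_permute4_outer)
    finally show ?thesis by (simp add: up_nth sum_distrib_left sum_distrib_right)
  qed
  then show ?thesis by (simp add: vec_eq_iff)
qed

lemma fr4_volume_form:
  assumes x: "x \<in> U"
  shows "fr4 (C x) (volume_form (G x)) m n c d = eps4 m n c d"
proof -
  let ?c = "\<lambda>m. (\<chi> i. C x $ i $ m) :: real^4"
  have "fr4 (C x) (volume_form (G x)) m n c d = sqrt (det (G x)) * (\<Sum>i\<in>UNIV. \<Sum>j\<in>UNIV. \<Sum>k\<in>UNIV. \<Sum>l\<in>UNIV.
      eps4 i j k l * (?c m $ i * ?c n $ j * ?c c $ k * ?c d $ l))"
    unfolding fr4_expand volume_form_def eps4_def by (simp add: sum_distrib_left mult.assoc)
  also have "\<dots> = sqrt (det (G x)) * det (vector [?c m, ?c n, ?c c, ?c d] :: real^4^4)"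
    unfolding eps4_expand ..
  also have "(vector [?c m, ?c n, ?c c, ?c d] :: real^4^4)
      = vector [axis m 1, axis n 1, axis c 1, axis d 1] ** transpose (C x)"
  proof -
    have ax: "axis i 1 $ a = (kd i a :: real)" for i a :: 4
      by (simp add: axis_def kd_def)
    show ?thesis
      unfolding vec_eq_iff forall_4[of "\<lambda>i. \<forall>j. _ i j"] matrix_matrix_mult_def
      by (simp add: transpose_def ax)
  qed
  finally show ?thesis using det_C[OF x] by (simp add: det_mul eps4_def mult_ac)
qed

lemma up_skew:
  assumes "\<And>m n. a m n = - a n m"
  shows "up (C x) a \<in> bivectors"
proof -
  have "transpose (\<chi> m n. a m n) = - (\<chi> m n. a m n)"
    unfolding transpose_def vec_eq_iff vec_lambda_beta vector_uminus_component by (intro allI assms)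
  then show ?thesis
    by (simp add: bivectors_def up_def matrix_transpose_mul matrix_ring_simps)
qed

lemma dual_proj_up:
  assumes x: "x \<in> U" and a: "\<And>m n. a m n = - a n m"
  shows "dual_proj s (G x) (up (C x) a) = (\<Sum>\<alpha>\<in>UNIV. (1/4 * sd_comp s a \<alpha>) *\<^sub>R up (C x) (sd s \<alpha>))"
proof -
  have e: "1/2 * (a c d + s * (1/2 * (\<Sum>m\<in>UNIV. \<Sum>n\<in>UNIV. eps4 m n c d * a m n)))
      = (\<Sum>\<alpha>\<in>UNIV. (1/4 * sd_comp s a \<alpha>) * sd s \<alpha> c d)" for c d
    unfolding eps4_contract[where a = a and c = c and d = d, OF a sign]
    by (simp only: sum_distrib_left mult.assoc)
  have "dual_proj s (G x) (up (C x) a) =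
      up (C x) (\<lambda>c d. 1/2 * (a c d + s * (1/2 * (\<Sum>m\<in>UNIV. \<Sum>n\<in>UNIV. eps4 m n c d * a m n))))"
    unfolding dual_proj_def hodge_star_def tensor_op_up[OF x] fr4_volume_form[OF x] up_linear ..
  also have "\<dots> = up (C x) (\<lambda>c d. \<Sum>\<alpha>\<in>UNIV. (1/4 * sd_comp s a \<alpha>) * sd s \<alpha> c d)"
    unfolding e ..
  finally show ?thesis unfolding up_linear .
qed

lemma up_H:
  assumes x: "x \<in> U"
  shows "up (C x) (\<lambda>c d. (H x ** \<alpha> ** transpose (H x)) $ c $ d) = \<alpha>"
proof -
  have t: "transpose (H x) ** transpose (C x) = mat 1"
    using CH[OF x] matrix_transpose_mul[of "C x" "H x"] by simp
  have "up (C x) (\<lambda>c d. (H x ** \<alpha> ** transpose (H x)) $ c $ d) = C x ** H x ** \<alpha> ** (transpose (H x) ** transpose (C x))"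
    by (simp add: up_def vec_lambda_eta matrix_mul_assoc)
  then show ?thesis by (simp add: t CH[OF x])
qed

lemma dual_proj_wedge:
  assumes x: "x \<in> U"
  shows "dual_proj s (G x) (wedge (axis i 1) (axis j 1)) = (\<Sum>\<alpha>\<in>UNIV. (1/2 * w \<alpha> x $ i $ j) *\<^sub>R up (C x) (sd s \<alpha>))"
proof -
  define a where "a c d = H x $ c $ i * H x $ d $ j - H x $ c $ j * H x $ d $ i" for c d
  have ax: "axis i 1 $ a = (kd i a :: real)" for i a :: 4
    by (simp add: axis_def kd_def)
  have "(H x ** wedge (axis i 1) (axis j 1) ** transpose (H x)) $ c $ d = a c d" for c d
  proof -
    have "(H x ** wedge (axis i 1) (axis j 1) ** transpose (H x)) $ c $ d =
      (\<Sum>l\<in>UNIV. (\<Sum>k\<in>UNIV. H x $ c $ k * (kd i k * kd j l - kd i l * kd j k)) * H x $ d $ l)"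
      by (simp add: matrix_matrix_mult_def wedge_def transpose_def ax)
    also have "\<dots> = (\<Sum>l\<in>UNIV. kd j l * ((\<Sum>k\<in>UNIV. kd i k * H x $ c $ k) * H x $ d $ l)
      - kd i l * ((\<Sum>k\<in>UNIV. kd j k * H x $ c $ k) * H x $ d $ l))"
      by (simp only: right_diff_distrib left_diff_distrib sum_subtractf sum_distrib_left sum_distrib_right mult_ac)
    finally show ?thesis by (simp add: a_def sum_subtractf)
  qed
  then have u: "wedge (axis i 1) (axis j 1) = up (C x) a"
    using up_H[OF x, of "wedge (axis i 1) (axis j 1)"] by simp
  have "sd_comp s a \<alpha> = w \<alpha> x $ i $ j - w \<alpha> x $ j $ i" for \<alpha>
    unfolding sd_comp_def a_def w_nth by (simp add: right_diff_distrib sum_subtractf)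
  then have "sd_comp s a \<alpha> = 2 * w \<alpha> x $ i $ j" for \<alpha>
    using w_skew[of \<alpha> x j i] by simp
  then show ?thesis
    unfolding u by (subst dual_proj_up[OF x]) (simp_all add: a_def)
qed

lemma tensor_form_up:
  "tensor_form T (up E a) (up E b) = 1/4 * (\<Sum>m\<in>UNIV. \<Sum>n\<in>UNIV. \<Sum>c\<in>UNIV. \<Sum>d\<in>UNIV. fr4 E T m n c d * a m n * b c d)"
proof -
  have "tensor_form T (up E a) (up E b) = 1/4 * (\<Sum>i\<in>UNIV. \<Sum>j\<in>UNIV.
      (\<Sum>k\<in>UNIV. \<Sum>l\<in>UNIV. T i j k l * up E b $ k $ l) * up E a $ i $ j)"
    by (simp add: tensor_form_def sum_distrib_left mult_ac)
  also have "\<dots> = 1/4 * (\<Sum>m\<in>UNIV. \<Sum>n\<in>UNIV. (\<Sum>c\<in>UNIV. \<Sum>d\<in>UNIV. fr4 E T m n c d * b c d) * a m n)"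
    unfolding pair_up fr2_sum fr2_linear fr4_def ..
  finally show ?thesis by (simp add: sum_distrib_left mult_ac)
qed

lemma tensor_form_sum:
  "tensor_form T (\<Sum>\<alpha>\<in>UNIV. p \<alpha> *\<^sub>R u \<alpha>) (\<Sum>\<beta>\<in>UNIV. q \<beta> *\<^sub>R u \<beta>)
     = (\<Sum>\<alpha>\<in>UNIV. \<Sum>\<beta>\<in>UNIV. p \<alpha> * q \<beta> * tensor_form T (u \<alpha>) (u (\<beta>::3)))"
  by (simp add: tensor_form_def sum_3 sum.distrib sum_distrib_left algebra_simps)

text \<open>The factor 1/2 is 1/2 * 1/2 * 2: one half from each projected coordinate bivector, and 2
  because the value of W on \<open>sd s \<alpha>\<close> and \<open>sd s \<beta>\<close> is twice
  the normalised entry of A.\<close>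

lemma weyl_dual_eq:
  assumes x: "x \<in> U"
  shows "weyl_dual s G x i j k l = (\<Sum>\<alpha>\<in>UNIV. \<Sum>\<beta>\<in>UNIV. 1/2 * A x $ \<alpha> $ \<beta> * (w \<alpha> x $ i $ j * w \<beta> x $ k $ l))"
proof -
  have "tensor_form (weyl G x) (up (C x) (sd s \<alpha>)) (up (C x) (sd s \<beta>)) = 2 * A x $ \<alpha> $ \<beta>" for \<alpha> \<beta>
    unfolding tensor_form_up A_def sd_block_def sd_comp_def
    by (simp add: sum_distrib_left mult_ac)
  then show ?thesis
    unfolding weyl_dual_def dual_proj_wedge[OF x] tensor_form_sum
    by (intro sum.cong refl) simp
qed

end

section \<open>Norm, covariant derivative and determinant of the half Weyl tensor\<close>

lemma fr4_sum: "fr4 C (\<lambda>i j k l. \<Sum>r\<in>K. T r i j k l) a b c d = (\<Sum>r\<in>K. fr4 C (T r) a b c d)"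
  by (simp add: fr4_def fr2_sum)

lemma sum_permute8:
  fixes f :: "'i::finite \<Rightarrow> 'i \<Rightarrow> 'i \<Rightarrow> 'i \<Rightarrow> 'i \<Rightarrow> 'i \<Rightarrow> 'i \<Rightarrow> 'i \<Rightarrow> real"
  shows "(\<Sum>i\<in>UNIV. \<Sum>j\<in>UNIV. \<Sum>k\<in>UNIV. \<Sum>l\<in>UNIV. \<Sum>p\<in>UNIV. \<Sum>q\<in>UNIV. \<Sum>r\<in>UNIV. \<Sum>t\<in>UNIV. f i j k l p q r t)
    = (\<Sum>p\<in>UNIV. \<Sum>q\<in>UNIV. \<Sum>r\<in>UNIV. \<Sum>t\<in>UNIV. \<Sum>i\<in>UNIV. \<Sum>j\<in>UNIV. \<Sum>k\<in>UNIV. \<Sum>l\<in>UNIV. f i j k l p q r t)"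
  unfolding sum.cartesian_product UNIV_Times_UNIV
  by (rule sum.reindex_bij_witness[of _ "\<lambda>(p,q,r,t,i,j,k,l). (i,j,k,l,p,q,r,t)" "\<lambda>(i,j,k,l,p,q,r,t). (p,q,r,t,i,j,k,l)"]; auto)

lemma sd_inner2:
  assumes s: "s * s = 1"
  shows "(\<Sum>a\<in>UNIV. \<Sum>b\<in>UNIV. (\<Sum>\<alpha>\<in>UNIV. p \<alpha> * sd s \<alpha> a b) * (\<Sum>\<alpha>\<in>UNIV. q \<alpha> * sd s \<alpha> a b))
    = 4 * (\<Sum>\<alpha>\<in>UNIV. p \<alpha> * q \<alpha>)"
proof -
  have s2: "s * (s * x) = x" for x using s by (simp add: mult.assoc[symmetric])
  show ?thesis unfolding sum_3 sum_4 sd_table by (simp add: s2 algebra_simps)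
qed

text \<open>The basis is orthogonal in each index pair separately, and the constants balance: 1/4 *
  (1/2)^2 * 4 * 4 = 1.\<close>

lemma sd_inner:
  assumes s: "s * s = 1"
  shows "1/4 * (\<Sum>a\<in>UNIV. \<Sum>b\<in>UNIV. \<Sum>c\<in>UNIV. \<Sum>d\<in>UNIV.
      (\<Sum>\<alpha>\<in>UNIV. \<Sum>\<beta>\<in>UNIV. 1/2 * X $ \<alpha> $ \<beta> * (sd s \<alpha> a b * sd s \<beta> c d)) *
      (\<Sum>\<alpha>\<in>UNIV. \<Sum>\<beta>\<in>UNIV. 1/2 * Y $ \<alpha> $ \<beta> * (sd s \<alpha> a b * sd s \<beta> c d))) = mdot X Y"
proof -
  define p where "p X a b \<beta> = (\<Sum>\<alpha>\<in>UNIV. X $ \<alpha> $ \<beta> * sd s \<alpha> a b)" for X :: "real^3^3" and a b \<beta>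
  have e: "(\<Sum>\<alpha>\<in>UNIV. \<Sum>\<beta>\<in>UNIV. 1/2 * X $ \<alpha> $ \<beta> * (sd s \<alpha> a b * sd s \<beta> c d))
      = 1/2 * (\<Sum>\<beta>\<in>UNIV. p X a b \<beta> * sd s \<beta> c d)" for X a b c d
    unfolding p_def by (subst sum.swap) (simp add: sum_distrib_left sum_distrib_right mult_ac)
  have q: "(1/2 * y) * (1/2 * z) = 1/4 * (y * z)" for y z :: real by simp
  have "1/4 * (\<Sum>a\<in>UNIV. \<Sum>b\<in>UNIV. \<Sum>c\<in>UNIV. \<Sum>d\<in>UNIV.
      (1/2 * (\<Sum>\<beta>\<in>UNIV. p X a b \<beta> * sd s \<beta> c d)) * (1/2 * (\<Sum>\<beta>\<in>UNIV. p Y a b \<beta> * sd s \<beta> c d)))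
    = 1/16 * (\<Sum>a\<in>UNIV. \<Sum>b\<in>UNIV. \<Sum>c\<in>UNIV. \<Sum>d\<in>UNIV.
      (\<Sum>\<beta>\<in>UNIV. p X a b \<beta> * sd s \<beta> c d) * (\<Sum>\<beta>\<in>UNIV. p Y a b \<beta> * sd s \<beta> c d))"
    unfolding q sum_distrib_left[symmetric] by simp
  also have "\<dots> = 1/4 * (\<Sum>a\<in>UNIV. \<Sum>b\<in>UNIV. \<Sum>\<beta>\<in>UNIV. p X a b \<beta> * p Y a b \<beta>)"
    unfolding sd_inner2[OF s] sum_distrib_left[symmetric] by simp
  also have "(\<Sum>a\<in>UNIV. \<Sum>b\<in>UNIV. \<Sum>\<beta>\<in>UNIV. p X a b \<beta> * p Y a b \<beta>)
      = (\<Sum>\<beta>\<in>UNIV. \<Sum>a\<in>UNIV. \<Sum>b\<in>UNIV. p X a b \<beta> * p Y a b \<beta>)"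
    by (simp add: sum_3 sum.distrib)
  also have "\<dots> = (\<Sum>\<beta>\<in>UNIV. 4 * (\<Sum>\<alpha>\<in>UNIV. X $ \<alpha> $ \<beta> * Y $ \<alpha> $ \<beta>))"
    unfolding p_def sd_inner2[OF s] ..
  also have "1/4 * \<dots> = mdot X Y"
    unfolding mdot_def by (subst sum.swap) (simp add: sum_distrib_left)
  finally show ?thesis unfolding e .
qed

text \<open>What has to be shown for \<open>THE\<close> is independence of the basis. The matrix P
  expressing b' through b is invertible and satisfies P B' = B P, so both determinants
  agree.\<close>

lemma endo_det3_eqI:
  fixes b :: "3 \<Rightarrow> 'v::real_vector" and B :: "real^3^3"
  assumes b: "inj b" "independent (range b)" "span (range b) = V"
    and B: "\<And>j. T (b j) = (\<Sum>i\<in>UNIV. B $ i $ j *\<^sub>R b i)"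
    and T: "\<And>u v. u \<in> V \<Longrightarrow> v \<in> V \<Longrightarrow> T (u + v) = T u + T v"
      "\<And>r v. v \<in> V \<Longrightarrow> T (r *\<^sub>R v) = r *\<^sub>R T v"
  shows "endo_det3 V T = det B"
proof -
  have indep: "c = d" if "(\<Sum>i\<in>UNIV. c i *\<^sub>R b i) = (\<Sum>i\<in>UNIV. d i *\<^sub>R b i)" "inj b" "independent (range b)"
    for b :: "3 \<Rightarrow> 'v" and c d :: "3 \<Rightarrow> real"
  proof -
    have "(\<Sum>i\<in>UNIV. (c i - d i) *\<^sub>R b i) = 0" using that(1) by (simp add: scaleR_left_diff_distrib sum_subtractf)
    then have "(\<Sum>v\<in>range b. (c (inv b v) - d (inv b v)) *\<^sub>R v) = 0"
      by (subst sum.reindex[OF that(2)]) (simp add: that(2))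
    then have "c (inv b v) - d (inv b v) = 0" if "v \<in> range b" for v
      using independentD[OF \<open>independent (range b)\<close> finite_imageI[OF finite] subset_refl, of "\<lambda>v. c (inv b v) - d (inv b v)" v] that
      by simp
    from this[of "b _"] show ?thesis using that(2) by (simp add: fun_eq_iff)
  qed
  have expand: "\<exists>c. v = (\<Sum>i\<in>UNIV. c i *\<^sub>R b i)" if v: "v \<in> span (range b)" and "inj b" for b :: "3 \<Rightarrow> 'v" and v
  proof -
    obtain u where "v = (\<Sum>w\<in>range b. u w *\<^sub>R w)"
      using v unfolding span_finite[OF finite_imageI[OF finite]] by auto
    then have "v = (\<Sum>i\<in>UNIV. u (b i) *\<^sub>R b i)"
      by (simp add: sum.reindex[OF that(2)])
    then show ?thesis by (intro exI[of _ "\<lambda>i. u (b i)"])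
  qed
  have uniq: "det B' = det B"
    if b': "inj b'" "independent (range b')" "span (range b') = V"
      and B': "\<And>j. T (b' j) = (\<Sum>i\<in>UNIV. B' $ i $ j *\<^sub>R b' i)" for b' :: "3 \<Rightarrow> 'v" and B' :: "real^3^3"
  proof -
    have V: "b j \<in> V" "b' j \<in> V" for j
      using span_base[of "b j" "range b"] span_base[of "b' j" "range b'"] b(3) b'(3) by auto
    have sub: "subspace V" using b(3) subspace_span by blast
    have Tsum: "T (\<Sum>i\<in>I. c i *\<^sub>R u i) = (\<Sum>i\<in>I. c i *\<^sub>R T (u i))"
      if "\<And>i. u i \<in> V" for c :: "3 \<Rightarrow> real" and u and I :: "3 set"
    proof (induction I rule: infinite_finite_induct)
      case (insert i I)
      have "(\<Sum>i\<in>I. c i *\<^sub>R u i) \<in> V"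
        using sub that by (intro subspace_sum[OF sub] subspace_scale[OF sub]) auto
      then show ?case using insert that T subspace_scale[OF sub] by simp
    next
      case empty
      show ?case using T(2)[of 0 0] subspace_0[OF sub] by simp
    qed simp
    have "\<exists>c. b' j = (\<Sum>i\<in>UNIV. c i *\<^sub>R b i)" for j
      using expand[of "b' j" b] V b by simp
    then obtain p where p: "\<And>j. b' j = (\<Sum>i\<in>UNIV. p j i *\<^sub>R b i)" by metis
    have "\<exists>c. b j = (\<Sum>i\<in>UNIV. c i *\<^sub>R b' i)" for j
      using expand[of "b j" b'] V b' by simp
    then obtain q where q: "\<And>j. b j = (\<Sum>i\<in>UNIV. q j i *\<^sub>R b' i)" by metis
    define P where "P = (\<chi> i j. p j i)"
    define Q where "Q = (\<chi> i j. q j i)"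
    have comb: "(\<Sum>i\<in>UNIV. c i *\<^sub>R (\<Sum>k\<in>UNIV. M i k *\<^sub>R u k)) = (\<Sum>k\<in>UNIV. (\<Sum>i\<in>UNIV. c i * M i k) *\<^sub>R u k)"
      for c :: "3 \<Rightarrow> real" and M :: "3 \<Rightarrow> 3 \<Rightarrow> real" and u :: "3 \<Rightarrow> 'v"
      by (simp add: scaleR_sum_right scaleR_sum_left) (rule sum.swap)
    have "b j = (\<Sum>k\<in>UNIV. (\<Sum>i\<in>UNIV. q j i * p i k) *\<^sub>R b k)" for j
      using q[of j] unfolding p comb .
    moreover have "(\<Sum>k\<in>UNIV. kd j k *\<^sub>R b k) = b j" for j
      by (simp add: kd_def if_distrib[where f = "\<lambda>r. r *\<^sub>R _"] cong: if_cong)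
    ultimately have "(\<Sum>k\<in>UNIV. (\<Sum>i\<in>UNIV. q j i * p i k) *\<^sub>R b k) = (\<Sum>k\<in>UNIV. kd j k *\<^sub>R b k)" for j
      by (rule trans[OF sym sym])
    from fun_cong[OF indep[OF this b(1,2)]] have "(\<Sum>i\<in>UNIV. q j i * p i k) = kd j k" for j k .
    then have "(P ** Q) $ i $ j = kd i j" for i j
      by (subst kd_sym) (simp add: P_def Q_def matrix_matrix_mult_def mult.commute)
    then have PQ: "P ** Q = mat 1"
      by (simp add: mat_def vec_eq_iff kd_def)
    have "(\<Sum>k\<in>UNIV. (\<Sum>i\<in>UNIV. B' $ i $ j * p i k) *\<^sub>R b k) = (\<Sum>k\<in>UNIV. (\<Sum>i\<in>UNIV. p j i * B $ k $ i) *\<^sub>R b k)" for j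
    proof -
      have "T (b' j) = (\<Sum>k\<in>UNIV. (\<Sum>i\<in>UNIV. B' $ i $ j * p i k) *\<^sub>R b k)"
        unfolding B' unfolding p comb ..
      moreover have "T (b' j) = (\<Sum>k\<in>UNIV. (\<Sum>i\<in>UNIV. p j i * B $ k $ i) *\<^sub>R b k)"
        unfolding p[of j] Tsum[of b, OF V(1)] B comb ..
      ultimately show ?thesis by simp
    qed
    from fun_cong[OF indep[OF this b(1,2)]]
    have "(\<Sum>i\<in>UNIV. B' $ i $ j * p i k) = (\<Sum>i\<in>UNIV. p j i * B $ k $ i)" for j k .
    then have "P ** B' = B ** P"
      by (simp add: P_def matrix_matrix_mult_def vec_eq_iff mult.commute)
    then have "det P * det B' = det B * det P" by (metis det_mul)
    moreover have "det P \<noteq> 0"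
      using PQ det_mul[of P Q] by (auto simp: det_I)
    ultimately show ?thesis by simp
  qed
  show ?thesis
    unfolding endo_det3_def
  proof (rule the_equality)
    show "\<exists>b (Ba::real^3^3). inj b \<and> independent (range b) \<and> span (range b) = V \<and>
        (\<forall>j. T (b j) = (\<Sum>i\<in>UNIV. Ba $ i $ j *\<^sub>R b i)) \<and> det B = det Ba"
      by (intro exI[of _ b] exI[of _ B] conjI allI refl b B)
  next
    fix d
    assume "\<exists>b (Ba::real^3^3). inj b \<and> independent (range b) \<and> span (range b) = V \<and>
        (\<forall>j. T (b j) = (\<Sum>i\<in>UNIV. Ba $ i $ j *\<^sub>R b i)) \<and> d = det Ba"
    then show "d = det B"
    proof (elim exE conjE)
      fix b' :: "3 \<Rightarrow> 'v" and B' :: "real^3^3"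
      assume "inj b'" "independent (range b')" "span (range b') = V"
        and "\<forall>j. T (b' j) = (\<Sum>i\<in>UNIV. B' $ i $ j *\<^sub>R b' i)" and d: "d = det B'"
      then show "d = det B" unfolding d by (intro uniq) blast+
    qed
  qed
qed

context oriented_frame
begin

lemma ginv_swap: "x \<in> U \<Longrightarrow> ginv (G x) i j = ginv (G x) j i"
  by (simp add: ginv_eq mult.commute)

lemma tensor_inner_frame:
  assumes x: "x \<in> U"
  shows "tensor_inner (G x) S T = 1/4 * (\<Sum>a\<in>UNIV. \<Sum>b\<in>UNIV. \<Sum>c\<in>UNIV. \<Sum>d\<in>UNIV.
    fr4 (C x) S a b c d * fr4 (C x) T a b c d)"
proof -
  have raise: "(\<Sum>a\<in>UNIV. \<Sum>b\<in>UNIV. \<Sum>c\<in>UNIV. \<Sum>d\<in>UNIV.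
        ginv (G x) i a * ginv (G x) j b * ginv (G x) k c * ginv (G x) l d * T a b c d)
    = (\<Sum>p\<in>UNIV. \<Sum>q\<in>UNIV. \<Sum>r\<in>UNIV. \<Sum>t\<in>UNIV. fr4 (C x) T p q r t *
        (C x $ i $ p * C x $ j $ q * C x $ k $ r * C x $ l $ t))" for i j k l
  proof -
    have "(\<Sum>a\<in>UNIV. \<Sum>b\<in>UNIV. \<Sum>c\<in>UNIV. \<Sum>d\<in>UNIV.
        ginv (G x) i a * ginv (G x) j b * ginv (G x) k c * ginv (G x) l d * T a b c d)
      = (\<Sum>a\<in>UNIV. \<Sum>b\<in>UNIV. (\<Sum>c\<in>UNIV. \<Sum>d\<in>UNIV. T a b c d * ginv (G x) c k * ginv (G x) d l)
          * ginv (G x) a i * ginv (G x) b j)"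
      unfolding ginv_swap[OF x, of i] ginv_swap[OF x, of j] ginv_swap[OF x, of k] ginv_swap[OF x, of l]
        sum_distrib_right by (simp only: mult_ac)
    also have "\<dots> = (\<Sum>p\<in>UNIV. \<Sum>q\<in>UNIV. (\<Sum>r\<in>UNIV. \<Sum>t\<in>UNIV. fr4 (C x) T p q r t * C x $ k $ r * C x $ l $ t)
        * C x $ i $ p * C x $ j $ q)"
      unfolding raise_indices[OF x] fr2_sum fr2_linear fr4_def ..
    finally show ?thesis unfolding sum_distrib_right by (simp only: mult_ac)
  qed
  have "tensor_inner (G x) S T = 1/4 * (\<Sum>i\<in>UNIV. \<Sum>j\<in>UNIV. \<Sum>k\<in>UNIV. \<Sum>l\<in>UNIV.
      \<Sum>p\<in>UNIV. \<Sum>q\<in>UNIV. \<Sum>r\<in>UNIV. \<Sum>t\<in>UNIV. S i j k l * (fr4 (C x) T p q r t *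
        (C x $ i $ p * C x $ j $ q * C x $ k $ r * C x $ l $ t)))"
    unfolding tensor_inner_def raise sum_distrib_left ..
  also have "\<dots> = 1/4 * (\<Sum>p\<in>UNIV. \<Sum>q\<in>UNIV. \<Sum>r\<in>UNIV. \<Sum>t\<in>UNIV. \<Sum>i\<in>UNIV. \<Sum>j\<in>UNIV. \<Sum>k\<in>UNIV. \<Sum>l\<in>UNIV.
      S i j k l * (fr4 (C x) T p q r t * (C x $ i $ p * C x $ j $ q * C x $ k $ r * C x $ l $ t)))"
    by (subst sum_permute8) (rule refl)
  also have "\<dots> = 1/4 * (\<Sum>p\<in>UNIV. \<Sum>q\<in>UNIV. \<Sum>r\<in>UNIV. \<Sum>t\<in>UNIV. fr4 (C x) S p q r t * fr4 (C x) T p q r t)"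
    unfolding fr4_expand[of _ S] sum_distrib_right by (simp only: mult_ac)
  finally show ?thesis .
qed

definition ww :: "real^3^3 \<Rightarrow> real^4 \<Rightarrow> tensor4" where
  "ww X x i j k l = (\<Sum>\<alpha>\<in>UNIV. \<Sum>\<beta>\<in>UNIV. 1/2 * X $ \<alpha> $ \<beta> * (w \<alpha> x $ i $ j * w \<beta> x $ k $ l))"

lemma fr4_ww:
  assumes x: "x \<in> U"
  shows "fr4 (C x) (ww X x) a b c d = (\<Sum>\<alpha>\<in>UNIV. \<Sum>\<beta>\<in>UNIV. 1/2 * X $ \<alpha> $ \<beta> * (sd s \<alpha> a b * sd s \<beta> c d))"
  unfolding ww_def[abs_def] fr4_sum fr4_linear
    fr4_products(1)[of _ "\<lambda>i j. w \<alpha> x $ i $ j" "\<lambda>k l. w \<beta> x $ k $ l" for \<alpha> \<beta>] fr2_w[OF x] ..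

lemma weyl_dual_ww: "x \<in> U \<Longrightarrow> weyl_dual s G x = ww (A x) x"
  by (simp add: fun_eq_iff weyl_dual_eq ww_def)

lemma tensor_inner_ww: "x \<in> U \<Longrightarrow> tensor_inner (G x) (ww X x) (ww Y x) = mdot X Y"
  unfolding tensor_inner_frame fr4_ww by (rule sd_inner[OF sign])

lemma tensor_norm2_weyl_dual: "x \<in> U \<Longrightarrow> tensor_norm2 G (weyl_dual s G) x = mdot (A x) (A x)"
  by (simp add: tensor_norm2_def weyl_dual_ww tensor_inner_ww)

text \<open>The Christoffel terms of \<open>cov_deriv\<close> cancel those in the derivatives of the
  forms w. What remains is \<open>\<Theta>\<close> acting on both indices of A, and as
  \<open>\<Theta>\<close> is skew this is the commutator in \<open>ad_deriv\<close>.\<close>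

lemma cov_deriv_weyl_dual:
  assumes x: "x \<in> U"
  shows "cov_deriv G (weyl_dual s G) x p = ww (ad_deriv \<Theta> p A x) x"
proof (intro ext)
  fix i j k l
  have d: "(\<lambda>y. A y $ \<alpha> $ \<beta>) differentiable (at x)" "(\<lambda>y. w \<alpha> y $ i $ j) differentiable (at x)"
    "(\<lambda>y. w \<alpha> y $ i $ j * w \<beta> y $ k $ l) differentiable (at x)"
    "(\<lambda>y. 1/2 * A y $ \<alpha> $ \<beta>) differentiable (at x)"
    "(\<lambda>y. 1/2 * A y $ \<alpha> $ \<beta> * (w \<alpha> y $ i $ j * w \<beta> y $ k $ l)) differentiable (at x)"
    "(\<lambda>y. \<Sum>\<beta>\<in>UNIV. 1/2 * A y $ \<alpha> $ \<beta> * (w \<alpha> y $ i $ j * w \<beta> y $ k $ l)) differentiable (at x)" for \<alpha> \<beta> i j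
    by (intro smooth_on_differentiable[OF _ x] smooth_intros open_U msmooth_on_nth[OF A_smooth]
        msmooth_on_nth[OF w_smooth])+
  have "pd p (\<lambda>y. weyl_dual s G y i j k l) x = pd p (\<lambda>y. ww (A y) y i j k l) x"
    by (rule pd_cong_open[OF open_U x]) (simp add: weyl_dual_ww)
  also have "\<dots> = (\<Sum>\<alpha>\<in>UNIV. \<Sum>\<beta>\<in>UNIV. 1/2 * mpd p A x $ \<alpha> $ \<beta> * (w \<alpha> x $ i $ j * w \<beta> x $ k $ l)
      + 1/2 * A x $ \<alpha> $ \<beta> * (pd p (\<lambda>y. w \<alpha> y $ i $ j) x * w \<beta> x $ k $ l + w \<alpha> x $ i $ j * pd p (\<lambda>y. w \<beta> y $ k $ l) x))"
    unfolding ww_def pd_sum[OF d(6)] pd_sum[OF d(5)] pd_mult[OF d(4,3)] pd_mult[OF d(2,2)] pd_cmult[OF d(1)]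
    by (simp add: mpd_def)
  finally have 1: "pd p (\<lambda>y. weyl_dual s G y i j k l) x = \<dots>" .
  define g where "g \<alpha> i j = (\<Sum>m\<in>UNIV. christoffel G x m p i * w \<alpha> x $ m $ j)" for \<alpha> i j
  define g' where "g' \<alpha> i j = (\<Sum>m\<in>UNIV. w \<alpha> x $ i $ m * christoffel G x m p j)" for \<alpha> i j
  have w: "pd p (\<lambda>y. w \<alpha> y $ i $ j) x = g \<alpha> i j + g' \<alpha> i j + (\<Sum>\<gamma>\<in>UNIV. \<Theta> p x $ \<gamma> $ \<alpha> * w \<gamma> x $ i $ j)" for \<alpha> i j
    unfolding mpd_w_nth[OF x] g_def g'_def ..
  have 2: "(\<Sum>m\<in>UNIV. christoffel G x m p i * ww X x m j k l + christoffel G x m p j * ww X x i m k l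
      + christoffel G x m p k * ww X x i j m l + christoffel G x m p l * ww X x i j k m)
    = (\<Sum>\<alpha>\<in>UNIV. \<Sum>\<beta>\<in>UNIV. 1/2 * X $ \<alpha> $ \<beta> * ((g \<alpha> i j + g' \<alpha> i j) * w \<beta> x $ k $ l
        + w \<alpha> x $ i $ j * (g \<beta> k l + g' \<beta> k l)))" for X
    unfolding ww_def g_def g'_def by (simp add: sum_3 sum_4 algebra_simps)
  have z: "\<Theta> p x $ 1 $ 1 = 0" "\<Theta> p x $ 2 $ 2 = 0" "\<Theta> p x $ 3 $ 3 = 0" "\<Theta> p x $ 2 $ 1 = - \<Theta> p x $ 1 $ 2"
    "\<Theta> p x $ 3 $ 1 = - \<Theta> p x $ 1 $ 3" "\<Theta> p x $ 3 $ 2 = - \<Theta> p x $ 2 $ 3"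
    using \<Theta>_skew[of p x 1 1] \<Theta>_skew[of p x 2 2] \<Theta>_skew[of p x 3 3]
      \<Theta>_skew[of p x 2 1] \<Theta>_skew[of p x 3 1] \<Theta>_skew[of p x 3 2] by auto
  show "cov_deriv G (weyl_dual s G) x p i j k l = ww (ad_deriv \<Theta> p A x) x i j k l"
    unfolding cov_deriv_def 1 w weyl_dual_ww[OF x] 2
    unfolding ww_def ad_deriv_def mcomm_def
    by (simp add: matrix_matrix_mult_def sum_3 z algebra_simps)
qed

text \<open>The bivectors \<open>sd s\<close> are orthogonal and of equal length, so the operator
  has the same matrix A in this basis as in the normalised one.\<close>

lemma det_weyl_dual_eq:
  assumes x: "x \<in> U"
  shows "det_weyl_dual s G x = det (A x)"
  unfolding det_weyl_dual_def
proof (rule endo_det3_eqI[where b = "\<lambda>\<alpha>. up (C x) (sd s \<alpha>)"])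
  let ?u = "\<lambda>\<alpha>. up (C x) (sd s \<alpha>)"
  have f: "sd_comp s (\<lambda>m n. \<Sum>\<alpha>\<in>UNIV. c \<alpha> * sd s \<alpha> m n) \<beta> = 4 * c \<beta>" for c \<beta>
    unfolding sd_comp_sum sd_comp_cmult unfolding sd_comp_def sd_orthogonal[OF sign]
    by (simp add: mult.left_commute[of _ 4] sum_distrib_left[symmetric] kd_sym[of \<beta>])
  have up_sum: "(\<Sum>\<alpha>\<in>UNIV. c \<alpha> *\<^sub>R ?u \<alpha>) = up (C x) (\<lambda>m n. \<Sum>\<alpha>\<in>UNIV. c \<alpha> * sd s \<alpha> m n)" for c
    unfolding up_linear ..
  have up0: "a = b" if "up (C x) a = up (C x) b" for a b
  proof -
    have t: "transpose (C x) ** transpose (H x) = mat 1"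
      using HC[OF x] matrix_transpose_mul[of "H x" "C x"] by simp
    have "H x ** up (C x) a ** transpose (H x) = (\<chi> m n. a m n)" for a
    proof -
      have "H x ** up (C x) a ** transpose (H x) = (H x ** C x) ** (\<chi> m n. a m n) ** (transpose (C x) ** transpose (H x))"
        by (simp add: up_def matrix_mul_assoc)
      then show ?thesis by (simp add: t HC[OF x])
    qed
    then have "(\<chi> m n. a m n) = (\<chi> m n. b m n)" using that by metis
    then show ?thesis by (simp add: vec_eq_iff fun_eq_iff)
  qed
  have indep: "c = d" if "(\<Sum>\<alpha>\<in>UNIV. c \<alpha> *\<^sub>R ?u \<alpha>) = (\<Sum>\<alpha>\<in>UNIV. d \<alpha> *\<^sub>R ?u \<alpha>)" for c d
  proof
    fix \<beta>
    from up0[OF that[unfolded up_sum]]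
    show "c \<beta> = d \<beta>" using f[of c \<beta>] f[of d \<beta>] by simp
  qed
  show inj: "inj ?u"
  proof (rule injI)
    fix \<alpha> \<beta> assume "?u \<alpha> = ?u \<beta>"
    then have "(\<Sum>\<gamma>\<in>UNIV. kd \<alpha> \<gamma> *\<^sub>R ?u \<gamma>) = (\<Sum>\<gamma>\<in>UNIV. kd \<beta> \<gamma> *\<^sub>R ?u \<gamma>)"
      by (simp add: kd_def if_distrib[where f = "\<lambda>r. r *\<^sub>R _"] cong: if_cong)
    from fun_cong[OF indep[OF this], of \<alpha>] show "\<alpha> = \<beta>" by (simp add: kd_def split: if_splits)
  qed
  show "independent (range ?u)"
  proof (rule independent_if_scalars_zero)
    fix f v assume s0: "(\<Sum>v\<in>range ?u. f v *\<^sub>R v) = 0" and v: "v \<in> range ?u"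
    have "(\<Sum>\<alpha>\<in>UNIV. f (?u \<alpha>) *\<^sub>R ?u \<alpha>) = (\<Sum>\<alpha>\<in>UNIV. 0 *\<^sub>R ?u \<alpha>)"
      using s0 by (simp add: sum.reindex[OF inj])
    from indep[OF this] v show "f v = 0" by (auto dest: fun_cong)
  qed simp
  have lin: "tensor_op h T (\<alpha> + \<beta>) = tensor_op h T \<alpha> + tensor_op h T \<beta>" "tensor_op h T (r *\<^sub>R \<alpha>) = r *\<^sub>R tensor_op h T \<alpha>"
    for h T \<alpha> \<beta> r
    by (simp_all add: vec_eq_iff tensor_op_def sum.distrib sum_distrib_left algebra_simps)
  show "tensor_op (G x) (weyl_dual s G x) (u + v) = tensor_op (G x) (weyl_dual s G x) u + tensor_op (G x) (weyl_dual s G x) v"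
    "tensor_op (G x) (weyl_dual s G x) (r *\<^sub>R v) = r *\<^sub>R tensor_op (G x) (weyl_dual s G x) v" for u v r
    by (rule lin)+
  show "tensor_op (G x) (weyl_dual s G x) (?u j) = (\<Sum>i\<in>UNIV. A x $ i $ j *\<^sub>R ?u i)" for j
  proof -
    have s2: "s * (s * x) = x" for x using sign by (simp add: mult.assoc[symmetric])
    have A: "A x $ 2 $ 1 = A x $ 1 $ 2" "A x $ 3 $ 1 = A x $ 1 $ 3" "A x $ 3 $ 2 = A x $ 2 $ 3"
      by (rule A_sym[OF x])+
    have "1/2 * (\<Sum>m\<in>UNIV. \<Sum>n\<in>UNIV. fr4 (C x) (ww (A x) x) m n c d * sd s j m n) = (\<Sum>i\<in>UNIV. A x $ i $ j * sd s i c d)" for c d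
    proof -
      have "\<forall>j. 1/2 * (\<Sum>m\<in>UNIV. \<Sum>n\<in>UNIV. fr4 (C x) (ww (A x) x) m n c d * sd s j m n) = (\<Sum>i\<in>UNIV. A x $ i $ j * sd s i c d)"
        unfolding fr4_ww[OF x] forall_3 sum_3
        unfolding sum_4 sd_table by (simp add: A s2 algebra_simps)
      then show ?thesis by blast
    qed
    then show ?thesis
      unfolding weyl_dual_ww[OF x] tensor_op_up[OF x] up_sum by simp
  qed
  show "span (range ?u) = dual_space s (G x)"
  proof
    have t: "transpose (M + N) = transpose M + transpose N" "transpose (r *\<^sub>R M) = r *\<^sub>R transpose M"
      "transpose 0 = (0 :: real^4^4)" for M N :: "real^4^4" and r
      by (simp_all add: transpose_def vec_eq_iff)
    have z: "tensor_op (G x) T 0 = 0" for T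
      using lin(2)[of "G x" T 0 0] by simp
    have sub: "subspace (dual_space s (G x))"
      by (simp add: subspace_def dual_space_def hodge_star_def bivectors_def lin t z
          scaleR_add_right scaleR_left_commute)
    have "?u \<alpha> \<in> dual_space s (G x)" for \<alpha>
    proof -
      have "sd_comp s (sd s \<alpha>) \<beta> = 4 * kd \<alpha> \<beta>" for \<beta>
        unfolding sd_comp_def sd_orthogonal[OF sign] by (simp add: kd_sym)
      then have "dual_proj s (G x) (?u \<alpha>) = (\<Sum>\<beta>\<in>UNIV. kd \<alpha> \<beta> *\<^sub>R ?u \<beta>)"
        by (subst dual_proj_up[OF x sd_skew]) simp
      also have "\<dots> = ?u \<alpha>"
        by (simp add: kd_def if_distrib[where f = "\<lambda>r. r *\<^sub>R _"] cong: if_cong)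
      finally have "s *\<^sub>R hodge_star (G x) (?u \<alpha>) = ?u \<alpha>"
        by (simp add: dual_proj_def vec_eq_iff)
      then have "s *\<^sub>R s *\<^sub>R hodge_star (G x) (?u \<alpha>) = s *\<^sub>R ?u \<alpha>" by simp
      then show ?thesis
        using up_skew[OF sd_skew, where x = x] sign by (simp add: dual_space_def)
    qed
    then show "span (range ?u) \<subseteq> dual_space s (G x)"
      by (intro span_minimal sub) auto
    show "dual_space s (G x) \<subseteq> span (range ?u)"
    proof
      fix \<alpha> assume \<alpha>: "\<alpha> \<in> dual_space s (G x)"
      define a where "a c d = (H x ** \<alpha> ** transpose (H x)) $ c $ d" for c d
      have T: "transpose (H x ** \<alpha> ** transpose (H x)) = - (H x ** \<alpha> ** transpose (H x))"
        using \<alpha> by (simp add: dual_space_def bivectors_def matrix_transpose_mul matrix_mul_assoc matrix_ring_simps)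
      have sk: "a m n = - a n m" for m n
        using arg_cong[OF T, of "\<lambda>M. M $ n $ m"] unfolding a_def by (simp add: transpose_def)
      have u: "up (C x) a = \<alpha>" using up_H[OF x, of \<alpha>] unfolding a_def[abs_def] .
      \<comment> \<open>On the eigenspace for s the projection is the identity since s * s = 1, so
        \<open>dual_proj_up\<close> expands \<alpha> in the basis.\<close>
      have "dual_proj s (G x) \<alpha> = \<alpha>"
        using \<alpha> sign by (simp add: dual_proj_def dual_space_def vec_eq_iff mult.assoc[symmetric])
      then have "\<alpha> = (\<Sum>\<beta>\<in>UNIV. (1/4 * sd_comp s a \<beta>) *\<^sub>R ?u \<beta>)"
        using dual_proj_up[where a = a, OF x sk] by (simp add: u)
      also have "\<dots> \<in> span (range ?u)"
        by (intro span_sum span_scale span_base) auto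
      finally show "\<alpha> \<in> span (range ?u)" .
    qed
  qed
qed

end

section \<open>Existence of orthonormal frames\<close>

definition gip :: "real^4^4 \<Rightarrow> real^4 \<Rightarrow> real^4 \<Rightarrow> real" where
  "gip h u v = (\<Sum>i\<in>UNIV. \<Sum>j\<in>UNIV. h $ i $ j * (u $ i * v $ j))"

lemma gip_linear:
  "gip h (u + u') v = gip h u v + gip h u' v" "gip h (r *\<^sub>R u) v = r * gip h u v"
  "gip h (sum f K) v = (\<Sum>k\<in>K. gip h (f k) v)" "gip h (u - u') v = gip h u v - gip h u' v"
  "gip h u (r *\<^sub>R v) = r * gip h u v"
proof -
  show add: "gip h (u + u') v = gip h u v + gip h u' v" for u u'
    by (simp add: gip_def distrib_left distrib_right sum.distrib)
  show "gip h (r *\<^sub>R u) v = r * gip h u v" "gip h (u - u') v = gip h u v - gip h u' v"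
    "gip h u (r *\<^sub>R v) = r * gip h u v"
    by (simp_all add: gip_def sum_distrib_left right_diff_distrib left_diff_distrib sum_subtractf mult_ac)
  show "gip h (sum f K) v = (\<Sum>k\<in>K. gip h (f k) v)"
    by (induction K rule: infinite_finite_induct) (simp_all add: add, simp_all add: gip_def)
qed

lemma gip_sym:
  assumes "transpose h = h"
  shows "gip h u v = gip h v u"
proof -
  have "h $ i $ j = h $ j $ i" for i j
    using arg_cong[OF assms, of "\<lambda>M. M $ j $ i"] by (simp add: transpose_def)
  then have "gip h u v = (\<Sum>i\<in>UNIV. \<Sum>j\<in>UNIV. h $ j $ i * (v $ j * u $ i))"
    unfolding gip_def by (intro sum.cong refl) (metis mult.commute)
  also have "\<dots> = gip h v u" unfolding gip_def by (rule sum.swap)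
  finally show ?thesis .
qed

text \<open>In the type \<open>4\<close> the numeral 4 equals 0. The induction therefore runs over
  natural numbers, and \<open>ix\<close> lists the coordinates in the order 1, 2, 3, 4.\<close>

definition ix :: "nat \<Rightarrow> 4" where
  "ix k = (if k = 0 then 1 else if k = 1 then 2 else if k = 2 then 3 else 4)"

lemma ix_inj: "k < 4 \<Longrightarrow> m < 4 \<Longrightarrow> ix k = ix m \<longleftrightarrow> k = m"
  by (auto simp: ix_def split: if_splits)

text \<open>Triangularity with positive diagonal is carried through the induction for two reasons:
  it makes the next vector nonzero, and it makes the determinant of the finished frame positive, so
  that the frame is oriented.\<close>

lemma gram_schmidt:
  assumes U: "open U" and G: "msmooth_on G U" and sym: "\<And>x. x \<in> U \<Longrightarrow> transpose (G x) = G x"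
    and pos: "\<And>x u. x \<in> U \<Longrightarrow> u \<noteq> 0 \<Longrightarrow> 0 < gip (G x) u u" and "k \<le> 4"
  shows "\<exists>E :: nat \<Rightarrow> real^4 \<Rightarrow> real^4. (\<forall>a<k. \<forall>i. smooth_on (\<lambda>x. E a x $ i) U) \<and>
    (\<forall>x\<in>U. \<forall>a<k. \<forall>b<k. gip (G x) (E a x) (E b x) = kd a b) \<and>
    (\<forall>x\<in>U. \<forall>a<k. 0 < E a x $ ix a \<and> (\<forall>m<4. a < m \<longrightarrow> E a x $ ix m = 0))"
  using \<open>k \<le> 4\<close>
proof (induction k)
  case 0
  show ?case by simp
next
  case (Suc k)
  then have k: "k < 4" by simp
  obtain E :: "nat \<Rightarrow> real^4 \<Rightarrow> real^4" where e:
    "\<forall>a<k. \<forall>i. smooth_on (\<lambda>x. E a x $ i) U"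
    "\<forall>x\<in>U. \<forall>a<k. \<forall>b<k. gip (G x) (E a x) (E b x) = kd a b"
    "\<forall>x\<in>U. \<forall>a<k. 0 < E a x $ ix a \<and> (\<forall>m<4. a < m \<longrightarrow> E a x $ ix m = 0)"
    using Suc.IH[OF less_imp_le[OF k]] by (elim exE conjE) (rule that)
  have E: "smooth_on (\<lambda>x. E a x $ i) U" if "a < k" for a i
    using e(1) that by simp
  have orth: "gip (G x) (E a x) (E b x) = kd a b" if "x \<in> U" "a < k" "b < k" for x a b
    using e(2) that by simp
  have tri: "0 < E a x $ ix a" "m < 4 \<Longrightarrow> a < m \<Longrightarrow> E a x $ ix m = 0" if "x \<in> U" "a < k" for x a m
    using e(3) that by simp_all
  \<comment> \<open>All earlier vectors vanish in the coordinate \<open>ix k\<close>, so v has entry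
    1 there; this replaces an argument about linear independence.\<close>
  define v where "v x = axis (ix k) 1 - (\<Sum>a<k. gip (G x) (axis (ix k) 1) (E a x) *\<^sub>R E a x)" for x
  define N where "N x = gip (G x) (v x) (v x)" for x
  define e where "e x = inverse (sqrt (N x)) *\<^sub>R v x" for x
  have vk: "v x $ ix k = 1" if "x \<in> U" for x
    using tri(2)[OF that _ k] by (simp add: v_def)
  have vm: "v x $ ix m = 0" if "x \<in> U" "m < 4" "k < m" for x m
    using tri(2)[OF that(1) _ that(2)] that ix_inj[OF k that(2)] by (simp add: v_def axis_def)
  have "v x \<noteq> 0" if "x \<in> U" for x using vk[OF that] by auto
  then have N: "0 < N x" if "x \<in> U" for x using pos that by (simp add: N_def)
  have ve: "gip (G x) (v x) (E b x) = 0" if "x \<in> U" "b < k" for x b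
  proof -
    have "gip (G x) (v x) (E b x) = gip (G x) (axis (ix k) 1) (E b x)
        - (\<Sum>a<k. gip (G x) (axis (ix k) 1) (E a x) * kd a b)"
      unfolding v_def gip_linear using orth[OF that(1) _ that(2)] by simp
    then show ?thesis using that(2) by (simp add: kd_def if_distrib cong: if_cong)
  qed
  have sv: "smooth_on (\<lambda>x. v x $ i) U" for i
    unfolding v_def gip_def
    by (simp, intro smooth_intros U msmooth_on_nth[OF G] E) simp_all
  have sN: "smooth_on N U"
    unfolding N_def[abs_def] gip_def by (intro smooth_intros U msmooth_on_nth[OF G] sv)
  have se: "smooth_on (\<lambda>x. e x $ i) U" for i
    unfolding e_def
    by (simp, rule smooth_on_mult[OF U smooth_on_inverse[OF U smooth_on_sqrt[OF U]] sv])
      (simp_all add: sN N less_imp_neq[OF N, THEN not_sym])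
  have ee: "gip (G x) (e x) (e x) = 1" if "x \<in> U" for x
  proof -
    have "gip (G x) (e x) (e x) = inverse (sqrt (N x)) * (inverse (sqrt (N x)) * N x)"
      unfolding e_def gip_linear N_def ..
    also have "\<dots> = 1" using N[OF that] by (simp add: field_simps)
    finally show ?thesis .
  qed
  have eE: "gip (G x) (e x) (E b x) = 0" "gip (G x) (E b x) (e x) = 0" if "x \<in> U" "b < k" for x b
    using ve[OF that] gip_sym[OF sym[OF that(1)], of "E b x" "e x"] by (simp_all add: e_def gip_linear)
  show ?case
  proof (intro exI[of _ "E(k := e)"] conjI allI ballI impI)
    fix x m a assume "x \<in> U" "a < Suc k" "m < (4::nat)" "a < m"
    then show "(E(k := e)) a x $ ix m = 0"
      using vm tri(2) by (cases "a = k") (auto simp: e_def)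
  next
    fix x a assume "x \<in> U" "a < Suc k"
    then show "0 < (E(k := e)) a x $ ix a"
      using vk N tri(1) by (cases "a = k") (auto simp: e_def)
  next
    fix x a b assume "x \<in> U" "a < Suc k" "b < Suc k"
    then show "gip (G x) ((E(k := e)) a x) ((E(k := e)) b x) = kd a b"
      using orth ee eE by (auto simp: less_Suc_eq kd_def)
  next
    fix a i assume "a < Suc k"
    then show "smooth_on (\<lambda>x. (E(k := e)) a x $ i) U"
      using E se by (auto simp: less_Suc_eq)
  qed
qed

lemma orthonormal_frame_exists:
  assumes U: "open U" and G: "msmooth_on G U" and sym: "\<And>x. x \<in> U \<Longrightarrow> transpose (G x) = G x"
    and pos: "\<And>x u. x \<in> U \<Longrightarrow> u \<noteq> 0 \<Longrightarrow> 0 < gip (G x) u u"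
  obtains C where "msmooth_on C U" "\<And>x. x \<in> U \<Longrightarrow> transpose (C x) ** G x ** C x = mat 1"
    "\<And>x. x \<in> U \<Longrightarrow> 0 < det (C x)"
proof -
  obtain E :: "nat \<Rightarrow> real^4 \<Rightarrow> real^4" where e:
    "\<forall>a<4. \<forall>i. smooth_on (\<lambda>x. E a x $ i) U"
    "\<forall>x\<in>U. \<forall>a<4. \<forall>b<4. gip (G x) (E a x) (E b x) = kd a b"
    "\<forall>x\<in>U. \<forall>a<4. 0 < E a x $ ix a \<and> (\<forall>m<4. a < m \<longrightarrow> E a x $ ix m = 0)"
    by (rule exE[OF gram_schmidt[OF U G sym pos order_refl]]) (assumption | elim conjE, rule that, assumption+)+
  have E: "smooth_on (\<lambda>x. E a x $ i) U" if "a < 4" for a i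
    using e(1) that by simp
  have orth: "gip (G x) (E a x) (E b x) = kd a b" if "x \<in> U" "a < 4" "b < 4" for x a b
    using e(2) that by simp
  have tri: "0 < E a x $ ix a" "m < 4 \<Longrightarrow> a < m \<Longrightarrow> E a x $ ix m = 0" if "x \<in> U" "a < 4" for x a m
    using e(3) that by simp_all
  define xi where "xi a = (if a = (1::4) then 0 else if a = 2 then 1 else if a = 3 then 2 else (3::nat))" for a
  have xi: "xi a < 4" "xi a = xi b \<longleftrightarrow> a = b" for a b
    using exhaust_4[of a] exhaust_4[of b] by (auto simp: xi_def)
  define C where "C x = (\<chi> i a. E (xi a) x $ i)" for x
  show ?thesis
  proof
    show "msmooth_on C U" using E xi by (simp add: msmooth_on_def C_def)
    fix x assume x: "x \<in> U"
    show "transpose (C x) ** G x ** C x = mat 1"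
    proof -
      have "(transpose (C x) ** G x ** C x) $ a $ b = gip (G x) (E (xi a) x) (E (xi b) x)" for a b
      proof -
        have "(transpose (C x) ** G x ** C x) $ a $ b
          = (\<Sum>j\<in>UNIV. \<Sum>i\<in>UNIV. G x $ i $ j * (E (xi a) x $ i * E (xi b) x $ j))"
          by (simp add: matrix_matrix_mult_def transpose_def C_def sum_distrib_left sum_distrib_right mult_ac)
        also have "\<dots> = gip (G x) (E (xi a) x) (E (xi b) x)" unfolding gip_def by (rule sum.swap)
        finally show ?thesis .
      qed
      then show ?thesis
        using orth[OF x] xi by (simp add: vec_eq_iff mat_def kd_def)
    qed
    have z: "C x $ 2 $ 1 = 0" "C x $ 3 $ 1 = 0" "C x $ 4 $ 1 = 0" "C x $ 3 $ 2 = 0" "C x $ 4 $ 2 = 0" "C x $ 4 $ 3 = 0"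
      using tri(2)[OF x, of 0 1] tri(2)[OF x, of 0 2] tri(2)[OF x, of 0 3] tri(2)[OF x, of 1 2]
        tri(2)[OF x, of 1 3] tri(2)[OF x, of 2 3]
      by (simp_all add: C_def xi_def ix_def)
    have p: "0 < C x $ 1 $ 1" "0 < C x $ 2 $ 2" "0 < C x $ 3 $ 3" "0 < C x $ 4 $ 4"
      using tri(1)[OF x, of 0] tri(1)[OF x, of 1] tri(1)[OF x, of 2] tri(1)[OF x, of 3]
      by (simp_all add: C_def xi_def ix_def)
    show "0 < det (C x)"
      unfolding det_4 by (simp add: z p)
  qed
qed

section \<open>The identity in a chart\<close>

text \<open>The norm of the half Weyl tensor equals \<open>mdot (A y) (A y)\<close> only on the
  domain of the frame, which suffices because derivatives are local.\<close>

lemma drift_laplacian_cong: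
  assumes "open S" "x \<in> S" "\<And>y. y \<in> S \<Longrightarrow> H y = K y"
  shows "drift_laplacian G F H x = drift_laplacian G F K x"
proof -
  have 1: "pd i H y = pd i K y" if "y \<in> S" for i y
    by (rule pd_cong_open[OF assms(1) that assms(3)])
  have 2: "pd i (pd j H) x = pd i (pd j K) x" for i j
    by (rule pd_cong_open[OF assms(1,2) 1])
  show ?thesis
    by (simp add: drift_laplacian_def laplacian_def hessian_def grad_inner_def 1[OF assms(2)] 2)
qed

locale conf_einstein_oriented = conf_einstein U G C s F L + oriented_frame U G C s
  for U G C s F L
begin

lemma cov_deriv_norm2_weyl_dual:
  assumes x: "x \<in> U"
  shows "cov_deriv_norm2 G (weyl_dual s G) x = (\<Sum>b\<in>UNIV. mdot (Pf x b) (Pf x b))"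
  unfolding cov_deriv_norm2_def cov_deriv_weyl_dual[OF x] tensor_inner_ww[OF x] ginv_trace[OF x]
    fr2_mdot_deriv ..

lemma half_weyl_identity:
  assumes x: "x \<in> U"
  shows "drift_laplacian G F (tensor_norm2 G (weyl_dual s G)) x =
    2 * cov_deriv_norm2 G (weyl_dual s G) x
    + (4 * L x - grad_inner G F F x) * tensor_norm2 G (weyl_dual s G) x - 36 * det_weyl_dual s G x"
proof -
  have "drift_laplacian G F (tensor_norm2 G (weyl_dual s G)) x = drift_laplacian G F (\<lambda>y. mdot (A y) (A y)) x"
    by (rule drift_laplacian_cong[OF open_U x tensor_norm2_weyl_dual])
  then show ?thesis
    by (simp only: drift_laplacian_A[OF x] cov_deriv_norm2_weyl_dual[OF x] tensor_norm2_weyl_dual[OF x]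
        det_weyl_dual_eq[OF x])
qed

end

lemma half_weyl_identity_chart:
  assumes U: "open U" and G: "msmooth_on G U" and sym: "\<And>x. x \<in> U \<Longrightarrow> transpose (G x) = G x"
    and pos: "\<And>x u. x \<in> U \<Longrightarrow> u \<noteq> 0 \<Longrightarrow> 0 < gip (G x) u u"
    and F: "smooth_on F U" and L: "smooth_on L U"
    and eq: "\<And>x i j. x \<in> U \<Longrightarrow>
      ricci G x i j + hessian G F x i j + 1/2 * (pd i F x * pd j F x) = L x * G x $ i $ j"
    and s: "s = 1 \<or> s = -1" and x: "x \<in> U"
  shows "drift_laplacian G F (tensor_norm2 G (weyl_dual s G)) x =
    2 * cov_deriv_norm2 G (weyl_dual s G) x
    + (4 * L x - grad_inner G F F x) * tensor_norm2 G (weyl_dual s G) x - 36 * det_weyl_dual s G x"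
proof -
  obtain C where C: "msmooth_on C U" "\<And>x. x \<in> U \<Longrightarrow> transpose (C x) ** G x ** C x = mat 1"
    "\<And>x. x \<in> U \<Longrightarrow> 0 < det (C x)"
    using orthonormal_frame_exists[OF U G sym pos] by blast
  interpret conf_einstein_oriented U G C s F L
    by unfold_locales (use assms C in auto)
  show ?thesis by (rule half_weyl_identity[OF x])
qed

section \<open>Charts\<close>

lemma differentiable_vec4:
  fixes f :: "real^4 \<Rightarrow> real^4"
  assumes "\<And>i. (\<lambda>x. f x $ i) differentiable (at x)"
  shows "f differentiable (at x)"
  using assms by (subst differentiable_componentwise_within) (auto simp: Basis_vec_def inner_axis)

context
  fixes M :: "'a topology" and A :: "'a chart set"
  assumes M: "oriented_4manifold M A"
begin

lemma chart_inj: "c \<in> A \<Longrightarrow> inj_on (snd c) (fst c)"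
proof -
  assume c: "c \<in> A"
  then have "homeomorphic_map (subtopology M (fst c)) (top_of_set (chart_range c)) (snd c)" "fst c \<subseteq> topspace M"
    using M openin_subset[of M "fst c"] by (auto simp: oriented_4manifold_def)
  then show ?thesis
    using homeomorphic_imp_injective_map[of "subtopology M (fst c)"]
    by (simp add: topspace_subtopology Int_absorb1)
qed

lemma chart_inv_apply [simp]: "c \<in> A \<Longrightarrow> p \<in> fst c \<Longrightarrow> chart_inv c (snd c p) = p"
  unfolding chart_inv_def by (rule inv_into_f_f[OF chart_inj])

lemma chart_inv_mem:
  assumes "x \<in> chart_range c"
  shows "chart_inv c x \<in> fst c" "snd c (chart_inv c x) = x"
  using assms inv_into_into[of x "snd c" "fst c"] f_inv_into_f[of x "snd c" "fst c"]
  by (simp_all add: chart_range_def chart_inv_def)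

lemma chart_range_open: "c \<in> A \<Longrightarrow> open (chart_range c)"
  using M by (auto simp: oriented_4manifold_def)

lemma chart_overlap_open:
  assumes c: "c \<in> A" and d: "d \<in> A"
  shows "open (snd c ` (fst c \<inter> fst d))"
proof -
  have h: "homeomorphic_map (subtopology M (fst c)) (top_of_set (chart_range c)) (snd c)"
    and o: "openin M (fst c)" "openin M (fst d)"
    using M c d by (auto simp: oriented_4manifold_def)
  have "openin (subtopology M (fst c)) (fst c \<inter> fst d)"
    by (rule openin_subtopology_Int2[OF o(2)])
  then have "openin (top_of_set (chart_range c)) (snd c ` (fst c \<inter> fst d))"
    using homeomorphic_imp_open_map[OF h] by (simp add: open_map_def)
  then show ?thesis
    using openin_open_trans chart_range_open[OF c] by blast
qed

lemma transition_differentiable: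
  assumes "c \<in> A" "d \<in> A" "p \<in> fst c" "p \<in> fst d"
  shows "transition c d differentiable (at (snd c p))"
proof (rule differentiable_vec4)
  fix i
  have "smooth_on (\<lambda>x. transition c d x $ i) (snd c ` (fst c \<inter> fst d))"
    using M assms(1,2) by (auto simp: oriented_4manifold_def)
  then show "(\<lambda>x. transition c d x $ i) differentiable (at (snd c p))"
    by (rule smooth_on_differentiable) (use assms in auto)
qed

text \<open>Chain rule: on the open overlap of c and d, the transition to e factors through d near
  the point.\<close>

lemma jacobian_cocycle:
  assumes A: "c \<in> A" "d \<in> A" "e \<in> A" and p: "p \<in> fst c" "p \<in> fst d" "p \<in> fst e"
  shows "jacobian (transition c e) (at (snd c p))
    = jacobian (transition d e) (at (snd d p)) ** jacobian (transition c d) (at (snd c p))"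
proof -
  let ?S = "snd c ` (fst c \<inter> fst d)"
  let ?J = "\<lambda>c d. jacobian (transition c d) (at (snd c p))"
  have D: "(transition c d has_derivative (\<lambda>h. ?J c d *v h)) (at (snd c p))"
    if "c \<in> A" "d \<in> A" "p \<in> fst c" "p \<in> fst d" for c d
    using transition_differentiable[OF that] by (simp add: jacobian_works[symmetric])
  have q: "transition c d (snd c p) = snd d p" using A p by (simp add: transition_def)
  have "(transition d e \<circ> transition c d has_derivative (\<lambda>h. ?J d e *v h) \<circ> (\<lambda>h. ?J c d *v h)) (at (snd c p))"
    by (rule diff_chain_at) (use D A p q in simp_all)
  then have "(transition c e has_derivative (\<lambda>h. ?J d e *v h) \<circ> (\<lambda>h. ?J c d *v h)) (at (snd c p))"
    by (rule has_derivative_transform_within_open[OF _ chart_overlap_open[OF A(1,2)]])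
      (use A p in \<open>auto simp: transition_def\<close>)
  from has_derivative_unique[OF D[OF A(1,3) p(1,3)] this]
  have "?J c e *v h = (?J d e ** ?J c d) *v h" for h
    by (simp add: fun_eq_iff matrix_vector_mul_assoc)
  then show ?thesis by (simp add: matrix_eq)
qed

lemma jacobian_refl:
  assumes "c \<in> A" "p \<in> fst c"
  shows "jacobian (transition c c) (at (snd c p)) = mat 1"
proof -
  have "((\<lambda>y. y) has_derivative (\<lambda>h. h)) (at (snd c p))" by (rule has_derivative_ident)
  then have "(transition c c has_derivative (\<lambda>h. h)) (at (snd c p))"
    by (rule has_derivative_transform_within_open[OF _ chart_range_open[OF assms(1)]])
      (use assms in \<open>auto simp: transition_def chart_range_def\<close>)
  then have "frechet_derivative (transition c c) (at (snd c p)) = (\<lambda>h. h)"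
    by (rule frechet_derivative_at[symmetric])
  then show ?thesis by (simp add: jacobian_def matrix_id_mat_1[unfolded id_def])
qed

lemma coord_vec_tangent:
  assumes "c \<in> A" "p \<in> fst c"
  shows "coord_vec A p c i \<in> tangent_space A p"
  unfolding tangent_space_def
proof (intro CollectI conjI ballI allI impI)
  fix d e assume "d \<in> A" "e \<in> A" "p \<in> fst d \<inter> fst e"
  then show "coord_vec A p c i e = jacobian (transition d e) (at (snd d p)) *v coord_vec A p c i d"
    using jacobian_cocycle[of c d e p] assms by (simp add: coord_vec_def matrix_vector_mul_assoc)
qed (auto simp: coord_vec_def)

lemma tangent_space_linear:
  assumes "u \<in> tangent_space A p" "v \<in> tangent_space A p"
  shows "(\<lambda>c. a *\<^sub>R u c + b *\<^sub>R v c) \<in> tangent_space A p"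
  unfolding tangent_space_def
proof (intro CollectI conjI ballI allI impI)
  fix d e assume "d \<in> A" "e \<in> A" "p \<in> fst d \<inter> fst e"
  then have "u e = jacobian (transition d e) (at (snd d p)) *v u d"
    "v e = jacobian (transition d e) (at (snd d p)) *v v d"
    using assms unfolding tangent_space_def by blast+
  then show "a *\<^sub>R u e + b *\<^sub>R v e
      = jacobian (transition d e) (at (snd d p)) *v (a *\<^sub>R u d + b *\<^sub>R v d)"
    by (simp only: matrix_vector_right_distrib matrix_vector_mult_scaleR)
qed (use assms in \<open>auto simp: tangent_space_def\<close>)

context
  fixes g :: "'a metric_field"
  assumes g: "riemannian_metric M A g"
begin

lemma metric_sum:
  assumes p: "p \<in> topspace M" and t: "\<And>i. t i \<in> tangent_space A p" and w: "w \<in> tangent_space A p"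
    and I: "finite I"
  shows "(\<lambda>c. \<Sum>i\<in>I. a i *\<^sub>R t i c) \<in> tangent_space A p
    \<and> g p (\<lambda>c. \<Sum>i\<in>I. a i *\<^sub>R t i c) w = (\<Sum>i\<in>I. a i * g p (t i) w)"
proof -
  have lin: "g p (\<lambda>c. a *\<^sub>R u c + b *\<^sub>R v c) w = a * g p u w + b * g p v w"
    if "u \<in> tangent_space A p" "v \<in> tangent_space A p" for u v a b
    using g p that w by (simp add: riemannian_metric_def inner_product_on_tangent_def)
  show ?thesis using I
  proof (induction I rule: finite_induct)
    case empty
    show ?case using tangent_space_linear[OF w w, of 0 0] lin[OF w w, of 0 0] by simp
  next
    case (insert i I)
    then show ?case
      using tangent_space_linear[OF t[of i], of "\<lambda>c. \<Sum>i\<in>I. a i *\<^sub>R t i c" "a i" 1]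
        lin[OF t[of i], of "\<lambda>c. \<Sum>i\<in>I. a i *\<^sub>R t i c" "a i" 1]
      by simp
  qed
qed

lemma metric_comp_chart:
  assumes c: "c \<in> A" and x: "x \<in> chart_range c"
  shows "transpose (metric_comp A g c x) = metric_comp A g c x"
    and "u \<noteq> 0 \<Longrightarrow> 0 < gip (metric_comp A g c x) u u"
proof -
  define p where "p = chart_inv c x"
  have p: "p \<in> fst c" "snd c p = x" using chart_inv_mem[OF x] by (simp_all add: p_def)
  have pM: "p \<in> topspace M"
    using M c p(1) by (auto simp: oriented_4manifold_def)
  let ?t = "coord_vec A p c"
  have t: "?t i \<in> tangent_space A p" for i by (rule coord_vec_tangent[OF c p(1)])
  have ip: "inner_product_on_tangent (tangent_space A p) (g p)"
    using g pM by (simp add: riemannian_metric_def)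
  have sym: "g p v w = g p w v" if "v \<in> tangent_space A p" "w \<in> tangent_space A p" for v w
    using ip that by (simp add: inner_product_on_tangent_def)
  show "transpose (metric_comp A g c x) = metric_comp A g c x"
    unfolding metric_comp_def transpose_def p_def[symmetric]
    by (simp add: vec_eq_iff) (intro allI sym t)
  assume u: "u \<noteq> 0"
  define v where "v = (\<lambda>d. \<Sum>i\<in>UNIV. u $ i *\<^sub>R ?t i d)"
  have v: "v \<in> tangent_space A p" "g p v w = (\<Sum>i\<in>UNIV. u $ i * g p (?t i) w)" if "w \<in> tangent_space A p" for w
    using metric_sum[OF pM t that finite, where a = "\<lambda>i. u $ i"] by (simp_all add: v_def)
  \<comment> \<open>The transition from c to itself has Jacobian 1, so the column of v in its own
    chart is u. Thus v is nonzero and positivity of the metric on tangent vectors applies to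
    it.\<close>
  have "v c = u"
  proof -
    have "?t i c = axis i 1" for i
      using c p jacobian_refl[OF c p(1)] by (simp add: coord_vec_def)
    then have "v c = (\<Sum>i\<in>UNIV. u $ i *s axis i 1)"
      by (simp add: v_def scalar_mult_eq_scaleR)
    then show ?thesis by (simp add: basis_expansion)
  qed
  then have "v \<noteq> (\<lambda>c. 0)" using u by auto
  then have "0 < g p v v"
    using ip v(1)[OF t] by (simp add: inner_product_on_tangent_def)
  also have "g p v v = (\<Sum>i\<in>UNIV. u $ i * (\<Sum>j\<in>UNIV. u $ j * g p (?t i) (?t j)))"
  proof -
    have "g p (?t i) v = (\<Sum>j\<in>UNIV. u $ j * g p (?t i) (?t j))" for i
      using sym[OF t v(1)[OF t]] v(2)[OF t] sym[OF t t] by simp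
    then show ?thesis using v(2)[OF v(1)[OF t]] by simp
  qed
  also have "\<dots> = gip (metric_comp A g c x) u u"
    by (simp add: gip_def metric_comp_def p_def sum_distrib_left mult_ac)
  finally show "0 < gip (metric_comp A g c x) u u" .
qed

end

end

theorem corollary1p1:
  fixes M :: "'a topology" and A :: "'a chart set" and g :: "'a metric_field"
    and f lam :: "'a \<Rightarrow> real" and s :: real
  assumes "oriented_4manifold M A"
    and "riemannian_metric M A g"
    and "smooth_function A f" and "smooth_function A lam"
    and "\<forall>c\<in>A. \<forall>x\<in>chart_range c. \<forall>i j.
           ricci (metric_comp A g c) x i j
           + hessian (metric_comp A g c) (f \<circ> chart_inv c) x i j
           + 1/2 * (pd i (f \<circ> chart_inv c) x * pd j (f \<circ> chart_inv c) x)
           = (lam \<circ> chart_inv c) x * metric_comp A g c x $ i $ j"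
    and "s = 1 \<or> s = -1"
  shows "\<forall>c\<in>A. \<forall>x\<in>chart_range c.
           (let G = metric_comp A g c; F = f \<circ> chart_inv c; L = lam \<circ> chart_inv c; W = weyl_dual s G
            in drift_laplacian G F (tensor_norm2 G W) x
               = 2 * cov_deriv_norm2 G W x
                 + (4 * L x - grad_inner G F F x) * tensor_norm2 G W x
                 - 36 * det_weyl_dual s G x)"
  unfolding Let_def
proof (intro ballI)
  fix c x
  assume c: "c \<in> A" and x: "x \<in> chart_range c"
  show "drift_laplacian (metric_comp A g c) (f \<circ> chart_inv c)
      (tensor_norm2 (metric_comp A g c) (weyl_dual s (metric_comp A g c))) x
    = 2 * cov_deriv_norm2 (metric_comp A g c) (weyl_dual s (metric_comp A g c)) x
      + (4 * (lam \<circ> chart_inv c) x - grad_inner (metric_comp A g c) (f \<circ> chart_inv c) (f \<circ> chart_inv c) x)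
        * tensor_norm2 (metric_comp A g c) (weyl_dual s (metric_comp A g c)) x
      - 36 * det_weyl_dual s (metric_comp A g c) x"
  proof (rule half_weyl_identity_chart[OF chart_range_open[OF assms(1) c] _ _ _ _ _ _ assms(6) x])
    show "msmooth_on (metric_comp A g c) (chart_range c)"
      using assms(2) c by (simp add: riemannian_metric_def msmooth_on_def)
    show "smooth_on (f \<circ> chart_inv c) (chart_range c)" "smooth_on (lam \<circ> chart_inv c) (chart_range c)"
      using assms(3,4) c by (simp_all add: smooth_function_def)
    fix y assume y: "y \<in> chart_range c"
    show "transpose (metric_comp A g c y) = metric_comp A g c y"
      by (rule metric_comp_chart(1)[OF assms(1,2) c y])
    show "0 < gip (metric_comp A g c y) u u" if "u \<noteq> 0" for u
      by (rule metric_comp_chart(2)[OF assms(1,2) c y that])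
    show "ricci (metric_comp A g c) y i j + hessian (metric_comp A g c) (f \<circ> chart_inv c) y i j
        + 1/2 * (pd i (f \<circ> chart_inv c) y * pd j (f \<circ> chart_inv c) y)
      = (lam \<circ> chart_inv c) y * metric_comp A g c y $ i $ j" for i j
      using assms(5) c y by blast
  qed
qed

end
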